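(* Let $r\in\mathbb{N}$ and let $f\in\mathcal{K}'_{M,r}(\mathbb{R}^n)$ (resp. $f\in\mathcal{S}'_r(\mathbb{R}^n)$). Let $\{q_\lambda f\}_{\lambda\in\mathbb{R}}$ be the (generalized) multiresolution expansion of $f$ in an $(M,r)$-regular (resp. $r$-regular) MRA. Then $$\lim_{\lambda\to\infty}(q_\lambda f)(\mathbf{x}_0)=f(\mathbf{x}_0)$$ at every point $\mathbf{x}_0\in\mathbb{R}^n$ where the distributional point value $f(\mathbf{x}_0)$ of $f$ exists and is of order $\le r$.
   Context: $\mathbb{N}=\{0,1,2,\dots\}$. $M:[0,\infty)\to[0,\infty)$ is a continuous increasing function with $M(t)+M(s)\le M(t+s)$ and $M(t+s)\le M(2t)+M(2s)$ for all $t,s\ge0$; write $M(\mathbf{x})=M(|\mathbf{x}|)$ for $\mathbf{x}\in\mathbb{R}^n$. $\mathcal{K}_{M,r}(\mathbb{R}^n)$ is the Fréchet space of all $\varphi\in C^r(\mathbb{R}^n)$ such that for every $l\in\mathbb{N}$ the norm $\nu_{r,l}(\varphi)=\sup_{|\alpha|\le r,\,\mathbf{x}\in\mathbb{R}^n}e^{M(l\mathbf{x})}|\varphi^{(\alpha)}(\mathbf{x})|$ is finite, topologized by these norms. $\mathcal{S}_r(\mathbb{R}^n)$ is the Fréchet space of all $\varphi\in C^r(\mathbb{R}^n)$ such that for every $l\in\mathbb{N}$ the norm $\rho_{r,l}(\varphi)=\sup_{|\alpha|\le r,\,\mathbf{x}\in\mathbb{R}^n}(1+|\mathbf{x}|)^l|\varphi^{(\alpha)}(\mathbf{x})|$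 is finite, topologized by these norms. $\mathcal{K}'_{M,r}$ and $\mathcal{S}'_r$ are the duals (spaces of distributions). MRA: an increasing sequence $\{V_j\}_{j\in\mathbb{Z}}$ of closed linear subspaces of $L^2(\mathbb{R}^n)$ such that (i) $f\in V_j\Leftrightarrow f(2\,\cdot)\in V_{j+1}$; (ii) $f\in V_0\Leftrightarrow f(\cdot-\mathbf{m})\in V_0$ for $\mathbf{m}\in\mathbb{Z}^n$; (iii) $\bigcap_jV_j=\{0\}$ and $\overline{\bigcup_jV_j}=L^2(\mathbb{R}^n)$; (iv) there is a scaling function $\phi\in L^2(\mathbb{R}^n)$ such that $\{\phi(\cdot-\mathbf{m})\}_{\mathbf{m}\in\mathbb{Z}^n}$ is an orthonormal basis of $V_0$. The MRA is $(M,r)$-regular (resp. $r$-regular) if the scaling function can be chosen in $\mathcal{K}_{M,r}(\mathbb{R}^n)$ (resp. $\mathcal{S}_r(\mathbb{R}^n)$); such a $\phi$ is then fixed. Put $q_0(\mathbf{x},\mathbf{y})=\sum_{\mathbf{m}\in\mathbb{Z}^n}\phi(\mathbf{x}-\mathbf{m})\overline{\phi(\mathbf{y}-\mathbf{m})}$ and, for $\lambda\in\mathbb{R}$, $q_\lambda(\mathbf{x},\mathbf{y})=2^{n\lambda}q_0(2^\lambda\mathbf{x},2^\lambda\mathbf{y})$ and $(q_\lambda f)(\mathbf{x})=\langle f(\mathbf{y}),q_\lambda(\mathbf{x},\mathbf{y})\rangle_{\mathbf{y}}$ (bilinear pairing). $\langle f(\mathbf{x}_0+\varepsilon\mathbf{x}),\varphi(\mathbf{x})\rangle=|\varepsilon|^{-n}\langle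 f(\mathbf{y}),\varphi((\mathbf{y}-\mathbf{x}_0)/\varepsilon)\rangle$. A distribution $f$ has distributional point value $f(\mathbf{x}_0)=\gamma$ if $\lim_{\varepsilon\to0}\langle f(\mathbf{x}_0+\varepsilon\mathbf{x}),\varphi(\mathbf{x})\rangle=\gamma\int_{\mathbb{R}^n}\varphi(\mathbf{x})\,d\mathbf{x}$ for all $\varphi\in\mathcal{D}(\mathbb{R}^n)$. It is of order $\le r$ if this limit holds uniformly for $\varphi$ in bounded subsets of $\mathcal{D}^r(\mathbb{R}^n)$, the space of compactly supported $C^r$ functions (bounded: supports in a common compact set, and all derivatives of order $\le r$ uniformly bounded). *)

theory Defs
  imports "HOL-Analysis.Analysis"
begin

definition partial_deriv :: "'n \<Rightarrow> (real^'n::finite \<Rightarrow> complex) \<Rightarrow> real^'n \<Rightarrow> complex" where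
  "partial_deriv i f x = vector_derivative (\<lambda>t. f (x + t *\<^sub>R axis i 1)) (at 0)"

fun Cr_fun :: "nat \<Rightarrow> (real^'n::finite \<Rightarrow> complex) \<Rightarrow> bool" where
  "Cr_fun 0 f \<longleftrightarrow> continuous_on UNIV f"
| "Cr_fun (Suc r) f \<longleftrightarrow> continuous_on UNIV f \<and>
     (\<forall>i. (\<forall>x. (\<lambda>t. f (x + t *\<^sub>R axis i 1)) differentiable (at (0::real))) \<and>
          Cr_fun r (partial_deriv i f))"

text \<open>An arbitrary but fixed enumeration of the coordinates; the derivative below is applied
  only to functions of class C^r and orders at most r, where it does not depend on this choice.\<close>

definition coords :: "'n::finite list" where
  "coords = (SOME is. distinct is \<and> set is = UNIV)"

definition multi_deriv :: "('n \<Rightarrow> nat) \<Rightarrow> (real^'n::finite \<Rightarrow> complex) \<Rightarrow> real^'n \<Rightarrow> complex" where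
  "multi_deriv \<alpha> f = foldr (\<lambda>i g. (partial_deriv i ^^ \<alpha> i) g) coords f"

definition multi_indices :: "nat \<Rightarrow> ('n::finite \<Rightarrow> nat) set" where
  "multi_indices r = {\<alpha>. (\<Sum>i\<in>UNIV. \<alpha> i) \<le> r}"

text \<open>Superadditivity and nonnegativity already make \<open>M\<close> nondecreasing, so ``increasing'' is read
  strictly; this excludes \<open>M = 0\<close>, for which the norms below impose no decay.\<close>

definition weight_function :: "(real \<Rightarrow> real) \<Rightarrow> bool" where
  "weight_function M \<longleftrightarrow>
     continuous_on {0..} M \<and> strict_mono_on {0..} M \<and> (\<forall>t\<ge>0. M t \<ge> 0) \<and>
     (\<forall>t\<ge>0. \<forall>s\<ge>0. M t + M s \<le> M (t + s)) \<and>
     (\<forall>t\<ge>0. \<forall>s\<ge>0. M (t + s) \<le> M (2 * t) + M (2 * s))"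

text \<open>The suprema are taken in the extended nonnegative reals, so that finiteness of the
  norms is the condition that they differ from infinity.\<close>

definition nu_norm :: "(real \<Rightarrow> real) \<Rightarrow> nat \<Rightarrow> nat \<Rightarrow> (real^'n::finite \<Rightarrow> complex) \<Rightarrow> ennreal" where
  "nu_norm M r l \<phi> =
     (SUP \<alpha>\<in>multi_indices r. SUP x. ennreal (exp (M (norm (real l *\<^sub>R x))) * cmod (multi_deriv \<alpha> \<phi> x)))"

definition rho_norm :: "nat \<Rightarrow> nat \<Rightarrow> (real^'n::finite \<Rightarrow> complex) \<Rightarrow> ennreal" where
  "rho_norm r l \<phi> =
     (SUP \<alpha>\<in>multi_indices r. SUP x. ennreal ((1 + norm x) ^ l * cmod (multi_deriv \<alpha> \<phi> x)))"

definition KM_space :: "(real \<Rightarrow> real) \<Rightarrow> nat \<Rightarrow> (real^'n::finite \<Rightarrow> complex) set" where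
  "KM_space M r = {\<phi>. Cr_fun r \<phi> \<and> (\<forall>l. nu_norm M r l \<phi> < \<infinity>)}"

definition S_space :: "nat \<Rightarrow> (real^'n::finite \<Rightarrow> complex) set" where
  "S_space r = {\<phi>. Cr_fun r \<phi> \<and> (\<forall>l. rho_norm r l \<phi> < \<infinity>)}"

definition norms_topology ::
  "(real^'n::finite \<Rightarrow> complex) set \<Rightarrow> (nat \<Rightarrow> (real^'n \<Rightarrow> complex) \<Rightarrow> ennreal) \<Rightarrow> (real^'n \<Rightarrow> complex) topology" where
  "norms_topology X p = topology_generated_by
     {{\<psi>\<in>X. p l (\<lambda>x. \<psi> x - \<phi> x) < ennreal e} | l \<phi> e. \<phi> \<in> X \<and> e > 0}"

text \<open>Functionals are total functions in HOL; only their values on \<open>X\<close> are constrained.\<close>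

definition continuous_dual ::
  "(real^'n::finite \<Rightarrow> complex) set \<Rightarrow> (nat \<Rightarrow> (real^'n \<Rightarrow> complex) \<Rightarrow> ennreal)
    \<Rightarrow> ((real^'n \<Rightarrow> complex) \<Rightarrow> complex) set" where
  "continuous_dual X p = {f.
     (\<forall>\<phi>\<in>X. \<forall>\<psi>\<in>X. f (\<lambda>x. \<phi> x + \<psi> x) = f \<phi> + f \<psi>) \<and>
     (\<forall>c. \<forall>\<phi>\<in>X. f (\<lambda>x. c * \<phi> x) = c * f \<phi>) \<and>
     continuous_map (norms_topology X p) euclidean f}"

definition KM_dual :: "(real \<Rightarrow> real) \<Rightarrow> nat \<Rightarrow> ((real^'n::finite \<Rightarrow> complex) \<Rightarrow> complex) set" where
  "KM_dual M r = continuous_dual (KM_space M r) (nu_norm M r)"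

definition S_dual :: "nat \<Rightarrow> ((real^'n::finite \<Rightarrow> complex) \<Rightarrow> complex) set" where
  "S_dual r = continuous_dual (S_space r) (rho_norm r)"

text \<open>Elements of L^2 are represented by functions, not by classes modulo null sets; the
  closure operator below saturates a set under almost everywhere equality.\<close>

definition L2 :: "(real^'n::finite \<Rightarrow> complex) set" where
  "L2 = {f \<in> borel_measurable lebesgue. integrable lebesgue (\<lambda>x. (cmod (f x))\<^sup>2)}"

definition L2_norm_fun :: "(real^'n::finite \<Rightarrow> complex) \<Rightarrow> real" where
  "L2_norm_fun f = sqrt (LINT x|lebesgue. (cmod (f x))\<^sup>2)"

definition L2_inner :: "(real^'n::finite \<Rightarrow> complex) \<Rightarrow> (real^'n \<Rightarrow> complex) \<Rightarrow> complex" where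
  "L2_inner f g = (LINT x|lebesgue. f x * cnj (g x))"

definition L2_closure :: "(real^'n::finite \<Rightarrow> complex) set \<Rightarrow> (real^'n \<Rightarrow> complex) set" where
  "L2_closure A = {f \<in> L2. \<exists>u. (\<forall>k::nat. u k \<in> A) \<and>
     (\<lambda>k. L2_norm_fun (\<lambda>x. u k x - f x)) \<longlonglongrightarrow> 0}"

definition L2_closed_subspace :: "(real^'n::finite \<Rightarrow> complex) set \<Rightarrow> bool" where
  "L2_closed_subspace V \<longleftrightarrow> V \<subseteq> L2 \<and> (\<lambda>x. 0) \<in> V \<and>
     (\<forall>f\<in>V. \<forall>g\<in>V. (\<lambda>x. f x + g x) \<in> V) \<and>
     (\<forall>c. \<forall>f\<in>V. (\<lambda>x. c * f x) \<in> V) \<and>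
     L2_closure V = V"

definition family_span :: "('i \<Rightarrow> real^'n::finite \<Rightarrow> complex) \<Rightarrow> (real^'n \<Rightarrow> complex) set" where
  "family_span e = {\<lambda>x. \<Sum>i\<in>F. c i * e i x | F c. finite F}"

definition orthonormal_basis ::
  "('i \<Rightarrow> real^'n::finite \<Rightarrow> complex) \<Rightarrow> (real^'n \<Rightarrow> complex) set \<Rightarrow> bool" where
  "orthonormal_basis e V \<longleftrightarrow> (\<forall>i. e i \<in> V) \<and>
     (\<forall>i j. L2_inner (e i) (e j) = (if i = j then 1 else 0)) \<and>
     L2_closure (family_span e) = V"

definition lattice_point :: "int^'n::finite \<Rightarrow> real^'n" where
  "lattice_point m = (\<chi> i. of_int (m $ i))"

definition scaling_function ::
  "(int \<Rightarrow> (real^'n::finite \<Rightarrow> complex) set) \<Rightarrow> (real^'n \<Rightarrow> complex) \<Rightarrow> bool" where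
  "scaling_function V \<phi> \<longleftrightarrow> \<phi> \<in> L2 \<and>
     orthonormal_basis (\<lambda>m::int^'n. \<lambda>x. \<phi> (x - lattice_point m)) (V 0)"

definition MRA :: "(int \<Rightarrow> (real^'n::finite \<Rightarrow> complex) set) \<Rightarrow> bool" where
  "MRA V \<longleftrightarrow>
     (\<forall>j. L2_closed_subspace (V j)) \<and> mono V \<and>
     (\<forall>j f. f \<in> V j \<longleftrightarrow> (\<lambda>x. f (2 *\<^sub>R x)) \<in> V (j + 1)) \<and>
     (\<forall>f m. f \<in> V 0 \<longleftrightarrow> (\<lambda>x. f (x - lattice_point m)) \<in> V 0) \<and>
     (\<Inter>j. V j) = {f \<in> L2. AE x in lebesgue. f x = 0} \<and>
     L2_closure (\<Union>j. V j) = L2 \<and>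
     (\<exists>\<phi>. scaling_function V \<phi>)"

definition q0_kernel :: "(real^'n::finite \<Rightarrow> complex) \<Rightarrow> real^'n \<Rightarrow> real^'n \<Rightarrow> complex" where
  "q0_kernel \<phi> x y =
     (\<Sum>\<^sub>\<infinity>m::int^'n. \<phi> (x - lattice_point m) * cnj (\<phi> (y - lattice_point m)))"

definition q_kernel :: "(real^'n::finite \<Rightarrow> complex) \<Rightarrow> real \<Rightarrow> real^'n \<Rightarrow> real^'n \<Rightarrow> complex" where
  "q_kernel \<phi> l x y = of_real (2 powr (real CARD('n) * l)) *
     q0_kernel \<phi> ((2 powr l) *\<^sub>R x) ((2 powr l) *\<^sub>R y)"

definition mra_expansion ::
  "(real^'n::finite \<Rightarrow> complex) \<Rightarrow> real \<Rightarrow> ((real^'n \<Rightarrow> complex) \<Rightarrow> complex) \<Rightarrow> real^'n \<Rightarrow> complex" where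
  "mra_expansion \<phi> l f x = f (\<lambda>y. q_kernel \<phi> l x y)"

definition compactly_supported :: "(real^'n::finite \<Rightarrow> complex) \<Rightarrow> bool" where
  "compactly_supported \<phi> \<longleftrightarrow> compact (closure {x. \<phi> x \<noteq> 0})"

definition Dr_space :: "nat \<Rightarrow> (real^'n::finite \<Rightarrow> complex) set" where
  "Dr_space r = {\<phi>. Cr_fun r \<phi> \<and> compactly_supported \<phi>}"

definition D_space :: "(real^'n::finite \<Rightarrow> complex) set" where
  "D_space = {\<phi>. (\<forall>k. Cr_fun k \<phi>) \<and> compactly_supported \<phi>}"

definition Dr_bounded :: "nat \<Rightarrow> (real^'n::finite \<Rightarrow> complex) set \<Rightarrow> bool" where
  "Dr_bounded r B \<longleftrightarrow> B \<subseteq> Dr_space r \<and>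
     (\<exists>K. compact K \<and> (\<forall>\<phi>\<in>B. closure {x. \<phi> x \<noteq> 0} \<subseteq> K)) \<and>
     (\<exists>C. \<forall>\<phi>\<in>B. \<forall>\<alpha>\<in>multi_indices r. \<forall>x. cmod (multi_deriv \<alpha> \<phi> x) \<le> C)"

text \<open>This is the pairing of \<open>f (x0 + \<epsilon> x)\<close>, a distribution in \<open>x\<close>, with \<open>\<phi>\<close>.\<close>

definition dilated_pairing ::
  "((real^'n::finite \<Rightarrow> complex) \<Rightarrow> complex) \<Rightarrow> real^'n \<Rightarrow> real \<Rightarrow> (real^'n \<Rightarrow> complex) \<Rightarrow> complex" where
  "dilated_pairing f x0 \<epsilon> \<phi> =
     f (\<lambda>y. \<phi> ((y - x0) /\<^sub>R \<epsilon>)) / of_real (\<bar>\<epsilon>\<bar> ^ CARD('n))"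

definition has_point_value ::
  "((real^'n::finite \<Rightarrow> complex) \<Rightarrow> complex) \<Rightarrow> real^'n \<Rightarrow> complex \<Rightarrow> bool" where
  "has_point_value f x0 \<gamma> \<longleftrightarrow>
     (\<forall>\<phi>\<in>D_space. ((\<lambda>\<epsilon>. dilated_pairing f x0 \<epsilon> \<phi>) \<longlongrightarrow> \<gamma> * (LINT x|lebesgue. \<phi> x)) (at 0))"

definition point_value_order_le ::
  "nat \<Rightarrow> ((real^'n::finite \<Rightarrow> complex) \<Rightarrow> complex) \<Rightarrow> real^'n \<Rightarrow> complex \<Rightarrow> bool" where
  "point_value_order_le r f x0 \<gamma> \<longleftrightarrow>
     (\<forall>B. Dr_bounded r B \<longrightarrow>
        uniform_limit B (\<lambda>\<epsilon> \<phi>. dilated_pairing f x0 \<epsilon> \<phi>) (\<lambda>\<phi>. \<gamma> * (LINT x|lebesgue. \<phi> x)) (at 0))"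

end

(* The kernel q_lambda(x0, .) is eps^(-n) kappa((y - x0)/eps) with eps = 2^(-lambda), where
   kappa = q_0(x0/eps, x0/eps + .) is bounded, with its derivatives of order at most r, by a rapidly
   decreasing function that does not depend on eps.  Hence (q_lambda f)(x0) is the pairing of
   f(x0 + eps z) with kappa(z).  Fix a C^r cutoff theta that equals 1 near the origin.  The pairing with
   theta(z/2^k) kappa(z) is telescoped over dyadic scales: each difference, rescaled by 2^k, lies in a
   bounded set of compactly supported C^r functions and has norm O(2^(-k(n+1))), so the point
   value of order at most r controls the sum as long as 2^k eps stays below a fixed delta.  The
   remaining part lives where |y - x0| is bounded below and is O(eps) by continuity of f.

   The limit is gamma times the integral of kappa, which equals 1: for the indicator function G_j of a ball
   of radius comparable to 2^j, density of the union of the V_j bounds the squared L^2 distance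
   of G_j to V_0 by a small multiple of 2^(jn), while on the cube [0,2^j)^n the projection of G_j
   is close to the periodic function h(x) = integral of q_0(x, .).  Hence h = 1 almost everywhere, and
   everywhere by continuity. *)

theory Submission
  imports Defs
begin

section \<open>Bounds on iterated partial derivatives\<close>

text \<open>The profile varies with the scale and is not compactly supported, so convergence against
  a fixed test function says nothing about it; uniformity over bounded sets is what the order of the
  point value supplies. The shell estimate is a balance: decay of order n + r + 1 loses r to the
  derivatives of the rescaled profile, and the change of variables costs a further 2^(kn), so 2^(-k)
  remains. For the outer part the functional costs s^(n + r) with s = 1/eps, and decay of order n +
  r + 1 beyond a radius comparable to s leaves 1/s. The constant 1 is not square integrable, so the
  axioms cannot be applied to it directly; balls of growing radius replace it, and errors are
  measured against their volume. Periodicity then turns a small mean error over a large cube into a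
  small error over one cell. Both classes of test functions are treated at once: the argument only
  uses weights that are at least 1, nondecreasing, multiply, split over sums and dominate
  polynomials.\<close>

abbreviation has_partial_deriv ::
  "'n \<Rightarrow> (real^'n::finite \<Rightarrow> complex) \<Rightarrow> complex \<Rightarrow> real^'n \<Rightarrow> bool" where
  "has_partial_deriv i f d x \<equiv>
     ((\<lambda>t. f (x + t *\<^sub>R axis i 1)) has_vector_derivative d) (at (0::real))"

lemma partial_deriv_eqI: "has_partial_deriv i f d x \<Longrightarrow> partial_deriv i f x = d"
  unfolding partial_deriv_def by (rule vector_derivative_at)

lemma partially_differentiable_iff:
  "(\<lambda>t. f (x + t *\<^sub>R axis i 1)) differentiable (at (0::real)) \<longleftrightarrow>
     has_partial_deriv i f (partial_deriv i f x) x"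
  unfolding partial_deriv_def by (simp add: vector_derivative_works)

text \<open>The derivative is given at parameter 0 for every base point, so moving the base point
  along the line gives it at every t. The fundamental theorem of calculus and termwise
  differentiation need this form.\<close>

lemma has_partial_deriv_along:
  assumes "\<And>y. has_partial_deriv i f (g y) y"
  shows "((\<lambda>t. f (x + t *\<^sub>R axis i 1)) has_vector_derivative g (x + t *\<^sub>R axis i 1)) (at t within S)"
proof -
  have "((\<lambda>s. s - t) has_vector_derivative 1) (at t)"
    by (auto intro!: derivative_eq_intros)
  then have "((\<lambda>s. f ((x + t *\<^sub>R axis i 1) + (s - t) *\<^sub>R axis i 1)) has_vector_derivative
      1 *\<^sub>R g (x + t *\<^sub>R axis i 1)) (at t)"
    using vector_diff_chain_at[of "\<lambda>s. s - t" 1 t "\<lambda>s. f ((x + t *\<^sub>R axis i 1) + s *\<^sub>R axis i 1)"]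
      assms[of "x + t *\<^sub>R axis i 1"]
    by (simp add: o_def)
  then show ?thesis
    by (auto simp: algebra_simps intro: has_vector_derivative_at_within)
qed

text \<open>Bounds the partial derivatives up to order r, taken in every order of differentiation,
  by one majorant. The recursion follows \<open>Cr_fun\<close>, so sums, products and series are
  handled by induction on r without multi-indices; a pointwise majorant can record decay and support
  as well as size.\<close>

fun Cr_bound :: "nat \<Rightarrow> (real^'n \<Rightarrow> real) \<Rightarrow> (real^'n::finite \<Rightarrow> complex) \<Rightarrow> bool" where
  "Cr_bound 0 w f \<longleftrightarrow> continuous_on UNIV f \<and> (\<forall>x. cmod (f x) \<le> w x)"
| "Cr_bound (Suc r) w f \<longleftrightarrow> continuous_on UNIV f \<and> (\<forall>x. cmod (f x) \<le> w x) \<and>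
     (\<forall>i. (\<forall>x. has_partial_deriv i f (partial_deriv i f x) x) \<and> Cr_bound r w (partial_deriv i f))"

lemma Cr_bound_imp_Cr_fun: "Cr_bound r w f \<Longrightarrow> Cr_fun r f"
  by (induction r arbitrary: f) (auto simp: partially_differentiable_iff)

lemma Cr_bound_continuous: "Cr_bound r w f \<Longrightarrow> continuous_on UNIV f"
  by (cases r) auto

lemma Cr_bound_le: "Cr_bound r w f \<Longrightarrow> cmod (f x) \<le> w x"
  by (cases r) auto

lemma Cr_bound_nonneg: "Cr_bound r w f \<Longrightarrow> 0 \<le> w x"
  using Cr_bound_le norm_ge_zero order_trans by blast

lemma Cr_bound_SucD: "Cr_bound (Suc r) w f \<Longrightarrow> Cr_bound r w f"
  by (induction r arbitrary: f) auto

lemma Cr_bound_mono: "Cr_bound r w f \<Longrightarrow> (\<And>x. w x \<le> w' x) \<Longrightarrow> Cr_bound r w' f"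
proof (induction r arbitrary: f)
  case 0
  then show ?case by (meson Cr_bound.simps(1) order_trans)
next
  case (Suc r)
  then show ?case by (meson Cr_bound.simps(2) order_trans)
qed

lemma Cr_bound_SucI:
  assumes "continuous_on UNIV f" "\<And>x. cmod (f x) \<le> w x"
    and "\<And>i x. has_partial_deriv i f (g i x) x" "\<And>i. Cr_bound r w (g i)"
  shows "Cr_bound (Suc r) w f"
proof -
  have "partial_deriv i f = g i" for i
    using assms(3) by (auto intro!: ext partial_deriv_eqI)
  with assms show ?thesis by simp
qed

lemma Cr_bound_add:
  "Cr_bound r v f \<Longrightarrow> Cr_bound r w g \<Longrightarrow> Cr_bound r (\<lambda>x. v x + w x) (\<lambda>x. f x + g x)"
proof (induction r arbitrary: f g)
  case 0
  then show ?case by (auto intro!: continuous_intros norm_triangle_mono)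
next
  case (Suc r)
  show ?case
    by (rule Cr_bound_SucI[where g="\<lambda>i x. partial_deriv i f x + partial_deriv i g x"])
      (use Suc in \<open>auto intro!: continuous_intros norm_triangle_mono has_vector_derivative_add\<close>)
qed

lemma Cr_bound_cmult:
  "Cr_bound r w f \<Longrightarrow> Cr_bound r (\<lambda>x. cmod c * w x) (\<lambda>x. c * f x)"
proof (induction r arbitrary: f)
  case 0
  then show ?case by (auto intro!: continuous_intros mult_left_mono simp: norm_mult)
next
  case (Suc r)
  show ?case
    by (rule Cr_bound_SucI[where g="\<lambda>i x. c * partial_deriv i f x"])
      (use Suc in \<open>auto intro!: continuous_intros mult_left_mono has_vector_derivative_mult_right simp: norm_mult\<close>)
qed

lemma Cr_bound_diff:
  assumes "Cr_bound r v f" "Cr_bound r w g"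
  shows "Cr_bound r (\<lambda>x. v x + w x) (\<lambda>x. f x - g x)"
  using Cr_bound_add[OF assms(1) Cr_bound_cmult[OF assms(2), of "-1"]] by simp

lemma Cr_bound_cnj: "Cr_bound r w f \<Longrightarrow> Cr_bound r w (\<lambda>x. cnj (f x))"
proof (induction r arbitrary: f)
  case 0
  then show ?case by (auto intro!: continuous_intros)
next
  case (Suc r)
  show ?case
    by (rule Cr_bound_SucI[where g="\<lambda>i x. cnj (partial_deriv i f x)"])
      (use Suc in \<open>auto intro!: continuous_intros has_vector_derivative_cnj\<close>)
qed

lemma Cr_bound_const: "Cr_bound r (\<lambda>x. cmod c) (\<lambda>x. c)"
proof -
  have "Cr_bound k (\<lambda>x. 0) (\<lambda>x::real^'n. 0)" for k
    by (induction k) (auto intro!: Cr_bound_SucI simp del: Cr_bound.simps(2))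
  then have "Cr_bound k (\<lambda>x. cmod c) (\<lambda>x::real^'n. 0)" for k
    by (rule Cr_bound_mono) simp
  then show ?thesis
    by (cases r) (auto intro!: Cr_bound_SucI[where g="\<lambda>_ _. 0"] simp del: Cr_bound.simps(2))
qed

text \<open>The product rule turns one product into two at each order, hence the factor 2^r.\<close>

lemma Cr_bound_mult:
  "Cr_bound r v f \<Longrightarrow> Cr_bound r w g \<Longrightarrow> Cr_bound r (\<lambda>x. 2 ^ r * v x * w x) (\<lambda>x. f x * g x)"
proof (induction r arbitrary: f g)
  case 0
  then have "0 \<le> v x" "0 \<le> w x" for x
    using Cr_bound_nonneg by blast+
  with 0 show ?case
    by (auto intro!: continuous_intros mult_mono simp: norm_mult)
next
  case (Suc r)
  have v: "0 \<le> v x" and w: "0 \<le> w x" for x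
    using Suc.prems Cr_bound_nonneg by blast+
  have 1: "cmod (f x) \<le> v x" "cmod (g x) \<le> w x" for x
    using Suc.prems by auto
  have 2: "(2::real) ^ Suc r \<ge> 1" by (rule one_le_power) simp
  show ?case
  proof (rule Cr_bound_SucI[where g="\<lambda>i x. f x * partial_deriv i g x + partial_deriv i f x * g x"])
    show "continuous_on UNIV (\<lambda>x. f x * g x)"
      using Suc.prems by (auto intro!: continuous_intros)
    show "cmod (f x * g x) \<le> 2 ^ Suc r * v x * w x" for x
    proof -
      have "cmod (f x * g x) \<le> 1 * (v x * w x)"
        using 1 v w by (auto simp: norm_mult intro!: mult_mono)
      also have "\<dots> \<le> 2 ^ Suc r * (v x * w x)"
        using 2 v w by (intro mult_right_mono) auto
      finally show ?thesis by (simp add: mult.assoc)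
    qed
    show "has_partial_deriv i (\<lambda>x. f x * g x) (f x * partial_deriv i g x + partial_deriv i f x * g x) x" for i x
      using has_vector_derivative_mult[of "\<lambda>t. f (x + t *\<^sub>R axis i 1)" "partial_deriv i f x" 0 UNIV
          "\<lambda>t. g (x + t *\<^sub>R axis i 1)" "partial_deriv i g x"] Suc.prems by simp
    show "Cr_bound r (\<lambda>x. 2 ^ Suc r * v x * w x) (\<lambda>x. f x * partial_deriv i g x + partial_deriv i f x * g x)" for i
      using Cr_bound_add[OF Suc.IH[OF Cr_bound_SucD[OF Suc.prems(1)], of "partial_deriv i g"]
          Suc.IH[OF _ Cr_bound_SucD[OF Suc.prems(2)], of "partial_deriv i f"]] Suc.prems
      by (simp add: algebra_simps)
  qed
qed

text \<open>A derivative of order k brings out a^k; the power of the maximum covers all k up to r,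
  whether a is large or small.\<close>

lemma Cr_bound_affine:
  "Cr_bound r w f \<Longrightarrow>
     Cr_bound r (\<lambda>x. max 1 \<bar>a\<bar> ^ r * w (a *\<^sub>R x + b)) (\<lambda>x. f (a *\<^sub>R x + b))"
proof (induction r arbitrary: f)
  case 0
  then show ?case
    by (auto intro!: continuous_intros continuous_on_compose2[of UNIV f])
next
  case (Suc r)
  let ?m = "max 1 \<bar>a\<bar>"
  have w: "0 \<le> w x" for x using Suc.prems Cr_bound_nonneg by blast
  show ?case
  proof (rule Cr_bound_SucI[where g="\<lambda>i x. of_real a * partial_deriv i f (a *\<^sub>R x + b)"])
    show "continuous_on UNIV (\<lambda>x. f (a *\<^sub>R x + b))"
      using Suc.prems by (auto intro!: continuous_intros continuous_on_compose2[of UNIV f])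
    show "cmod (f (a *\<^sub>R x + b)) \<le> ?m ^ Suc r * w (a *\<^sub>R x + b)" for x
    proof -
      have "cmod (f (a *\<^sub>R x + b)) \<le> 1 * w (a *\<^sub>R x + b)"
        using Suc.prems by auto
      also have "\<dots> \<le> ?m ^ Suc r * w (a *\<^sub>R x + b)"
        using w by (intro mult_right_mono one_le_power) auto
      finally show ?thesis .
    qed
    show "has_partial_deriv i (\<lambda>x. f (a *\<^sub>R x + b)) (of_real a * partial_deriv i f (a *\<^sub>R x + b)) x" for i x
    proof -
      have "((\<lambda>t. f ((a *\<^sub>R x + b) + t *\<^sub>R axis i 1)) has_vector_derivative
          partial_deriv i f (a *\<^sub>R x + b)) (at (a * 0))"
        using Suc.prems by simp
      from vector_diff_chain_at[of "\<lambda>t. a * t" a 0, OF _ this]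
      have "((\<lambda>t. a * t) has_vector_derivative a) (at 0) \<Longrightarrow> ?thesis"
        by (simp add: o_def scaleR_conv_of_real[symmetric] algebra_simps)
      then show ?thesis
        by (auto intro!: derivative_eq_intros simp: has_real_derivative_iff_has_vector_derivative[symmetric])
    qed
    show "Cr_bound r (\<lambda>x. ?m ^ Suc r * w (a *\<^sub>R x + b)) (\<lambda>x. of_real a * partial_deriv i f (a *\<^sub>R x + b))" for i
    proof (rule Cr_bound_mono[OF Cr_bound_cmult[OF Suc.IH]])
      show "Cr_bound r w (partial_deriv i f)" using Suc.prems by simp
      show "cmod (complex_of_real a) * (?m ^ r * w (a *\<^sub>R x + b)) \<le> ?m ^ Suc r * w (a *\<^sub>R x + b)" for x
      proof -
        have "\<bar>a\<bar> * (?m ^ r * w (a *\<^sub>R x + b)) \<le> ?m * (?m ^ r * w (a *\<^sub>R x + b))"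
          using w by (intro mult_right_mono) auto
        then show ?thesis by (simp add: mult.assoc)
      qed
    qed
  qed
qed

text \<open>Difference quotients at a point of U only see nearby values, which are 0, so the
  derivatives vanish on U too and the majorant may be set to 0 there.\<close>

lemma Cr_bound_vanish:
  assumes "open U"
  shows "Cr_bound r w f \<Longrightarrow> (\<And>x. x \<in> U \<Longrightarrow> f x = 0) \<Longrightarrow>
    Cr_bound r (\<lambda>x. if x \<in> U then 0 else w x) f"
proof (induction r arbitrary: f)
  case 0
  then show ?case by auto
next
  case (Suc r)
  have "partial_deriv i f x = 0" if "x \<in> U" for i x
  proof -
    have "open ((\<lambda>t. x + t *\<^sub>R axis i 1) -` U)"
      by (intro continuous_open_vimage assms) (auto intro!: continuous_intros)
    then have "\<forall>\<^sub>F t in nhds 0. x + t *\<^sub>R axis i 1 \<in> U"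
      using that eventually_nhds_in_open[of "(\<lambda>t. x + t *\<^sub>R axis i 1) -` U" 0] by simp
    then have "\<forall>\<^sub>F t in nhds 0. 0 = f (x + t *\<^sub>R axis i 1)"
      by eventually_elim (use Suc.prems in auto)
    then have "has_partial_deriv i f 0 x"
      using has_vector_derivative_transform_within_open
        [of "\<lambda>_. 0" 0 0 "(\<lambda>t. x + t *\<^sub>R axis i 1) -` U" "\<lambda>t. f (x + t *\<^sub>R axis i 1)"]
        \<open>open (_ -` U)\<close> that Suc.prems by auto
    then show ?thesis by (rule partial_deriv_eqI)
  qed
  then show ?case using Suc by auto
qed

text \<open>The two majorants serve different ends: \<open>c\<close> does not depend on x and gives
  uniform convergence at every order through the M-test, while the finer \<open>w\<close> survives
  in the bound on the sum, so that decay in x is kept.\<close>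

lemma Cr_bound_series:
  fixes f :: "nat \<Rightarrow> real^'n::finite \<Rightarrow> complex"
  assumes c: "summable c" and wc: "\<And>k x. w k x \<le> c k"
  shows "(\<And>k. Cr_bound r (w k) (f k)) \<Longrightarrow>
    Cr_bound r (\<lambda>x. \<Sum>k. w k x) (\<lambda>x. \<Sum>k. f k x)"
proof (induction r arbitrary: f)
  have ws: "summable (\<lambda>k. w k x)" if "\<And>k x. cmod (g k x) \<le> w k x" for g x
    using order_trans[OF norm_ge_zero that] wc by (intro summable_comparison_test'[OF c, of 0]) auto
  have uni: "uniform_limit UNIV (\<lambda>n x. \<Sum>k<n. g k x) (\<lambda>x. \<Sum>k. g k x) sequentially"
    if "\<And>k x. cmod (g k x) \<le> w k x" for g :: "nat \<Rightarrow> real^'n \<Rightarrow> complex"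
    by (rule Weierstrass_m_test[OF _ c]) (meson that wc order_trans)
  have cont: "continuous_on UNIV (\<lambda>x. \<Sum>k. g k x)"
    if "\<And>k x. cmod (g k x) \<le> w k x" "\<And>k. continuous_on UNIV (g k)" for g :: "nat \<Rightarrow> real^'n \<Rightarrow> complex"
    by (rule uniform_limit_theorem[OF _ uni]) (use that in \<open>auto intro!: always_eventually continuous_intros\<close>)
  have bd: "cmod (\<Sum>k. g k x) \<le> (\<Sum>k. w k x)" 
    if "\<And>k x. cmod (g k x) \<le> w k x" for g :: "nat \<Rightarrow> real^'n \<Rightarrow> complex" and x
  proof -
    have "summable (\<lambda>k. norm (g k x))"
      by (rule summable_comparison_test'[OF ws[OF that, of x], of 0]) (use that in auto)
    then show ?thesis
      using that by (intro order_trans[OF summable_norm] suminf_le ws) auto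
  qed
  { case 0
    then show ?case using bd cont by auto
  next
    case (Suc r)
    show ?case
    proof (rule Cr_bound_SucI[where g="\<lambda>i x. \<Sum>k. partial_deriv i (f k) x"])
      show "continuous_on UNIV (\<lambda>x. \<Sum>k. f k x)" using Suc.prems by (intro cont) auto
      show "cmod (\<Sum>k. f k x) \<le> (\<Sum>k. w k x)" for x using Suc.prems by (intro bd) auto
      show "Cr_bound r (\<lambda>x. \<Sum>k. w k x) (\<lambda>x. \<Sum>k. partial_deriv i (f k) x)" for i
        using Suc.prems by (intro Suc.IH) auto
      show "has_partial_deriv i (\<lambda>x. \<Sum>k. f k x) (\<Sum>k. partial_deriv i (f k) x) x" for i x
      proof -
        let ?p = "\<lambda>t. x + t *\<^sub>R axis i 1 :: real^'n"
        \<comment> \<open>Termwise differentiation along the line through x: the differentiated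
          series converges uniformly, which is the required error bound relative to the increment
          h.\<close>
        have "\<exists>g. \<forall>t\<in>UNIV. (\<lambda>n. f n (?p t)) sums g t \<and>
          (g has_derivative (\<lambda>h. h *\<^sub>R (\<Sum>k. partial_deriv i (f k) (?p t)))) (at t within UNIV)"
        proof (rule has_derivative_series[where f'="\<lambda>k t h. h *\<^sub>R partial_deriv i (f k) (?p t)"])
          show "((\<lambda>t. f k (?p t)) has_derivative (\<lambda>h. h *\<^sub>R partial_deriv i (f k) (?p t))) (at t within UNIV)" for k t
            using has_partial_deriv_along[where f="f k" and g="partial_deriv i (f k)" and i=i and x=x and t=t and S=UNIV] Suc.prems
            by (simp add: has_vector_derivative_def)
          show "(\<lambda>n. f n (?p 0)) sums (\<Sum>n. f n (?p 0))"
            using Suc.prems by (intro summable_sums summable_comparison_test'[OF ws[of f x], of 0]) auto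
          fix e :: real assume e: "e > 0"
          have "\<forall>k x. cmod (partial_deriv i (f k) x) \<le> w k x"
            using Suc.prems Cr_bound_le by force
          then have "uniform_limit UNIV (\<lambda>n x. \<Sum>k<n. partial_deriv i (f k) x)
              (\<lambda>x. \<Sum>k. partial_deriv i (f k) x) sequentially"
            by (intro uni) auto
          from uniform_limitD[OF this e]
          show "\<forall>\<^sub>F n in sequentially. \<forall>t\<in>UNIV. \<forall>h. norm ((\<Sum>k<n. h *\<^sub>R partial_deriv i (f k) (?p t)) -
              h *\<^sub>R (\<Sum>k. partial_deriv i (f k) (?p t))) \<le> e * norm h"
          proof eventually_elim
            case (elim n)
            show ?case
            proof (intro ballI allI)
              fix t h
              show "norm ((\<Sum>k<n. h *\<^sub>R partial_deriv i (f k) (?p t)) -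
                h *\<^sub>R (\<Sum>k. partial_deriv i (f k) (?p t))) \<le> e * norm h"
                using elim[rule_format, of "?p t"]
                by (simp add: scaleR_sum_right[symmetric] scaleR_diff_right[symmetric] dist_norm)
                  (metis abs_ge_zero less_imp_le mult.commute mult_right_mono)
            qed
          qed
        qed auto
        then obtain g where g: "\<And>t. (\<lambda>n. f n (?p t)) sums g t"
          "\<And>t. (g has_vector_derivative (\<Sum>k. partial_deriv i (f k) (?p t))) (at t)"
          by (auto simp: has_vector_derivative_def)
        have "g = (\<lambda>t. \<Sum>n. f n (?p t))" using g(1) by (auto simp: sums_iff)
        with g(2)[of 0] show ?thesis by simp
      qed
    qed
  }
qed

section \<open>Symmetry of mixed derivatives and independence of the order of
  differentiation\<close>

text \<open>The increment of f in direction i is an integral of its i-th partial derivative.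
  Differentiating under the integral in direction j expresses the increment of the j-th partial
  derivative as an integral of the mixed one, and differentiating at the upper limit recovers
  it.\<close>

lemma partial_deriv_commute:
  fixes f :: "real^'n::finite \<Rightarrow> complex"
  assumes "Cr_fun 2 f"
  shows "partial_deriv i (partial_deriv j f) = partial_deriv j (partial_deriv i f)"
proof
  fix x :: "real^'n"
  let ?e = "\<lambda>k. axis k (1::real) :: real^'n"
  have C: "Cr_fun (Suc (Suc 0)) f" using assms by (simp add: numeral_2_eq_2)
  have d1: "has_partial_deriv k f (partial_deriv k f y) y" for k y
    using C by (auto simp: partially_differentiable_iff)
  have d2: "has_partial_deriv k (partial_deriv l f) (partial_deriv k (partial_deriv l f) y) y" for k l y
    using C by (auto simp: partially_differentiable_iff)
  have c1: "continuous_on UNIV (partial_deriv k f)" for k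
    using C by simp
  have c2: "continuous_on UNIV (partial_deriv k (partial_deriv l f))" for k l
    using C by simp
  let ?H = "\<lambda>s. partial_deriv j (partial_deriv i f) (x + s *\<^sub>R ?e i)"
  have step: "partial_deriv j f (x + s *\<^sub>R ?e i) = partial_deriv j f x + integral {0..s} ?H"
    if s: "0 \<le> s" for s
  proof -
    have ftc: "f ((x + t *\<^sub>R ?e j) + s *\<^sub>R ?e i) - f (x + t *\<^sub>R ?e j) =
        integral (cbox 0 s) (\<lambda>u. partial_deriv i f ((x + u *\<^sub>R ?e i) + t *\<^sub>R ?e j))" for t
    proof -
      have "((\<lambda>u. partial_deriv i f ((x + t *\<^sub>R ?e j) + u *\<^sub>R ?e i)) has_integral
          f ((x + t *\<^sub>R ?e j) + s *\<^sub>R ?e i) - f ((x + t *\<^sub>R ?e j) + 0 *\<^sub>R ?e i)) {0..s}"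
        by (rule fundamental_theorem_of_calculus[OF s has_partial_deriv_along[OF d1]])
      then show ?thesis
        by (simp add: integral_unique ac_simps)
    qed
    have "((\<lambda>t. integral (cbox 0 s) (\<lambda>u. partial_deriv i f ((x + u *\<^sub>R ?e i) + t *\<^sub>R ?e j)))
        has_vector_derivative integral (cbox 0 s)
          (\<lambda>u. partial_deriv j (partial_deriv i f) ((x + u *\<^sub>R ?e i) + 0 *\<^sub>R ?e j))) (at 0 within UNIV)"
    proof (rule leibniz_rule_vector_derivative)
      show "((\<lambda>t. partial_deriv i f ((x + u *\<^sub>R ?e i) + t *\<^sub>R ?e j)) has_vector_derivative
          partial_deriv j (partial_deriv i f) ((x + u *\<^sub>R ?e i) + t *\<^sub>R ?e j)) (at t within UNIV)" for t u
        by (rule has_partial_deriv_along[OF d2])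
      show "(\<lambda>u. partial_deriv i f ((x + u *\<^sub>R ?e i) + t *\<^sub>R ?e j)) integrable_on cbox 0 s" for t
        by (intro integrable_continuous continuous_on_compose2[OF c1] continuous_intros) auto
      show "continuous_on (UNIV \<times> cbox 0 s)
          (\<lambda>(t, u). partial_deriv j (partial_deriv i f) ((x + u *\<^sub>R ?e i) + t *\<^sub>R ?e j))"
        unfolding case_prod_beta
        by (intro continuous_on_compose2[OF c2] continuous_intros) auto
    qed auto
    then have "((\<lambda>t. f ((x + s *\<^sub>R ?e i) + t *\<^sub>R ?e j) - f (x + t *\<^sub>R ?e j)) has_vector_derivative
        integral {0..s} ?H) (at 0)"
      unfolding ftc[symmetric] by (simp add: ac_simps)
    moreover have "((\<lambda>t. f ((x + s *\<^sub>R ?e i) + t *\<^sub>R ?e j) - f (x + t *\<^sub>R ?e j)) has_vector_derivative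
        partial_deriv j f (x + s *\<^sub>R ?e i) - partial_deriv j f x) (at 0)"
      by (intro has_vector_derivative_diff d1)
    ultimately have "partial_deriv j f (x + s *\<^sub>R ?e i) - partial_deriv j f x = integral {0..s} ?H"
      using vector_derivative_unique_at by blast
    then show ?thesis by (simp add: algebra_simps)
  qed
  \<comment> \<open>\<open>step\<close> covers only s \<ge> 0, so the two mixed derivatives are
    compared as one-sided derivatives at 0, which are unique within an interval.\<close>
  have "((\<lambda>s. integral {0..s} ?H) has_vector_derivative ?H 0) (at 0 within {0..1})"
    by (intro integral_has_vector_derivative continuous_on_compose2[OF c2] continuous_intros) auto
  then have "((\<lambda>s. partial_deriv j f x + integral {0..s} ?H) has_vector_derivative ?H 0) (at 0 within {0..1})"
    using has_vector_derivative_add[OF has_vector_derivative_const] by fastforce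
  then have "((\<lambda>s. partial_deriv j f (x + s *\<^sub>R ?e i)) has_vector_derivative ?H 0) (at 0 within {0..1})"
    by (rule has_vector_derivative_transform[rotated 2]) (auto simp: step)
  then have D1: "((\<lambda>s. partial_deriv j f (x + s *\<^sub>R ?e i)) has_vector_derivative
      partial_deriv j (partial_deriv i f) x) (at 0 within {0..1})"
    by simp
  have D2: "((\<lambda>s. partial_deriv j f (x + s *\<^sub>R ?e i)) has_vector_derivative
      partial_deriv i (partial_deriv j f) x) (at 0 within {0..1})"
    using d2[where k=i and l=j and y=x] by (rule has_vector_derivative_at_within)
  show "partial_deriv i (partial_deriv j f) x = partial_deriv j (partial_deriv i f) x"
    by (rule vector_derivative_unique_within_closed_interval[of 0 1 0, unfolded cbox_interval, OF _ _ D2 D1]) auto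
qed

abbreviation iter_deriv :: "'n list \<Rightarrow> (real^'n::finite \<Rightarrow> complex) \<Rightarrow> real^'n \<Rightarrow> complex" where
  "iter_deriv is f \<equiv> foldr partial_deriv is f"

lemma Cr_fun_SucD: "Cr_fun (Suc r) f \<Longrightarrow> Cr_fun r f"
  by (induction r arbitrary: f) auto

lemma Cr_fun_le: "Cr_fun r f \<Longrightarrow> k \<le> r \<Longrightarrow> Cr_fun k f"
  by (induction r arbitrary: k) (auto simp: le_Suc_eq dest: Cr_fun_SucD simp del: Cr_fun.simps(2))

lemma Cr_fun_iter_deriv: "Cr_fun (length is + k) f \<Longrightarrow> Cr_fun k (iter_deriv is f)"
  by (induction "is" arbitrary: f rule: rev_induct) auto

text \<open>A chain of adjacent swaps. Each swap acts on a function that still has two continuous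
  derivatives, which is why the hypothesis also counts the letter being moved.\<close>

lemma iter_deriv_move:
  "Cr_fun (Suc (length (as @ bs))) f \<Longrightarrow> iter_deriv (i # as @ bs) f = iter_deriv (as @ i # bs) f"
proof (induction as)
  case (Cons a as)
  have "Cr_fun 2 (iter_deriv (as @ bs) f)"
    using Cons.prems by (intro Cr_fun_iter_deriv Cr_fun_le[OF Cons.prems]) simp
  then have "iter_deriv (i # (a # as) @ bs) f = partial_deriv a (iter_deriv (i # as @ bs) f)"
    by (simp add: partial_deriv_commute)
  also have "iter_deriv (i # as @ bs) f = iter_deriv (as @ i # bs) f"
    by (rule Cons.IH[OF Cr_fun_le[OF Cons.prems]]) simp
  finally show ?case by simp
qed simp

lemma iter_deriv_permute:
  "mset is = mset js \<Longrightarrow> Cr_fun (length is) f \<Longrightarrow> iter_deriv is f = iter_deriv js f"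
proof (induction "is" arbitrary: js)
  case (Cons i "is")
  have "i \<in> set js" using Cons.prems(1) by (metis list.set_intros(1) mset_eq_setD)
  then obtain as bs where js: "js = as @ i # bs" by (meson split_list)
  have eq: "mset is = mset (as @ bs)" using Cons.prems(1) js by simp
  have "iter_deriv is f = iter_deriv (as @ bs) f"
    by (rule Cons.IH[OF eq Cr_fun_le[OF Cons.prems(2)]]) simp
  moreover have "length is = length (as @ bs)" using eq by (metis size_mset)
  ultimately show ?case
    using iter_deriv_move[of as bs f i] Cons.prems(2) js by simp
qed simp

lemma coords: "distinct (coords :: 'n::finite list)" "set (coords :: 'n list) = UNIV"
proof -
  have "\<exists>is::'n list. distinct is \<and> set is = UNIV"
    using finite_distinct_list[of "UNIV :: 'n set"] by auto
  then have "distinct (coords :: 'n list) \<and> set (coords :: 'n list) = UNIV"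
    unfolding coords_def by (rule someI_ex)
  then show "distinct (coords :: 'n list)" "set (coords :: 'n list) = UNIV" by auto
qed

text \<open>The word of coordinates that presents \<open>multi_deriv\<close> as a derivative along a
  list, so that permutations can be applied to it.\<close>

definition index_list :: "('n::finite \<Rightarrow> nat) \<Rightarrow> 'n list" where
  "index_list \<alpha> = concat (map (\<lambda>i. replicate (\<alpha> i) i) coords)"

lemma multi_deriv_eq_iter_deriv: "multi_deriv \<alpha> f = iter_deriv (index_list \<alpha>) f"
proof -
  have "foldr partial_deriv (replicate n i @ js) f = (partial_deriv i ^^ n) (foldr partial_deriv js f)" for n i js
    by (induction n) auto
  then have "foldr (\<lambda>i g. (partial_deriv i ^^ \<alpha> i) g) is f =
      iter_deriv (concat (map (\<lambda>i. replicate (\<alpha> i) i) is)) f" for "is"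
    by (induction "is") auto
  then show ?thesis unfolding multi_deriv_def index_list_def .
qed

lemma count_index_list: "count (mset (index_list \<alpha>)) i = \<alpha> i"
proof -
  have "distinct is \<Longrightarrow> count (mset (concat (map (\<lambda>i. replicate (\<alpha> i) i) is))) i = (if i \<in> set is then \<alpha> i else 0)" for "is"
    by (induction "is") auto
  from this[OF coords(1)] show ?thesis unfolding index_list_def by (simp add: coords(2))
qed

lemma length_index_list: "length (index_list \<alpha>) = (\<Sum>i\<in>UNIV. \<alpha> i)"
proof -
  have "length (index_list \<alpha>) = sum_list (map \<alpha> coords)"
    unfolding index_list_def by (simp add: length_concat o_def)
  also have "\<dots> = (\<Sum>i\<in>UNIV. \<alpha> i)"
    using coords by (metis sum_list_distinct_conv_sum_set)
  finally show ?thesis .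
qed

text \<open>\<open>foldr\<close> applies the last letter first, and the recursion of
  \<open>Cr_bound\<close> peels off the innermost derivative; hence words are split at their right
  end.\<close>

lemma Cr_bound_iff_iter_deriv:
  "Cr_bound r w f \<longleftrightarrow> Cr_fun r f \<and> (\<forall>is x. length is \<le> r \<longrightarrow> cmod (iter_deriv is f x) \<le> w x)"
proof (induction r arbitrary: f)
  case (Suc r)
  have "(\<forall>is x. length is \<le> Suc r \<longrightarrow> cmod (iter_deriv is f x) \<le> w x) \<longleftrightarrow>
      (\<forall>x. cmod (f x) \<le> w x) \<and>
      (\<forall>i is x. length is \<le> r \<longrightarrow> cmod (iter_deriv is (partial_deriv i f) x) \<le> w x)" (is "?L = ?R")
  proof
    assume L: ?L
    then show ?R
    proof (intro conjI allI impI)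
      show "cmod (f x) \<le> w x" for x
        using L[rule_format, of "[]"] by simp
      show "cmod (iter_deriv is (partial_deriv i f) x) \<le> w x" if "length is \<le> r" for i "is" x
        using L[rule_format, of "is @ [i]"] that by simp
    qed
  next
    assume R: ?R
    show ?L
    proof (intro allI impI)
      fix "is" :: "'a list" and x assume "length is \<le> Suc r"
      then show "cmod (iter_deriv is f x) \<le> w x"
        using R by (cases "is" rule: rev_cases) auto
    qed
  qed
  then show ?case
    by (simp add: Suc partially_differentiable_iff) blast
qed auto

text \<open>Every word is a permutation of the \<open>index_list\<close> of its letter counts. This
  is the bridge from norms and bounded sets, stated with multi-indices, to the recursive
  predicate.\<close>

lemma Cr_bound_iff_multi_deriv:
  "Cr_bound r w f \<longleftrightarrow>
     Cr_fun r f \<and> (\<forall>\<alpha>\<in>multi_indices r. \<forall>x. cmod (multi_deriv \<alpha> f x) \<le> w x)"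
proof -
  have "cmod (iter_deriv is f x) \<le> w x"
    if f: "Cr_fun r f" and *: "\<forall>\<alpha>\<in>multi_indices r. \<forall>x. cmod (multi_deriv \<alpha> f x) \<le> w x"
      and l: "length is \<le> r" for "is" x
  proof -
    define \<alpha> where "\<alpha> = count (mset is)"
    have m: "mset is = mset (index_list \<alpha>)"
      by (rule multiset_eqI) (simp add: count_index_list \<alpha>_def)
    then have "length is = length (index_list \<alpha>)" by (metis size_mset)
    then have "\<alpha> \<in> multi_indices r"
      using l by (simp add: multi_indices_def length_index_list)
    then show ?thesis
      using * iter_deriv_permute[OF m Cr_fun_le[OF f l]] by (simp add: multi_deriv_eq_iter_deriv)
  qed
  then show ?thesis
    unfolding Cr_bound_iff_iter_deriv
    by (auto simp: multi_deriv_eq_iter_deriv multi_indices_def length_index_list)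
qed

section \<open>Sums over the integer lattice\<close>

text \<open>Replacing x by its floor changes 1 + |x - k| by at most a factor 2, which makes the
  bound uniform in x. The 4 in \<open>?g\<close> is this factor squared, and 8 accounts for the two
  signs of k - floor x.\<close>

lemma sum_int_inverse_square_bound:
  obtains S :: real where "\<And>(x::real) (A::int set). finite A \<Longrightarrow> (\<Sum>k\<in>A. 1 / (1 + \<bar>x - of_int k\<bar>)\<^sup>2) \<le> S"
proof -
  let ?h = "\<lambda>n::nat. 1 / (1 + real n)\<^sup>2"
  let ?g = "\<lambda>j::int. 4 * ?h (nat \<bar>j\<bar>)"
  have "summable (\<lambda>n. inverse ((real (Suc n))\<^sup>2))"
    using inverse_power_summable[of 2, where ?'a=real] by (subst summable_Suc_iff) simp
  then have h: "summable ?h" by (simp add: inverse_eq_divide add.commute)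
  have sym: "(\<Sum>j\<in>{- int N..int N}. ?g j) \<le> 8 * (\<Sum>n\<le>N. ?h n)" for N
  proof (induction N)
    case (Suc N)
    have "{- int (Suc N)..int (Suc N)} = insert (- int (Suc N)) (insert (int (Suc N)) {- int N..int N})"
      by auto
    then show ?case using Suc by simp
  qed simp
  have main: "(\<Sum>j\<in>B. ?g j) \<le> 8 * (\<Sum>n. ?h n)" if B: "finite B" for B
  proof -
    obtain N where "\<forall>j\<in>B. nat \<bar>j\<bar> \<le> N"
      using finite_nat_set_iff_bounded_le[of "(\<lambda>j. nat \<bar>j\<bar>) ` B"] B by auto
    then have "B \<subseteq> {- int N..int N}" by force
    then have "(\<Sum>j\<in>B. ?g j) \<le> (\<Sum>j\<in>{- int N..int N}. ?g j)"
      by (intro sum_mono2) auto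
    also have "\<dots> \<le> 8 * (\<Sum>n\<le>N. ?h n)" by (rule sym)
    also have "\<dots> \<le> 8 * (\<Sum>n. ?h n)"
      using h by (intro mult_left_mono sum_le_suminf) auto
    finally show ?thesis .
  qed
  show ?thesis
  proof (rule that)
    fix x :: real and A :: "int set" assume A: "finite A"
    have "1 / (1 + \<bar>x - of_int k\<bar>)\<^sup>2 \<le> ?g (k - \<lfloor>x\<rfloor>)" for k
    proof -
      have "1 + real_of_int \<bar>k - \<lfloor>x\<rfloor>\<bar> \<le> 2 * (1 + \<bar>x - of_int k\<bar>)"
      proof -
        have "\<bar>real_of_int k - real_of_int \<lfloor>x\<rfloor>\<bar> \<le> 1 + 2 * \<bar>x - of_int k\<bar>"
          using of_int_floor_le[of x] real_of_int_floor_add_one_gt[of x] by (simp only: abs_if) (auto; linarith)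
        then show ?thesis by simp
      qed
      then have "(1 + real_of_int \<bar>k - \<lfloor>x\<rfloor>\<bar>)\<^sup>2 \<le> (2 * (1 + \<bar>x - of_int k\<bar>))\<^sup>2"
        by (intro power_mono) auto
      then have "(1 + real_of_int \<bar>k - \<lfloor>x\<rfloor>\<bar>)\<^sup>2 \<le> 4 * (1 + \<bar>x - of_int k\<bar>)\<^sup>2"
        unfolding power_mult_distrib by simp
      moreover have "real (nat \<bar>k - \<lfloor>x\<rfloor>\<bar>) = real_of_int \<bar>k - \<lfloor>x\<rfloor>\<bar>" by simp
      moreover have "(1 + real_of_int \<bar>k - \<lfloor>x\<rfloor>\<bar>)\<^sup>2 > 0" "(1 + \<bar>x - of_int k\<bar>)\<^sup>2 > 0"
        by (intro zero_less_power; linarith)+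
      ultimately show ?thesis
        by (simp add: divide_simps)
    qed
    then have "(\<Sum>k\<in>A. 1 / (1 + \<bar>x - of_int k\<bar>)\<^sup>2) \<le> (\<Sum>k\<in>A. ?g (k - \<lfloor>x\<rfloor>))"
      by (rule sum_mono)
    also have "\<dots> = (\<Sum>j\<in>(\<lambda>k. k - \<lfloor>x\<rfloor>) ` A. ?g j)"
      by (subst sum.reindex) (auto simp: inj_on_def)
    also have "\<dots> \<le> 8 * (\<Sum>n. ?h n)" using A by (intro main) auto
    finally show "(\<Sum>k\<in>A. 1 / (1 + \<bar>x - of_int k\<bar>)\<^sup>2) \<le> 8 * (\<Sum>n. ?h n)" .
  qed
qed

lemma prod_component_le_norm:
  fixes y :: "real^'n::finite"
  shows "(\<Prod>i\<in>UNIV. (1 + \<bar>y $ i\<bar>)\<^sup>2) \<le> (1 + norm y) ^ (2 * CARD('n))"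
proof -
  have "(\<Prod>i\<in>UNIV. (1 + \<bar>y $ i\<bar>)\<^sup>2) \<le> (\<Prod>i\<in>(UNIV::'n set). (1 + norm y)\<^sup>2)"
    by (intro prod_mono) (auto intro!: power_mono component_le_norm_cart)
  then show ?thesis by (simp add: power_mult)
qed

text \<open>The exponent 2n leaves one square for each coordinate, so each summand is dominated by a
  product; enlarging F to the box spanned by its coordinate projections factors the sum into n
  one-dimensional ones.\<close>

lemma lattice_sum_bound:
  obtains S :: real where
    "\<And>(x::real^'n::finite) F. finite F \<Longrightarrow>
       (\<Sum>m\<in>F. 1 / (1 + norm (x - lattice_point m)) ^ (2 * CARD('n))) \<le> S"
proof -
  obtain S :: real where S: "\<And>(x::real) (A::int set). finite A \<Longrightarrow> (\<Sum>k\<in>A. 1 / (1 + \<bar>x - of_int k\<bar>)\<^sup>2) \<le> S"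
    using sum_int_inverse_square_bound by blast
  show ?thesis
  proof (rule that)
    fix x :: "real^'n" and F :: "(int^'n) set" assume F: "finite F"
    define A where "A i = (\<lambda>m. m $ i) ` F" for i
    define P where "P = PiE UNIV A"
    let ?g = "\<lambda>i k. 1 / (1 + \<bar>x $ i - of_int k\<bar>)\<^sup>2"
    have fA: "finite (A i)" for i using F unfolding A_def by auto
    have fP: "finite P" unfolding P_def by (intro finite_PiE fA) auto
    have "m \<in> vec_lambda ` P" if "m \<in> F" for m
      using that unfolding P_def A_def by (intro image_eqI[of _ _ "vec_nth m"]) auto
    then have sub: "F \<subseteq> vec_lambda ` P" by blast
    have "(\<Sum>m\<in>F. 1 / (1 + norm (x - lattice_point m)) ^ (2 * CARD('n))) \<le> (\<Sum>m\<in>F. \<Prod>i\<in>UNIV. ?g i (m $ i))"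
    proof (rule sum_mono)
      fix m
      have "(\<Prod>i\<in>UNIV. (1 + \<bar>x $ i - of_int (m $ i)\<bar>)\<^sup>2) > 0"
        by (intro prod_pos ballI zero_less_power) linarith
      moreover have "(\<Prod>i\<in>UNIV. (1 + \<bar>x $ i - of_int (m $ i)\<bar>)\<^sup>2) \<le> (1 + norm (x - lattice_point m)) ^ (2 * CARD('n))"
        using prod_component_le_norm[of "x - lattice_point m"] by (simp add: lattice_point_def)
      ultimately show "1 / (1 + norm (x - lattice_point m)) ^ (2 * CARD('n)) \<le> (\<Prod>i\<in>UNIV. ?g i (m $ i))"
        by (simp add: prod_dividef frac_le)
    qed
    also have "\<dots> \<le> (\<Sum>m\<in>vec_lambda ` P. \<Prod>i\<in>UNIV. ?g i (m $ i))"
      by (rule sum_mono2) (use sub fP in \<open>auto intro!: prod_nonneg\<close>)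
    also have "\<dots> = (\<Sum>p\<in>P. \<Prod>i\<in>UNIV. ?g i (p i))"
      by (subst sum.reindex) (auto simp: inj_on_def vec_lambda_inject)
    also have "\<dots> = (\<Prod>i\<in>UNIV. \<Sum>k\<in>A i. ?g i k)"
      unfolding P_def by (rule prod_sum_PiE[symmetric]) (use fA in auto)
    also have "\<dots> \<le> (\<Prod>i\<in>(UNIV::'n set). S)"
      by (intro prod_mono) (auto intro!: S fA sum_nonneg)
    finally show "(\<Sum>m\<in>F. 1 / (1 + norm (x - lattice_point m)) ^ (2 * CARD('n))) \<le> S ^ CARD('n)"
      by simp
  qed
qed

text \<open>Turns the unordered sum in \<open>q0_kernel\<close> into an ordinary series, to which
  the M-test and termwise integration apply.\<close>

lemma lattice_enumeration:
  obtains e :: "nat \<Rightarrow> int^'n::finite" where "bij e"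
proof -
  have "inj (\<lambda>k::int. (\<chi> i. k) :: int^'n)"
    by (auto simp: inj_on_def vec_eq_iff)
  then have "infinite (UNIV :: (int^'n) set)"
    using finite_imageD[of "\<lambda>k::int. (\<chi> i. k) :: int^'n" UNIV] infinite_UNIV_int
    by (metis finite_subset subset_UNIV)
  then have "bij_betw (from_nat_into (UNIV :: (int^'n) set)) UNIV UNIV"
    by (intro bij_betw_from_nat_into) auto
  then show ?thesis using that by blast
qed

text \<open>Where 1 + |y| is about 2^k the integrand has size 2^(-k(n+1)) and the volume has size
  2^(kn), so the k-th shell contributes a multiple of 2^(-k).\<close>

lemma integrable_inverse_power_norm:
  "integrable lborel (\<lambda>y::real^'n::finite. 1 / (1 + norm y) ^ (CARD('n) + 1))"
proof (rule integrableI_bounded)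
  let ?n = "CARD('n)"
  let ?V = "unit_ball_vol (real ?n)"
  let ?c = "\<lambda>k::nat. (2 / 2 ^ k) ^ (?n + 1) :: real"
  let ?B = "\<lambda>k::nat. cball (0::real^'n) (2 ^ k)"
  show "(\<lambda>y::real^'n. 1 / (1 + norm y) ^ (?n + 1)) \<in> borel_measurable lborel"
    by simp
  have pt: "ennreal (norm (1 / (1 + norm y) ^ (?n + 1))) \<le> (\<Sum>k. ennreal (?c k) * indicator (?B k) y)" for y :: "real^'n"
  proof -
    \<comment> \<open>The least k puts y into the ball of radius 2^k and, by minimality, keeps 2^k
      below 2 (1 + |y|); this is the 2 in \<open>?c\<close>.\<close>
    define k where "k = (LEAST k. 1 + norm y \<le> (2::real) ^ k)"
    have ex: "\<exists>k. 1 + norm y \<le> (2::real) ^ k"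
      using real_arch_pow[of 2 "1 + norm y"] by (auto intro: less_imp_le)
    then have k1: "1 + norm y \<le> 2 ^ k" unfolding k_def by (rule LeastI_ex)
    have k2: "2 ^ k \<le> 2 * (1 + norm y)"
    proof (cases k)
      case 0 then show ?thesis by simp
    next
      case (Suc j)
      then have "\<not> 1 + norm y \<le> 2 ^ j" using not_less_Least[of j "\<lambda>k. 1 + norm y \<le> (2::real) ^ k"] k_def by auto
      then show ?thesis using Suc by simp
    qed
    have "1 / (1 + norm y) \<le> 2 / 2 ^ k"
      using k2 by (simp add: divide_simps add_pos_nonneg)
    then have "(1 / (1 + norm y)) ^ (?n + 1) \<le> ?c k"
      by (intro power_mono) auto
    then have "ennreal (norm (1 / (1 + norm y) ^ (?n + 1))) \<le> ennreal (?c k) * indicator (?B k) y"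
      using k1 by (auto simp: indicator_def power_divide intro!: ennreal_leI)
    also have "\<dots> \<le> (\<Sum>k. ennreal (?c k) * indicator (?B k) y)"
    proof -
      have "g k \<le> suminf g" for g :: "nat \<Rightarrow> ennreal"
        using sum_le_suminf[of g "{k}"] by simp
      then show ?thesis .
    qed
    finally show ?thesis .
  qed
  have shell: "ennreal (?c k) * emeasure lborel (?B k) = ennreal (2 ^ (?n + 1) * ?V * (1/2) ^ k)" for k
  proof -
    have "emeasure lborel (?B k) = ennreal (?V * (2 ^ k) ^ ?n)"
      by (subst emeasure_cball) auto
    then have "ennreal (?c k) * emeasure lborel (?B k) = ennreal (?c k * (?V * (2 ^ k) ^ ?n))"
      by (subst ennreal_mult[of "?c k"]) auto
    also have "?c k * (?V * (2 ^ k) ^ ?n) = 2 ^ (?n + 1) * ?V * (1/2) ^ k"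
      by (simp add: power_divide field_simps)
    finally show ?thesis .
  qed
  have "(\<integral>\<^sup>+ y. ennreal (norm (1 / (1 + norm y) ^ (?n + 1))) \<partial>(lborel :: (real^'n) measure))
      \<le> (\<integral>\<^sup>+ y. (\<Sum>k. ennreal (?c k) * indicator (?B k) y) \<partial>lborel)"
    by (rule nn_integral_mono) (rule pt)
  also have "\<dots> = (\<Sum>k. \<integral>\<^sup>+ y. ennreal (?c k) * indicator (?B k) y \<partial>lborel)"
    by (intro nn_integral_suminf borel_measurable_times_ennreal borel_measurable_indicator) auto
  also have "\<dots> = (\<Sum>k. ennreal (2 ^ (?n + 1) * ?V * (1/2) ^ k))"
  proof -
    have "(\<integral>\<^sup>+ y. ennreal (?c k) * indicator (?B k) y \<partial>lborel) = ennreal (?c k) * emeasure lborel (?B k)" for k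
      by (rule nn_integral_cmult_indicator) simp
    then show ?thesis by (simp only: shell)
  qed
  also have "\<dots> < \<infinity>"
  proof -
    have "summable (\<lambda>k. 2 ^ (?n + 1) * ?V * (1/2::real) ^ k)"
      by (intro summable_mult summable_geometric) auto
    then have "(\<Sum>k. ennreal (2 ^ (?n + 1) * ?V * (1/2) ^ k)) \<noteq> top"
      by (rule ennreal_suminf_neq_top) (simp only: unit_ball_vol_nonneg mult_nonneg_nonneg zero_le_power
          zero_le_numeral of_nat_0_le_iff zero_le_divide_1_iff)
    then show ?thesis
      unfolding infinity_ennreal_def by (simp only: top.not_eq_extremum)
  qed
  finally show "(\<integral>\<^sup>+ y. ennreal (norm (1 / (1 + norm y) ^ (?n + 1))) \<partial>(lborel :: (real^'n) measure)) < \<infinity>" .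
qed

section \<open>Weighted spaces of rapidly decreasing functions\<close>

text \<open>What exp (M (l t)) and (1 + t)^l have in common. \<open>split_le\<close> doubles the
  index because that is the form in which M is assumed to split over sums; \<open>poly_le\<close>
  lets a larger index buy polynomial decay.\<close>

locale decay_weight =
  fixes W :: "nat \<Rightarrow> real \<Rightarrow> real"
  assumes ge_1: "0 \<le> t \<Longrightarrow> 1 \<le> W l t"
    and mono: "0 \<le> s \<Longrightarrow> s \<le> t \<Longrightarrow> W l s \<le> W l t"
    and mult_le: "0 \<le> t \<Longrightarrow> W l t * W k t \<le> W (l + k) t"
    and split_le: "0 \<le> s \<Longrightarrow> 0 \<le> t \<Longrightarrow> W l (s + t) \<le> W (2 * l) s * W (2 * l) t"
    and poly_le: "\<exists>k C. \<forall>t\<ge>0. (1 + t) ^ p \<le> C * W k t"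
begin

lemma pos: "0 \<le> t \<Longrightarrow> 0 < W l t"
  using ge_1[of t l] by linarith

lemma pos_norm [simp]: "0 < W l (norm x)" "0 \<le> W l (norm x)" "W l (norm x) \<noteq> 0"
  using pos[of "norm x" l] by auto

lemma mono_index:
  assumes "l \<le> k" "0 \<le> t" shows "W l t \<le> W k t"
proof -
  have "W l t * 1 \<le> W l t * W (k - l) t"
    using assms ge_1 pos by (intro mult_left_mono) (auto intro: less_imp_le)
  also have "\<dots> \<le> W k t" using mult_le[of t l "k - l"] assms by simp
  finally show ?thesis by simp
qed

definition weight_norm :: "nat \<Rightarrow> nat \<Rightarrow> (real^'n::finite \<Rightarrow> complex) \<Rightarrow> ennreal" where
  "weight_norm r l \<phi> =
     (SUP \<alpha>\<in>multi_indices r. SUP x. ennreal (W l (norm x) * cmod (multi_deriv \<alpha> \<phi> x)))"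

definition rapid :: "nat \<Rightarrow> (real^'n::finite \<Rightarrow> complex) set" where
  "rapid r = {\<phi>. Cr_fun r \<phi> \<and> (\<forall>l. weight_norm r l \<phi> < \<infinity>)}"

lemma weight_norm_le_iff:
  assumes "Cr_fun r \<phi>" "0 \<le> B"
  shows "weight_norm r l \<phi> \<le> ennreal B \<longleftrightarrow> Cr_bound r (\<lambda>x. B / W l (norm x)) \<phi>"
  using assms unfolding weight_norm_def Cr_bound_iff_multi_deriv
  by (simp add: SUP_le_iff ennreal_le_iff pos_le_divide_eq mult.commute)

lemma rapid_iff: "\<phi> \<in> rapid r \<longleftrightarrow> (\<forall>l. \<exists>B. Cr_bound r (\<lambda>x. B / W l (norm x)) \<phi>)"
proof
  assume \<phi>: "\<phi> \<in> rapid r"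
  show "\<forall>l. \<exists>B. Cr_bound r (\<lambda>x. B / W l (norm x)) \<phi>"
  proof
    fix l
    obtain B where "B \<ge> 0" "weight_norm r l \<phi> = ennreal B"
      using \<phi> unfolding rapid_def by (cases "weight_norm r l \<phi>") (auto simp: less_top dest: spec[of _ l])
    then show "\<exists>B. Cr_bound r (\<lambda>x. B / W l (norm x)) \<phi>"
      using \<phi> weight_norm_le_iff[of r \<phi> B l] unfolding rapid_def by auto
  qed
next
  assume *: "\<forall>l. \<exists>B. Cr_bound r (\<lambda>x. B / W l (norm x)) \<phi>"
  then have C: "Cr_fun r \<phi>" using Cr_bound_imp_Cr_fun by blast
  have "weight_norm r l \<phi> < \<infinity>" for l
  proof -
    obtain B where B: "Cr_bound r (\<lambda>x. B / W l (norm x)) \<phi>" using * by blast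
    have "0 \<le> B" using Cr_bound_nonneg[OF B, of 0] pos[of 0 l] by (simp add: zero_le_divide_iff)
    then have "weight_norm r l \<phi> \<le> ennreal B" using B C by (simp add: weight_norm_le_iff)
    then show ?thesis by (simp add: order_le_less_trans)
  qed
  then show "\<phi> \<in> rapid r" using C unfolding rapid_def by auto
qed

lemma Cr_bound_weight_nonneg: "Cr_bound r (\<lambda>x. B / W l (norm x)) \<phi> \<Longrightarrow> 0 \<le> B"
  using Cr_bound_nonneg[of r "\<lambda>x. B / W l (norm x)" \<phi> 0] pos[of 0 l] by (simp add: zero_le_divide_iff)

lemma rapidE:
  assumes "\<phi> \<in> rapid r"
  obtains B where "0 \<le> B" "Cr_bound r (\<lambda>x. B / W l (norm x)) \<phi>"
  using assms Cr_bound_weight_nonneg unfolding rapid_iff by metis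

text \<open>\<open>W (l + k)\<close> dominates the product of \<open>W l\<close> and
  \<open>W k\<close>, and a suitable \<open>W k\<close> dominates the p-th power up to a constant;
  so polynomial decay is available on top of any weight.\<close>

lemma rapid_poly:
  assumes "\<phi> \<in> rapid r"
  obtains B where "0 \<le> B" "Cr_bound r (\<lambda>x. B / (W l (norm x) * (1 + norm x) ^ p)) \<phi>"
proof -
  obtain k C where C: "\<And>t. 0 \<le> t \<Longrightarrow> (1 + t) ^ p \<le> C * W k t" using poly_le by blast
  obtain B where B: "0 \<le> B" "Cr_bound r (\<lambda>x. B / W (l + k) (norm x)) \<phi>"
    using rapidE[OF assms] by blast
  have "0 \<le> C" using C[of 0] pos[of 0 k] by (simp add: zero_le_mult_iff) (smt (verit) mult_neg_pos)
  have "B / W (l + k) (norm x) \<le> (B * C) / (W l (norm x) * (1 + norm x) ^ p)" for x :: "real^'a"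
  proof -
    have "W l (norm x) * (1 + norm x) ^ p \<le> W l (norm x) * (C * W k (norm x))"
      by (intro mult_left_mono C) auto
    also have "\<dots> \<le> C * W (l + k) (norm x)"
      using mult_left_mono[OF mult_le[of "norm x" l k] \<open>0 \<le> C\<close>] by (simp add: ac_simps)
    finally have "B * (W l (norm x) * (1 + norm x) ^ p) \<le> B * (C * W (l + k) (norm x))"
      using B by (intro mult_left_mono)
    moreover have "0 < W l (norm x) * (1 + norm x) ^ p"
      by (intro mult_pos_pos zero_less_power) (auto simp: add_pos_nonneg)
    ultimately show ?thesis
      by (simp add: divide_le_eq pos_le_divide_eq algebra_simps)
  qed
  then show ?thesis
    using that[of "B * C"] B \<open>0 \<le> C\<close> Cr_bound_mono[OF B(2)] by auto
qed

lemma rapid_poly':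
  assumes "\<phi> \<in> rapid r"
  obtains B where "0 \<le> B" "Cr_bound r (\<lambda>x. B / (1 + norm x) ^ p) \<phi>"
proof -
  obtain B where B: "0 \<le> B" "Cr_bound r (\<lambda>x. B / (W 0 (norm x) * (1 + norm x) ^ p)) \<phi>"
    using rapid_poly[OF assms] by blast
  have "B / (W 0 (norm x) * (1 + norm x) ^ p) \<le> B / (1 + norm x) ^ p" for x :: "real^'a"
    using B ge_1[of "norm x" 0] mult_right_mono[of 1 "W 0 (norm x)" "(1 + norm x) ^ p"]
    by (intro divide_left_mono) (auto simp: add_pos_nonneg intro!: mult_pos_pos)
  then show ?thesis using that[OF B(1) Cr_bound_mono[OF B(2)]] by blast
qed

lemma rapid_cmult: "\<phi> \<in> rapid r \<Longrightarrow> (\<lambda>x. c * \<phi> x) \<in> rapid r"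
  unfolding rapid_iff
proof
  fix l assume "\<forall>l. \<exists>B. Cr_bound r (\<lambda>x. B / W l (norm x)) \<phi>"
  then obtain B where "Cr_bound r (\<lambda>x. B / W l (norm x)) \<phi>"
    by blast
  from Cr_bound_cmult[OF this, of c] show "\<exists>B. Cr_bound r (\<lambda>x. B / W l (norm x)) (\<lambda>x. c * \<phi> x)"
    by (auto intro!: exI[of _ "cmod c * B"])
qed

lemma rapid_zero: "(\<lambda>x. 0) \<in> rapid r"
  unfolding rapid_iff using Cr_bound_const[of r 0] by (intro allI exI[of _ 0]) simp

lemma rapid_mult_bounded:
  assumes "Cr_bound r (\<lambda>x. T) \<theta>" "\<phi> \<in> rapid r"
  shows "(\<lambda>x. \<theta> x * \<phi> x) \<in> rapid r"
  unfolding rapid_iff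
proof
  fix l
  obtain B where "Cr_bound r (\<lambda>x. B / W l (norm x)) \<phi>" using rapidE[OF assms(2)] by blast
  from Cr_bound_mult[OF assms(1) this]
  show "\<exists>B. Cr_bound r (\<lambda>x. B / W l (norm x)) (\<lambda>x. \<theta> x * \<phi> x)"
    by (auto intro!: exI[of _ "2 ^ r * T * B"])
qed

text \<open>The chain rule costs a^r. Since a \<ge> 1, dilation only moves the argument away from
  the origin, and recentring from x0 to 0 by \<open>split_le\<close> costs a constant and half of
  the index.\<close>

lemma Cr_bound_dilate:
  assumes "Cr_bound r (\<lambda>x. B / W (2 * l) (norm x)) \<psi>" "1 \<le> a"
  shows "Cr_bound r (\<lambda>y. (a ^ r * B * W (2 * l) (norm x0)) / W l (norm y)) (\<lambda>y. \<psi> (a *\<^sub>R (y - x0)))"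
proof -
  have B: "0 \<le> B" using assms(1) by (rule Cr_bound_weight_nonneg)
  have "Cr_bound r (\<lambda>y. max 1 \<bar>a\<bar> ^ r * (B / W (2 * l) (norm (a *\<^sub>R y + - (a *\<^sub>R x0)))))
      (\<lambda>y. \<psi> (a *\<^sub>R y + - (a *\<^sub>R x0)))"
    by (rule Cr_bound_affine[OF assms(1)])
  then have "Cr_bound r (\<lambda>y. a ^ r * (B / W (2 * l) (norm (a *\<^sub>R (y - x0))))) (\<lambda>y. \<psi> (a *\<^sub>R (y - x0)))"
    using assms(2) by (simp add: scaleR_diff_right max_def)
  then show ?thesis
  proof (rule Cr_bound_mono)
    fix y :: "real^'a"
    have "W l (norm y) \<le> W l (norm (y - x0) + norm x0)"
      using norm_triangle_ineq[of "y - x0" x0] by (intro mono) auto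
    also have "\<dots> \<le> W (2 * l) (norm (y - x0)) * W (2 * l) (norm x0)"
      by (rule split_le) auto
    also have "\<dots> \<le> W (2 * l) (norm (a *\<^sub>R (y - x0))) * W (2 * l) (norm x0)"
      using assms(2) mult_right_mono[of 1 a "norm (y - x0)"] by (intro mult_right_mono mono) auto
    finally have "(a ^ r * B) * W l (norm y) \<le> (a ^ r * B) * (W (2 * l) (norm (a *\<^sub>R (y - x0))) * W (2 * l) (norm x0))"
      using B assms(2) by (intro mult_left_mono) auto
    then show "a ^ r * (B / W (2 * l) (norm (a *\<^sub>R (y - x0)))) \<le> a ^ r * B * W (2 * l) (norm x0) / W l (norm y)"
      by (simp add: divide_le_eq pos_le_divide_eq algebra_simps del: norm_scaleR)
  qed
qed

lemma rapid_dilate: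
  assumes "\<psi> \<in> rapid r" "1 \<le> a"
  shows "(\<lambda>y. \<psi> (a *\<^sub>R (y - x0))) \<in> rapid r"
  unfolding rapid_iff
proof
  fix l
  obtain B where "Cr_bound r (\<lambda>x. B / W (2 * l) (norm x)) \<psi>" using rapidE[OF assms(1)] by blast
  from Cr_bound_dilate[OF this assms(2)]
  show "\<exists>B. Cr_bound r (\<lambda>x. B / W l (norm x)) (\<lambda>y. \<psi> (a *\<^sub>R (y - x0)))" by blast
qed

text \<open>The topology is generated by balls about arbitrary centres, so the neighbourhood base at
  0 is recovered by induction on generation. Intersections use that the norms increase with l; a
  ball about \<phi> that contains 0 leaves the slack e - a.\<close>

lemma norms_topology_nhd:
  assumes "openin (norms_topology (rapid r) (weight_norm r)) U" "(\<lambda>x. 0) \<in> U"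
  shows "\<exists>l d. 0 < d \<and> (\<forall>\<psi>. \<psi> \<in> rapid r \<and> weight_norm r l \<psi> < ennreal d \<longrightarrow> \<psi> \<in> U)"
proof -
  have "generate_topology_on {{\<psi>\<in>rapid r. weight_norm r l (\<lambda>x. \<psi> x - \<phi> x) < ennreal e} | l \<phi> e. \<phi> \<in> rapid r \<and> e > 0} U"
    using assms(1) unfolding norms_topology_def openin_topology_generated_by_iff .
  then show ?thesis using assms(2)
  proof (induction rule: generate_topology_on.induct)
    case (Int a b)
    obtain l d where 1: "0 < d" "\<And>\<psi>. \<psi> \<in> rapid r \<Longrightarrow> weight_norm r l \<psi> < ennreal d \<Longrightarrow> \<psi> \<in> a"
      using Int.IH(1) Int.prems by auto
    obtain l' d' where 2: "0 < d'" "\<And>\<psi>. \<psi> \<in> rapid r \<Longrightarrow> weight_norm r l' \<psi> < ennreal d' \<Longrightarrow> \<psi> \<in> b"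
      using Int.IH(2) Int.prems by auto
    note * = 1 2
    have le: "weight_norm r i \<psi> \<le> weight_norm r j \<psi>" if "i \<le> j" for i j and \<psi> :: "real^'a \<Rightarrow> complex"
      unfolding weight_norm_def
      by (intro SUP_mono' ennreal_leI mult_right_mono mono_index that) auto
    have "\<psi> \<in> a \<inter> b" if "\<psi> \<in> rapid r" "weight_norm r (max l l') \<psi> < ennreal (min d d')" for \<psi>
    proof -
      have "weight_norm r l \<psi> < ennreal d"
        using le[of l "max l l'" \<psi>] that(2) ennreal_leI[of "min d d'" d] by (meson max.cobounded1 min.cobounded1 order_le_less_trans order_less_le_trans)
      moreover have "weight_norm r l' \<psi> < ennreal d'"
        using le[of l' "max l l'" \<psi>] that(2) ennreal_leI[of "min d d'" d'] by (meson max.cobounded2 min.cobounded2 order_le_less_trans order_less_le_trans)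
      ultimately show ?thesis using * that by auto
    qed
    then show ?case using * by (intro exI[of _ "max l l'"] exI[of _ "min d d'"]) auto
  next
    case (UN K)
    then obtain k where k: "k \<in> K" "(\<lambda>x. 0) \<in> k" by auto
    from UN.IH[OF this] k show ?case by blast
  next
    case (Basis s)
    then obtain l \<phi> e where s: "s = {\<psi>\<in>rapid r. weight_norm r l (\<lambda>x. \<psi> x - \<phi> x) < ennreal e}"
      and \<phi>: "\<phi> \<in> rapid r" and e: "e > 0" by auto
    have less: "weight_norm r l (\<lambda>x. 0 - \<phi> x) < ennreal e" using Basis.prems s by auto
    then obtain a where a: "0 \<le> a" "weight_norm r l (\<lambda>x. 0 - \<phi> x) = ennreal a" "a < e"
      by (cases "weight_norm r l (\<lambda>x. 0 - \<phi> x)") (auto simp: ennreal_less_iff)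
    have m\<phi>: "(\<lambda>x. 0 - \<phi> x) \<in> rapid r" using rapid_cmult[OF \<phi>, of "-1"] by simp
    have "\<psi> \<in> s" if \<psi>: "\<psi> \<in> rapid r" "weight_norm r l \<psi> < ennreal (e - a)" for \<psi>
    proof -
      obtain b where b: "0 \<le> b" "weight_norm r l \<psi> = ennreal b" "b < e - a"
        using \<psi>(2) by (cases "weight_norm r l \<psi>") (auto simp: ennreal_less_iff)
      have 1: "Cr_bound r (\<lambda>x. b / W l (norm x)) \<psi>" "Cr_bound r (\<lambda>x. a / W l (norm x)) (\<lambda>x. 0 - \<phi> x)"
        using weight_norm_le_iff[of r \<psi> b l] weight_norm_le_iff[of r "\<lambda>x. 0 - \<phi> x" a l] a b \<psi>(1) m\<phi>
        unfolding rapid_def by auto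
      have 2: "Cr_bound r (\<lambda>x. (b + a) / W l (norm x)) (\<lambda>x. \<psi> x - \<phi> x)"
        using Cr_bound_add[OF 1] by (simp add: add_divide_distrib)
      have "weight_norm r l (\<lambda>x. \<psi> x - \<phi> x) \<le> ennreal (b + a)"
        using 2 weight_norm_le_iff[of r "\<lambda>x. \<psi> x - \<phi> x" "b + a" l] a b Cr_bound_imp_Cr_fun[OF 2] by simp
      also have "\<dots> < ennreal e" using a b by (intro ennreal_lessI) auto
      finally show ?thesis using s \<psi> by simp
    qed
    then show ?case using a by (intro exI[of _ l] exI[of _ "e - a"]) auto
  qed auto
qed

text \<open>Continuity at 0 bounds f by 1 on one norm ball, and homogeneity extends this. Scaling by
  d / (2 B) rather than d / B keeps the function strictly inside the ball.\<close>

lemma continuous_dual_bound: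
  assumes f: "f \<in> continuous_dual (rapid r) (weight_norm r)"
  obtains l C where "0 \<le> C"
    "\<And>\<psi> B. 0 < B \<Longrightarrow> \<psi> \<in> rapid r \<Longrightarrow> Cr_bound r (\<lambda>x. B / W l (norm x)) \<psi> \<Longrightarrow> cmod (f \<psi>) \<le> C * B"
proof -
  let ?T = "norms_topology (rapid r) (weight_norm r) :: (real^'a \<Rightarrow> complex) topology"
  have lin: "\<And>c \<phi>. \<phi> \<in> rapid r \<Longrightarrow> f (\<lambda>x. c * \<phi> x) = c * f \<phi>" and cont: "continuous_map ?T euclidean f"
    using f unfolding continuous_dual_def by auto
  have "topspace ?T \<subseteq> rapid r" unfolding norms_topology_def by auto
  moreover have "(\<lambda>x. 0) \<in> topspace ?T"
  proof -
    have "weight_norm r 0 (\<lambda>x::real^'a. 0) \<le> ennreal 0"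
      using Cr_bound_const[of r 0] by (subst weight_norm_le_iff) (auto intro: Cr_bound_imp_Cr_fun)
    then show ?thesis
      unfolding norms_topology_def topology_generated_by_topspace
      using rapid_zero[of r]
      by (intro UnionI[of "{\<psi>\<in>rapid r. weight_norm r 0 (\<lambda>x. \<psi> x - 0) < ennreal 1}"]
          CollectI exI[of _ 0] exI[of _ "\<lambda>x. 0"] exI[of _ 1]) auto
  qed
  moreover have "f (\<lambda>x. 0) = 0" using lin[OF rapid_zero, of 0] by simp
  ultimately have 0: "(\<lambda>x. 0) \<in> {\<psi> \<in> topspace ?T. f \<psi> \<in> ball 0 1}" by simp
  have "openin ?T {\<psi> \<in> topspace ?T. f \<psi> \<in> ball 0 1}"
    using cont by (rule openin_continuous_map_preimage) (simp add: open_openin[symmetric])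
  from norms_topology_nhd[OF this 0] obtain l d where d: "0 < d"
    "\<And>\<psi>. \<psi> \<in> rapid r \<Longrightarrow> weight_norm r l \<psi> < ennreal d \<Longrightarrow> cmod (f \<psi>) < 1" by auto
  show ?thesis
  proof (rule that[of "2 / d" l])
    fix \<psi> :: "real^'a \<Rightarrow> complex" and B
    assume B: "0 < B" and \<psi>: "\<psi> \<in> rapid r" and bd: "Cr_bound r (\<lambda>x. B / W l (norm x)) \<psi>"
    let ?c = "complex_of_real (d / (2 * B))"
    have "Cr_bound r (\<lambda>x. (d / 2) / W l (norm x)) (\<lambda>x. ?c * \<psi> x)"
      by (rule Cr_bound_mono[OF Cr_bound_cmult[OF bd]]) (use B d in \<open>auto simp: norm_divide norm_mult\<close>)
    then have "weight_norm r l (\<lambda>x. ?c * \<psi> x) \<le> ennreal (d / 2)"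
      using d by (subst weight_norm_le_iff) (auto intro: Cr_bound_imp_Cr_fun)
    also have "\<dots> < ennreal d" using d by (intro ennreal_lessI) auto
    finally have "cmod (?c * f \<psi>) < 1" using d(2) rapid_cmult[OF \<psi>] lin[OF \<psi>] by metis
    then show "cmod (f \<psi>) \<le> 2 / d * B"
      using B d by (simp add: norm_mult norm_divide field_simps)
  qed (use d in auto)
qed

end

section \<open>The polynomial and the exponential weights\<close>

interpretation poly_weight: decay_weight "\<lambda>l t. (1 + t) ^ l"
proof
  fix l k p :: nat and s t :: real
  show "0 \<le> t \<Longrightarrow> 1 \<le> (1 + t) ^ l" by simp
  show "0 \<le> s \<Longrightarrow> s \<le> t \<Longrightarrow> (1 + s) ^ l \<le> (1 + t) ^ l" by (intro power_mono) auto
  show "0 \<le> t \<Longrightarrow> (1 + t) ^ l * (1 + t) ^ k \<le> (1 + t) ^ (l + k)" by (simp add: power_add)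
  show "\<exists>k C. \<forall>t\<ge>0. (1 + t :: real) ^ p \<le> C * (1 + t) ^ k"
    by (intro exI[of _ p] exI[of _ 1]) auto
  assume s: "0 \<le> s" and t: "0 \<le> t"
  have "(1 + (s + t)) ^ l \<le> ((1 + s) * (1 + t)) ^ l"
    using s t by (intro power_mono) (auto simp: algebra_simps)
  also have "\<dots> \<le> ((1 + s) * (1 + t)) ^ (2 * l)"
    using s t mult_mono[of 1 "1 + s" 1 "1 + t"] by (intro power_increasing) auto
  finally show "(1 + (s + t)) ^ l \<le> (1 + s) ^ (2 * l) * (1 + t) ^ (2 * l)"
    by (simp add: power_mult_distrib)
qed

text \<open>Polynomial domination is the substantial axiom: superadditivity gives M(n) \<ge> n M(1),
  where M(1) > 0 because M is strictly increasing. Passing to real arguments loses one unit,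
  absorbed by the constant exp m, and k M(1) \<ge> p makes the weight beat e^(pt).\<close>

lemma decay_weight_exp:
  assumes "weight_function M"
  shows "decay_weight (\<lambda>l t. exp (M (real l * t)))"
proof
  have M: "\<And>t. 0 \<le> t \<Longrightarrow> 0 \<le> M t" "\<And>s t. 0 \<le> s \<Longrightarrow> 0 \<le> t \<Longrightarrow> M s + M t \<le> M (s + t)"
    "\<And>s t. 0 \<le> s \<Longrightarrow> 0 \<le> t \<Longrightarrow> M (s + t) \<le> M (2 * s) + M (2 * t)" "strict_mono_on {0..} M"
    using assms unfolding weight_function_def by auto
  have Mm: "M s \<le> M t" if "0 \<le> s" "s \<le> t" for s t
    using M(2)[of s "t - s"] M(1)[of "t - s"] that by simp
  fix l k p :: nat and s t :: real
  show "0 \<le> t \<Longrightarrow> 1 \<le> exp (M (real l * t))" using M(1) by simp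
  show "0 \<le> s \<Longrightarrow> s \<le> t \<Longrightarrow> exp (M (real l * s)) \<le> exp (M (real l * t))"
    by (simp add: Mm mult_left_mono)
  show "0 \<le> t \<Longrightarrow> exp (M (real l * t)) * exp (M (real k * t)) \<le> exp (M (real (l + k) * t))"
    using M(2)[of "real l * t" "real k * t"] by (simp add: exp_add[symmetric] algebra_simps)
  show "0 \<le> s \<Longrightarrow> 0 \<le> t \<Longrightarrow> exp (M (real l * (s + t))) \<le> exp (M (real (2 * l) * s)) * exp (M (real (2 * l) * t))"
    using M(3)[of "real l * s" "real l * t"] by (simp add: exp_add[symmetric] algebra_simps)
  show "\<exists>k C. \<forall>t\<ge>0. (1 + t) ^ p \<le> C * exp (M (real k * t))"
  proof -
    define m where "m = M 1"
    have m: "0 < m" using strict_mono_onD[OF M(4), of 0 1] M(1)[of 0] by (simp add: m_def)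
    have nat: "real n * m \<le> M (real n)" for n
    proof (induction n)
      case (Suc n)
      then show ?case using M(2)[of "real n" 1] by (simp add: m_def algebra_simps)
    qed (use M(1)[of 0] in simp)
    have lin: "(t - 1) * m \<le> M t" if "0 \<le> t" for t
    proof -
      have "(t - 1) * m \<le> real (nat \<lfloor>t\<rfloor>) * m"
      proof (rule mult_right_mono)
        have "t - 1 \<le> real_of_int \<lfloor>t\<rfloor>" by linarith
        then show "t - 1 \<le> real (nat \<lfloor>t\<rfloor>)" using that by simp
      qed (use m in simp)
      also have "\<dots> \<le> M (real (nat \<lfloor>t\<rfloor>))" by (rule nat)
      also have "\<dots> \<le> M t" using that by (intro Mm) auto
      finally show ?thesis .
    qed
    obtain k :: nat where k: "real p / m \<le> real k" using real_arch_simple by blast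
    have "(1 + t) ^ p \<le> exp m * exp (M (real k * t))" if t: "0 \<le> t" for t
    proof -
      have "(1 + t) ^ p \<le> exp t ^ p" using t exp_ge_add_one_self[of t] by (intro power_mono) auto
      also have "\<dots> = exp (real p * t)" by (simp add: exp_of_nat_mult)
      also have "\<dots> \<le> exp (m + M (real k * t))"
      proof -
        have "real p * t \<le> real k * m * t"
          using k m t by (intro mult_right_mono) (auto simp: field_simps)
        also have "\<dots> \<le> m + M (real k * t)"
          using lin[of "real k * t"] t by (simp add: algebra_simps)
        finally show ?thesis by simp
      qed
      finally show ?thesis by (simp add: exp_add)
    qed
    then show ?thesis by blast
  qed
qed

lemma S_space_eq: "S_space r = poly_weight.rapid r"
  unfolding S_space_def poly_weight.rapid_def rho_norm_def poly_weight.weight_norm_def ..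

lemma S_dual_eq: "S_dual r = continuous_dual (poly_weight.rapid r) (poly_weight.weight_norm r)"
  unfolding S_dual_def S_space_eq by (simp add: rho_norm_def[abs_def] poly_weight.weight_norm_def[abs_def])

lemma KM_space_eq:
  assumes "weight_function M"
  shows "(KM_space M r :: (real^'n::finite \<Rightarrow> complex) set) = decay_weight.rapid (\<lambda>l t. exp (M (real l * t))) r"
    "(KM_dual M r :: ((real^'n \<Rightarrow> complex) \<Rightarrow> complex) set) = continuous_dual (decay_weight.rapid (\<lambda>l t. exp (M (real l * t))) r)
      (decay_weight.weight_norm (\<lambda>l t. exp (M (real l * t))) r)"
proof -
  interpret decay_weight "\<lambda>l t. exp (M (real l * t))" by (rule decay_weight_exp[OF assms])
  have eq: "nu_norm M r = (weight_norm r :: nat \<Rightarrow> (real^'n \<Rightarrow> complex) \<Rightarrow> ennreal)"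
    by (intro ext) (simp add: nu_norm_def weight_norm_def)
  then show "(KM_space M r :: (real^'n \<Rightarrow> complex) set) = rapid r" by (simp add: KM_space_def rapid_def)
  then show "(KM_dual M r :: ((real^'n \<Rightarrow> complex) \<Rightarrow> complex) set) = continuous_dual (rapid r) (weight_norm r)"
    by (simp add: KM_dual_def eq)
qed

section \<open>The reproducing kernel\<close>

lemma lattice_series_bound:
  fixes e :: "nat \<Rightarrow> int^'n::finite"
  assumes "inj e"
  obtains S where "\<And>x. summable (\<lambda>k. 1 / (1 + norm (x - lattice_point (e k))) ^ (2 * CARD('n)))"
    "\<And>x. (\<Sum>k. 1 / (1 + norm (x - lattice_point (e k))) ^ (2 * CARD('n))) \<le> S"
proof -
  obtain S :: real where S: "\<And>(x::real^'n) F. finite F \<Longrightarrow>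
      (\<Sum>m\<in>F. 1 / (1 + norm (x - lattice_point m)) ^ (2 * CARD('n))) \<le> S"
    using lattice_sum_bound by blast
  have fin: "(\<Sum>k<n. 1 / (1 + norm (x - lattice_point (e k))) ^ (2 * CARD('n))) \<le> S" for x n
  proof -
    have "(\<Sum>m\<in>e ` {..<n}. 1 / (1 + norm (x - lattice_point m)) ^ (2 * CARD('n))) =
        (\<Sum>k<n. 1 / (1 + norm (x - lattice_point (e k))) ^ (2 * CARD('n)))"
      by (subst sum.reindex) (auto intro: inj_on_subset[OF assms])
    then show ?thesis using S[of "e ` {..<n}" x] by simp
  qed
  have sum: "summable (\<lambda>k. 1 / (1 + norm (x - lattice_point (e k))) ^ (2 * CARD('n)))" for x
    by (rule summableI_nonneg_bounded[OF _ fin]) simp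
  show ?thesis
    using that sum suminf_le_const[OF sum fin] by blast
qed

text \<open>One factor decays in the lattice variable while the other is merely bounded; this gives
  absolute convergence, so any enumeration yields the unordered sum.\<close>

lemma q0_kernel_eq_suminf:
  fixes e :: "nat \<Rightarrow> int^'n::finite"
  assumes e: "bij e" and \<phi>: "\<And>x. cmod (\<phi> x) \<le> B / (1 + norm x) ^ (2 * CARD('n))"
  shows "q0_kernel \<phi> x y = (\<Sum>k. \<phi> (x - lattice_point (e k)) * cnj (\<phi> (y - lattice_point (e k))))"
proof -
  have B: "0 \<le> B" using order_trans[OF norm_ge_zero \<phi>[of 0]] by simp
  have bd: "cmod (\<phi> x) \<le> B" for x
  proof -
    have "B / (1 + norm x) ^ (2 * CARD('n)) \<le> B / 1"
      using B by (intro divide_left_mono one_le_power) auto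
    then show ?thesis using \<phi>[of x] by simp
  qed
  obtain S where S: "\<And>x. summable (\<lambda>k. 1 / (1 + norm (x - lattice_point (e k))) ^ (2 * CARD('n)))"
    using lattice_series_bound[OF bij_is_inj[OF e]] by blast
  have "summable (\<lambda>k. B * B * (1 / (1 + norm (x - lattice_point (e k))) ^ (2 * CARD('n))))"
    by (intro summable_mult S)
  then have "summable (\<lambda>k. norm (\<phi> (x - lattice_point (e k)) * cnj (\<phi> (y - lattice_point (e k)))))"
  proof (rule summable_comparison_test'[where N=0])
    fix k
    have "cmod (\<phi> (x - lattice_point (e k))) * cmod (\<phi> (y - lattice_point (e k)))
        \<le> B / (1 + norm (x - lattice_point (e k))) ^ (2 * CARD('n)) * B"
      using B by (intro mult_mono \<phi> bd) auto
    then show "norm (norm (\<phi> (x - lattice_point (e k)) * cnj (\<phi> (y - lattice_point (e k)))))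
        \<le> B * B * (1 / (1 + norm (x - lattice_point (e k))) ^ (2 * CARD('n)))"
      by (simp add: norm_mult)
  qed
  from norm_summable_imp_has_sum[OF this summable_sums[OF summable_norm_cancel[OF this]]]
  have "(\<Sum>\<^sub>\<infinity>k. \<phi> (x - lattice_point (e k)) * cnj (\<phi> (y - lattice_point (e k)))) =
      (\<Sum>k. \<phi> (x - lattice_point (e k)) * cnj (\<phi> (y - lattice_point (e k))))"
    by (rule infsumI)
  then show ?thesis
    unfolding q0_kernel_def
    using infsum_reindex_bij_betw[OF e, of "\<lambda>m. \<phi> (x - lattice_point m) * cnj (\<phi> (y - lattice_point m))"] by simp
qed

context decay_weight
begin

text \<open>Only y is differentiated, so \<phi>(x - m) acts as a constant. The weight at x - y is
  split between x - m and y - m, and a spare power of 1 + |x - m| makes the sum over m finite,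
  uniformly in x.\<close>

lemma q0_kernel_bound:
  fixes \<phi> :: "real^'n::finite \<Rightarrow> complex"
  assumes "\<phi> \<in> rapid r"
  obtains B where "\<And>x. Cr_bound r (\<lambda>y. B / W l (norm (x - y))) (q0_kernel \<phi> x)"
proof -
  let ?P = "2 * CARD('n)"
  obtain A where A: "0 \<le> A" "Cr_bound r (\<lambda>x. A / (W (2 * l) (norm x) * (1 + norm x) ^ ?P)) \<phi>"
    using rapid_poly[OF assms] by blast
  obtain A' where A': "0 \<le> A'" "Cr_bound r (\<lambda>x. A' / (W (2 * l) (norm x))) \<phi>"
    using rapidE[OF assms] by blast
  obtain A'' where A'': "0 \<le> A''" "Cr_bound r (\<lambda>x. A'' / (1 + norm x) ^ ?P) \<phi>"
    using rapid_poly'[OF assms] by blast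
  obtain e :: "nat \<Rightarrow> int^'n" where e: "bij e" using lattice_enumeration by blast
  define s where "s x k = 1 / (1 + norm (x - lattice_point (e k))) ^ ?P" for x k
  obtain S where S: "\<And>x. summable (s x)" "\<And>x. (\<Sum>k. s x k) \<le> S"
    using lattice_series_bound[OF bij_is_inj[OF e]] unfolding s_def by metis
  have "Cr_bound r (\<lambda>y. A * A' * S / W l (norm (x - y))) (q0_kernel \<phi> x)" for x
  proof -
    define w where "w k y = A * A' * s x k / W l (norm (x - y))" for k y
    have s0: "0 \<le> s x k" for k by (simp add: s_def)
    have summand: "Cr_bound r (w k) (\<lambda>y. \<phi> (x - lattice_point (e k)) * cnj (\<phi> (y - lattice_point (e k))))" for k
    proof -
      let ?m = "lattice_point (e k)"
      have "Cr_bound r (\<lambda>y. max 1 \<bar>1\<bar> ^ r * (A' / W (2 * l) (norm (1 *\<^sub>R y + - ?m)))) (\<lambda>y. cnj (\<phi> (1 *\<^sub>R y + - ?m)))"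
        by (rule Cr_bound_affine[OF Cr_bound_cnj[OF A'(2)]])
      then have "Cr_bound r (\<lambda>y. A' / W (2 * l) (norm (y - ?m))) (\<lambda>y. cnj (\<phi> (y - ?m)))"
        by simp
      from Cr_bound_cmult[OF this, of "\<phi> (x - ?m)"] show ?thesis
      proof (rule Cr_bound_mono)
        fix y
        have "norm (x - y) \<le> norm (x - ?m) + norm (y - ?m)"
          using norm_triangle_ineq4[of "x - ?m" "y - ?m"] by simp
        then have "W l (norm (x - y)) \<le> W l (norm (x - ?m) + norm (y - ?m))"
          by (intro mono) auto
        also have "\<dots> \<le> W (2 * l) (norm (x - ?m)) * W (2 * l) (norm (y - ?m))"
          by (rule split_le) auto
        finally have W: "W l (norm (x - y)) \<le> W (2 * l) (norm (x - ?m)) * W (2 * l) (norm (y - ?m))" .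
        have "cmod (\<phi> (x - ?m)) * (A' / W (2 * l) (norm (y - ?m)))
            \<le> A / (W (2 * l) (norm (x - ?m)) * (1 + norm (x - ?m)) ^ ?P) * (A' / W (2 * l) (norm (y - ?m)))"
          using A' by (intro mult_right_mono Cr_bound_le[OF A(2)]) auto
        also have "\<dots> = A * A' * s x k / (W (2 * l) (norm (x - ?m)) * W (2 * l) (norm (y - ?m)))"
          by (simp add: s_def)
        also have "\<dots> \<le> A * A' * s x k / W l (norm (x - y))"
          using A A' s0 by (intro divide_left_mono W mult_nonneg_nonneg mult_pos_pos) auto
        finally show "cmod (\<phi> (x - ?m)) * (A' / W (2 * l) (norm (y - ?m))) \<le> w k y"
          by (simp add: w_def)
      qed
    qed
    have "w k y \<le> A * A' * s x k" for k y
      using A A' s0[of k] ge_1[of "norm (x - y)" l] unfolding w_def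
      by (simp add: pos_divide_le_eq mult_left_le_one_le mult_nonneg_nonneg) (metis mult_left_mono mult.right_neutral mult_nonneg_nonneg)
    then have "Cr_bound r (\<lambda>y. \<Sum>k. w k y) (\<lambda>y. \<Sum>k. \<phi> (x - lattice_point (e k)) * cnj (\<phi> (y - lattice_point (e k))))"
      by (intro Cr_bound_series[where c="\<lambda>k. A * A' * s x k"] summable_mult S summand)
    also have "(\<lambda>y. \<Sum>k. \<phi> (x - lattice_point (e k)) * cnj (\<phi> (y - lattice_point (e k)))) = q0_kernel \<phi> x"
      using q0_kernel_eq_suminf[OF e Cr_bound_le[OF A''(2)]] by auto
    finally show ?thesis
    proof (rule Cr_bound_mono)
      fix y
      have "(\<Sum>k. w k y) = A * A' / W l (norm (x - y)) * (\<Sum>k. s x k)"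
        using suminf_mult[OF S(1), of "A * A' / W l (norm (x - y))" x] by (simp add: w_def)
      also have "\<dots> \<le> A * A' / W l (norm (x - y)) * S"
        using A A' by (intro mult_left_mono S) auto
      finally show "(\<Sum>k. w k y) \<le> A * A' * S / W l (norm (x - y))" by simp
    qed
  qed
  then show ?thesis by (rule that)
qed

end

section \<open>Compactly supported cutoff functions of class C^r\<close>

text \<open>Each averaging over a unit interval gains one derivative and moves the two edges of the
  plateau by one half.\<close>

fun bump :: "real \<Rightarrow> nat \<Rightarrow> real \<Rightarrow> real" where
  "bump c 0 t = max 0 (min 1 (c + 1 - \<bar>t\<bar>))"
| "bump c (Suc k) t = integral {t - 1/2..t + 1/2} (bump c k)"

lemma has_real_derivative_moving_integral:
  fixes g :: "real \<Rightarrow> real"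
  assumes "continuous_on UNIV g"
  shows "((\<lambda>t. integral {t - 1/2..t + 1/2} g) has_real_derivative g (t + 1/2) - g (t - 1/2)) (at t)"
proof -
  have "isCont g x" for x using assms continuous_on_eq_continuous_at by blast
  then obtain G where G: "\<And>x. (G has_vector_derivative g x) (at x)"
    using einterval_antiderivative[of "-\<infinity>" "\<infinity>" g] by auto
  have "integral {t - 1/2..t + 1/2} g = G (t + 1/2) - G (t - 1/2)" for t
    by (intro integral_unique fundamental_theorem_of_calculus)
      (auto intro: has_vector_derivative_at_within G)
  moreover have "((\<lambda>t. G (t + 1/2) - G (t - 1/2)) has_real_derivative g (t + 1/2) - g (t - 1/2)) (at t)"
    using G[THEN has_real_derivative_iff_has_vector_derivative[THEN iffD2]]
      DERIV_shift[of G "g (t + 1/2)" t "1/2"] DERIV_shift[of G "g (t - 1/2)" t "- 1/2"]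
    by (intro DERIV_diff) auto
  ultimately show ?thesis by simp
qed

lemma continuous_bump: "continuous_on UNIV (bump c k)"
proof (induction k)
  case 0
  then show ?case by (auto intro!: continuous_intros)
next
  case (Suc k)
  show ?case
    using has_real_derivative_moving_integral[OF Suc] DERIV_isCont
    by (auto simp: continuous_on_eq_continuous_at)
qed

lemma bump_bounds: "\<bar>bump c k t\<bar> \<le> 1"
proof (induction k arbitrary: t)
  case (Suc k)
  show ?case
    using integral_bound[of "t - 1/2" "t + 1/2" "bump c k" 1] Suc
    by (simp add: continuous_on_subset[OF continuous_bump])
qed auto

lemma bump_eq_1: "\<bar>t\<bar> \<le> c - real k / 2 \<Longrightarrow> bump c k t = 1"
proof (induction k arbitrary: t)
  case (Suc k)
  have "integral {t - 1/2..t + 1/2} (bump c k) = integral {t - 1/2..t + 1/2} (\<lambda>x. 1)"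
    using Suc by (intro Henstock_Kurzweil_Integration.integral_cong) (auto simp: field_simps abs_le_iff)
  then show ?case by simp
qed auto

lemma bump_eq_0: "\<bar>t\<bar> \<ge> c + 1 + real k / 2 \<Longrightarrow> bump c k t = 0"
proof (induction k arbitrary: t)
  case (Suc k)
  have "integral {t - 1/2..t + 1/2} (bump c k) = integral {t - 1/2..t + 1/2} (\<lambda>x. 0)"
    using Suc by (intro Henstock_Kurzweil_Integration.integral_cong) (auto simp: field_simps abs_if split: if_splits)
  then show ?case by simp
qed auto

text \<open>The derivative of an average over a unit interval is the difference of two shifts of the
  averaged function. Hence the free shift b in the induction, and the doubling of the bound with
  each order.\<close>

lemma Cr_bound_bump:
  "Cr_bound k (\<lambda>x. 2 ^ k) (\<lambda>x::real^'n::finite. of_real (bump c k (x $ i + b)))"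
proof (induction k arbitrary: b)
  case 0
  show ?case
    using bump_bounds[of c 0] by (auto intro!: continuous_intros)
next
  case (Suc k)
  show ?case
  proof (rule Cr_bound_SucI[where g="\<lambda>j x. if j = i then of_real (bump c k (x $ i + (b + 1/2))) -
        of_real (bump c k (x $ i + (b - 1/2))) else 0"])
    show "continuous_on UNIV (\<lambda>x::real^'n. complex_of_real (bump c (Suc k) (x $ i + b)))"
      by (intro continuous_intros continuous_on_compose2[OF continuous_bump]) auto
    show "cmod (of_real (bump c (Suc k) (x $ i + b))) \<le> 2 ^ Suc k" for x :: "real^'n"
      using bump_bounds[of c "Suc k" "x $ i + b"] one_le_power[of "2::real" "Suc k"]
      by (simp del: bump.simps)
    show "Cr_bound k (\<lambda>x. 2 ^ Suc k) (\<lambda>x::real^'n. if j = i then of_real (bump c k (x $ i + (b + 1/2))) -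
        of_real (bump c k (x $ i + (b - 1/2))) else 0)" for j
    proof (cases "j = i")
      case True
      then show ?thesis using Cr_bound_diff[OF Suc[of "b + 1/2"] Suc[of "b - 1/2"]] by simp
    next
      case False
      have "Cr_bound k (\<lambda>x. 2 ^ Suc k) (\<lambda>x::real^'n. 0)"
        by (rule Cr_bound_mono[OF Cr_bound_const[of k 0]]) simp
      then show ?thesis using False by simp
    qed
    show "has_partial_deriv j (\<lambda>x. of_real (bump c (Suc k) (x $ i + b)))
        (if j = i then of_real (bump c k (x $ i + (b + 1/2))) - of_real (bump c k (x $ i + (b - 1/2))) else 0) x"
      for j and x :: "real^'n"
    proof (cases "j = i")
      case True
      have "((\<lambda>t. bump c (Suc k) (t + (x $ i + b))) has_real_derivative
          bump c k (x $ i + (b + 1/2)) - bump c k (x $ i + (b - 1/2))) (at 0)"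
      proof -
        have "bump c (Suc k) = (\<lambda>t. integral {t - 1/2..t + 1/2} (bump c k))" by auto
        then show ?thesis
          using has_real_derivative_moving_integral[OF continuous_bump, of c k "x $ i + b"]
          by (subst DERIV_shift[symmetric]) (simp add: algebra_simps del: bump.simps)
      qed
      then have "((\<lambda>t. complex_of_real (bump c (Suc k) (t + (x $ i + b)))) has_vector_derivative
          of_real (bump c k (x $ i + (b + 1/2)) - bump c k (x $ i + (b - 1/2)))) (at 0)"
        by (intro has_vector_derivative_of_real) (simp add: has_real_derivative_iff_has_vector_derivative)
      then show ?thesis using True by (simp add: ac_simps axis_def del: bump.simps)
    next
      case False
      then show ?thesis by (simp add: axis_def del: bump.simps)
    qed
  qed
qed

lemma Cr_bound_prod:
  assumes "finite I" "\<And>i. i \<in> I \<Longrightarrow> \<exists>T. Cr_bound r (\<lambda>x. T) (f i)"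
  shows "\<exists>T. Cr_bound r (\<lambda>x. T) (\<lambda>x. \<Prod>i\<in>I. f i x)"
  using assms
proof (induction I)
  case empty
  then show ?case using Cr_bound_const[of r 1] by auto
next
  case (insert i I)
  obtain S where S: "Cr_bound r (\<lambda>x. S) (f i)" using insert.prems by blast
  obtain T where T: "Cr_bound r (\<lambda>x. T) (\<lambda>x. \<Prod>i\<in>I. f i x)" using insert.IH insert.prems by blast
  from Cr_bound_mult[OF S T] show ?case using insert(1,2) by auto
qed

lemma Cr_cutoff:
  obtains \<theta> :: "real^'n::finite \<Rightarrow> complex" and T R where
    "Cr_bound r (\<lambda>x. T) \<theta>" "\<And>x. norm x \<le> 1 \<Longrightarrow> \<theta> x = 1" "\<And>x. norm x > R \<Longrightarrow> \<theta> x = 0" "1 \<le> R"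
proof -
  \<comment> \<open>After r averagings the plateau has half-width c - r/2 = 1 + r/2, which covers
    the unit ball, and the support has half-width \<open>?s\<close>. A point of norm above n times
    \<open>?s\<close> has a coordinate beyond that.\<close>
  define c where "c = 1 + real r"
  define \<theta> :: "real^'n \<Rightarrow> complex" where "\<theta> x = (\<Prod>i\<in>UNIV. of_real (bump c r (x $ i)))" for x
  let ?s = "c + 1 + real r / 2"
  have "\<exists>T. Cr_bound r (\<lambda>x. T) \<theta>"
    unfolding \<theta>_def using Cr_bound_bump[of r c _ 0] by (intro Cr_bound_prod) auto
  moreover have "\<theta> x = 1" if "norm x \<le> 1" for x
  proof -
    have "bump c r (x $ i) = 1" for i
      using component_le_norm_cart[of x i] that by (intro bump_eq_1) (auto simp: c_def)
    then show ?thesis by (simp add: \<theta>_def)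
  qed
  moreover have "\<theta> x = 0" if "norm x > real CARD('n) * ?s" for x
  proof -
    have "\<exists>i. \<bar>x $ i\<bar> \<ge> ?s"
    proof (rule ccontr)
      assume "\<nexists>i. \<bar>x $ i\<bar> \<ge> ?s"
      then have "(\<Sum>i\<in>UNIV. \<bar>x $ i\<bar>) \<le> (\<Sum>i\<in>(UNIV::'n set). ?s)"
        by (intro sum_mono) (auto simp: not_le intro: less_imp_le)
      then show False using norm_le_l1_cart[of x] that by simp
    qed
    then have "\<exists>i. bump c r (x $ i) = 0" using bump_eq_0 by blast
    then show ?thesis by (auto simp: \<theta>_def prod_zero_iff)
  qed
  moreover have "1 \<le> real CARD('n) * ?s"
    using mult_mono[of 1 "real CARD('n)" 1 ?s] by (auto simp: c_def Suc_le_eq)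
  ultimately show ?thesis using that by blast
qed

section \<open>Distributional point values\<close>

lemma lebesgue_affine:
  fixes t :: "'a::euclidean_space"
  assumes "c \<noteq> 0"
  shows "lebesgue = density (distr lebesgue lebesgue (\<lambda>x. t + c *\<^sub>R x)) (\<lambda>_. ennreal (\<bar>c\<bar> ^ DIM('a)))"
    and "(\<lambda>x. t + c *\<^sub>R x) \<in> lebesgue \<rightarrow>\<^sub>M lebesgue"
proof -
  have eq: "(\<lambda>x::'a. t + (\<Sum>j\<in>Basis. (c * (x \<bullet> j)) *\<^sub>R j)) = (\<lambda>x. t + c *\<^sub>R x)"
    by (simp add: scaleR_scaleR[symmetric] scaleR_sum_right[symmetric] euclidean_representation del: scaleR_scaleR)
  show "lebesgue = density (distr lebesgue lebesgue (\<lambda>x. t + c *\<^sub>R x)) (\<lambda>_. ennreal (\<bar>c\<bar> ^ DIM('a)))"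
    using lebesgue_affine_euclidean[where c="\<lambda>_::'a. c" and t=t] assms unfolding eq by simp
  show "(\<lambda>x. t + c *\<^sub>R x) \<in> lebesgue \<rightarrow>\<^sub>M lebesgue"
    using lebesgue_affine_measurable[where c="\<lambda>_::'a. c" and t=t] assms unfolding eq by simp
qed

lemma lebesgue_integral_affine:
  fixes f :: "'a::euclidean_space \<Rightarrow> 'b::{banach, second_countable_topology}"
  assumes c: "c \<noteq> 0" and f: "f \<in> borel_measurable lebesgue"
  shows "(LINT x|lebesgue. f x) = \<bar>c\<bar> ^ DIM('a) *\<^sub>R (LINT x|lebesgue. f (t + c *\<^sub>R x))"
proof -
  note m = lebesgue_affine(2)[OF c, of t]
  have "(LINT x|lebesgue. f x) = (LINT x|density (distr lebesgue lebesgue (\<lambda>x. t + c *\<^sub>R x)) (\<lambda>_. ennreal (\<bar>c\<bar> ^ DIM('a))). f x)"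
    using lebesgue_affine(1)[OF c, of t] by simp
  also have "\<dots> = (LINT x|distr lebesgue lebesgue (\<lambda>x. t + c *\<^sub>R x). (\<bar>c\<bar> ^ DIM('a)) *\<^sub>R f x)"
    using f by (intro integral_density) auto
  also have "\<dots> = \<bar>c\<bar> ^ DIM('a) *\<^sub>R (LINT x|lebesgue. f (t + c *\<^sub>R x))"
    using f m by (subst integral_distr) auto
  finally show ?thesis .
qed

lemma continuous_borel_measurable_lebesgue:
  fixes f :: "'a::euclidean_space \<Rightarrow> 'b::topological_space"
  shows "continuous_on UNIV f \<Longrightarrow> f \<in> borel_measurable lebesgue"
  by (intro measurable_completion) (simp add: borel_measurable_continuous_onI)

lemma integrable_inverse_power_norm_lebesgue:
  "integrable lebesgue (\<lambda>y::real^'n::finite. 1 / (1 + norm y) ^ (CARD('n) + 1))"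
  using integrable_inverse_power_norm by (subst integrable_completion) auto

lemma integrable_decay:
  fixes f :: "real^'n::finite \<Rightarrow> complex"
  assumes "f \<in> borel_measurable lebesgue" "\<And>x. cmod (f x) \<le> B / (1 + norm x) ^ (CARD('n) + 1)"
  shows "integrable lebesgue f"
proof (rule Bochner_Integration.integrable_bound[OF _ assms(1)])
  show "integrable lebesgue (\<lambda>y::real^'n. B * (1 / (1 + norm y) ^ (CARD('n) + 1)))"
    by (intro integrable_mult_right integrable_inverse_power_norm_lebesgue)
  show "AE x in lebesgue. norm (f x) \<le> norm (B * (1 / (1 + norm x) ^ (CARD('n) + 1)))"
  proof (rule AE_I2)
    fix x :: "real^'n"
    have "0 \<le> B" using order_trans[OF norm_ge_zero assms(2)[of 0]] by simp
    then show "norm (f x) \<le> norm (B * (1 / (1 + norm x) ^ (CARD('n) + 1)))"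
      using assms(2)[of x] by simp
  qed
qed

text \<open>Of the n + 2 powers of decay one is spent on the factor 1/N; the remaining n + 1 are
  integrable.\<close>

lemma integral_tail_bound:
  fixes f :: "real^'n::finite \<Rightarrow> complex"
  assumes "f \<in> borel_measurable lebesgue" "\<And>x. cmod (f x) \<le> B / (1 + norm x) ^ (CARD('n) + 2)"
    and "\<And>x. norm x < N \<Longrightarrow> f x = 0" and "0 < N"
  shows "cmod (LINT x|lebesgue. f x) \<le> B / N * (LINT y|lebesgue. 1 / (1 + norm (y::real^'n)) ^ (CARD('n) + 1))"
proof -
  let ?h = "\<lambda>y::real^'n. 1 / (1 + norm y) ^ (CARD('n) + 1)"
  have B: "0 \<le> B"
    using order_trans[OF norm_ge_zero assms(2)[of 0]] by simp
  have "cmod (f x) \<le> B / N * ?h x" for x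
  proof (cases "norm x < N")
    case True
    then show ?thesis using assms(3) B \<open>0 < N\<close> by simp
  next
    case False
    have "B / (1 + norm x) ^ (CARD('n) + 2) = (B / (1 + norm x)) * ?h x"
      by simp
    also have "\<dots> \<le> (B / N) * ?h x"
      using False B \<open>0 < N\<close> by (intro mult_right_mono divide_left_mono mult_pos_pos) auto
    finally show ?thesis using assms(2)[of x] by simp
  qed
  then have "cmod (LINT x|lebesgue. f x) \<le> (LINT x|lebesgue. B / N * ?h x)"
    by (intro Bochner_Integration.integral_norm_bound_integral integrable_mult_right integrable_inverse_power_norm_lebesgue
        integrable_decay[OF assms(1), of "B / N"]) auto
  also have "\<dots> = B / N * (LINT y|lebesgue. ?h y)" by (rule integral_mult_right_zero)
  finally show ?thesis .
qed

lemma compactly_supported_cball: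
  assumes "\<And>x. norm x > R \<Longrightarrow> \<psi> x = 0"
  shows "compactly_supported \<psi>" "closure {x. \<psi> x \<noteq> 0} \<subseteq> cball 0 R"
proof -
  show *: "closure {x. \<psi> x \<noteq> 0} \<subseteq> cball 0 R"
    using assms by (intro closure_minimal) (auto simp: not_less[symmetric])
  show "compactly_supported \<psi>"
    unfolding compactly_supported_def
    using * bounded_subset[OF bounded_cball] by (simp add: compact_eq_bounded_closed)
qed

text \<open>The scale is written as s = 1 / eps from here on, so that only multiplication by powers
  of s occurs and the limit is taken at infinity.\<close>

lemma dilated_pairing_inverse:
  fixes f :: "(real^'n::finite \<Rightarrow> complex) \<Rightarrow> complex"
  assumes "0 < s"
  shows "dilated_pairing f x0 (1 / s) \<psi> = of_real (s ^ CARD('n)) * f (\<lambda>y. \<psi> (s *\<^sub>R (y - x0)))"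
  using assms by (simp add: dilated_pairing_def power_one_over field_simps)

section \<open>Estimates for pairings at small scales\<close>

context decay_weight
begin

text \<open>All derivatives vanish outside the ball, and inside it the weight is at most its value
  at |R|, so a plain bound yields every weighted one.\<close>

lemma rapid_compact:
  assumes "Cr_bound r (\<lambda>x. A) \<psi>" "\<And>x. norm x > R \<Longrightarrow> \<psi> x = 0"
  shows "\<psi> \<in> rapid r"
  unfolding rapid_iff
proof
  fix l
  have A: "0 \<le> A" using assms(1) Cr_bound_nonneg by blast
  have "open {x::real^'a. norm x > R}"
    by (intro open_Collect_less continuous_intros)
  then have "Cr_bound r (\<lambda>x. if x \<in> {x. norm x > R} then 0 else A) \<psi>"
    by (rule Cr_bound_vanish) (use assms in auto)
  then have "Cr_bound r (\<lambda>x. A * W l \<bar>R\<bar> / W l (norm x)) \<psi>"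
  proof (rule Cr_bound_mono)
    fix x :: "real^'a"
    show "(if x \<in> {x. norm x > R} then 0 else A) \<le> A * W l \<bar>R\<bar> / W l (norm x)"
      using A pos[of "\<bar>R\<bar>" l] mono[of "norm x" "\<bar>R\<bar>" l]
      by (auto simp: pos_le_divide_eq intro!: mult_left_mono)
  qed
  then show "\<exists>B. Cr_bound r (\<lambda>x. B / W l (norm x)) \<psi>" by blast
qed

lemma continuous_dual_cmult:
  "f \<in> continuous_dual (rapid r) (weight_norm r) \<Longrightarrow> \<psi> \<in> rapid r \<Longrightarrow> f (\<lambda>x. c * \<psi> x) = c * f \<psi>"
  unfolding continuous_dual_def by auto

lemma continuous_dual_add:
  "f \<in> continuous_dual (rapid r) (weight_norm r) \<Longrightarrow> \<phi> \<in> rapid r \<Longrightarrow> \<psi> \<in> rapid r \<Longrightarrow>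
    f (\<lambda>x. \<phi> x + \<psi> x) = f \<phi> + f \<psi>"
  unfolding continuous_dual_def by auto

lemma dilated_pairing_add:
  assumes f: "f \<in> continuous_dual (rapid r) (weight_norm r)" and "\<phi> \<in> rapid r" "\<psi> \<in> rapid r" "1 \<le> s"
  shows "dilated_pairing f x0 (1 / s) (\<lambda>x. \<phi> x + \<psi> x) =
    dilated_pairing f x0 (1 / s) \<phi> + dilated_pairing f x0 (1 / s) \<psi>"
proof -
  have "f (\<lambda>y. \<phi> (s *\<^sub>R (y - x0)) + \<psi> (s *\<^sub>R (y - x0))) =
      f (\<lambda>y. \<phi> (s *\<^sub>R (y - x0))) + f (\<lambda>y. \<psi> (s *\<^sub>R (y - x0)))"
    using assms by (intro continuous_dual_add[OF f] rapid_dilate)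
  then show ?thesis
    using assms by (simp add: dilated_pairing_inverse algebra_simps)
qed

text \<open>Functions supported in the R-ball with derivatives bounded by 1 form one bounded set;
  homogeneity turns uniform convergence there into an error linear in A. The condition \<delta>
  \<le> 1 ensures s \<ge> 1, as \<open>rapid_dilate\<close> requires.\<close>

lemma point_value_uniform:
  fixes \<gamma> :: complex
  assumes f: "f \<in> continuous_dual (rapid r) (weight_norm r)"
    and pv: "point_value_order_le r f x0 \<gamma>" and \<eta>: "0 < \<eta>"
  obtains \<delta> where "0 < \<delta>" "\<delta> \<le> 1"
    "\<And>s A \<psi>. 0 < s \<Longrightarrow> 1 / s < \<delta> \<Longrightarrow> 0 < A \<Longrightarrow> Cr_bound r (\<lambda>x. A) \<psi> \<Longrightarrow>
       \<forall>x. norm x > R \<longrightarrow> \<psi> x = 0 \<Longrightarrow>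
       cmod (dilated_pairing f x0 (1 / s) \<psi> - \<gamma> * (LINT x|lebesgue. \<psi> x)) \<le> \<eta> * A"
proof -
  define B where "B = {\<psi>. Cr_bound r (\<lambda>x::real^'a. 1) \<psi> \<and> (\<forall>x. norm x > R \<longrightarrow> \<psi> x = 0)}"
  have b1: "B \<subseteq> Dr_space r"
    unfolding B_def Dr_space_def using Cr_bound_imp_Cr_fun compactly_supported_cball(1) by blast
  have b2: "\<forall>\<psi>\<in>B. closure {x. \<psi> x \<noteq> 0} \<subseteq> cball 0 R"
    unfolding B_def using compactly_supported_cball(2) by blast
  have b3: "\<forall>\<psi>\<in>B. \<forall>\<alpha>\<in>multi_indices r. \<forall>x. cmod (multi_deriv \<alpha> \<psi> x) \<le> 1"
    unfolding B_def Cr_bound_iff_multi_deriv by blast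
  have "Dr_bounded r B"
    unfolding Dr_bounded_def
    by (intro conjI exI[of _ "cball 0 R"] exI[of _ "1::real"] b1 b2 b3 compact_cball)
  then have "uniform_limit B (dilated_pairing f x0) (\<lambda>\<psi>. \<gamma> * (LINT x|lebesgue. \<psi> x)) (at 0)"
    using pv unfolding point_value_order_le_def by blast
  from uniform_limitD[OF this \<eta>] obtain d where d: "0 < d"
    "\<And>\<epsilon> \<psi>. \<epsilon> \<noteq> 0 \<Longrightarrow> \<bar>\<epsilon>\<bar> < d \<Longrightarrow> \<psi> \<in> B \<Longrightarrow>
      cmod (dilated_pairing f x0 \<epsilon> \<psi> - \<gamma> * (LINT x|lebesgue. \<psi> x)) < \<eta>"
    unfolding eventually_at by (auto simp: dist_norm)
  show ?thesis
  proof (rule that[of "min d 1"])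
    fix s A :: real and \<psi> :: "real^'a \<Rightarrow> complex"
    assume s: "0 < s" "1 / s < min d 1" and A: "0 < A" and \<psi>: "Cr_bound r (\<lambda>x. A) \<psi>"
      and "\<forall>x. norm x > R \<longrightarrow> \<psi> x = 0"
    then have supp: "\<And>x. norm x > R \<Longrightarrow> \<psi> x = 0" by blast
    let ?\<psi> = "\<lambda>x. of_real (1 / A) * \<psi> x"
    have "Cr_bound r (\<lambda>x. 1) ?\<psi>"
      by (rule Cr_bound_mono[OF Cr_bound_cmult[OF \<psi>]]) (use A in \<open>simp add: norm_divide\<close>)
    then have "?\<psi> \<in> B" unfolding B_def using supp by auto
    then have *: "cmod (dilated_pairing f x0 (1 / s) ?\<psi> - \<gamma> * (LINT x|lebesgue. ?\<psi> x)) < \<eta>"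
      using s by (intro d) auto
    have s1: "1 \<le> s" using s by (simp add: field_simps)
    have "(\<lambda>y. \<psi> (s *\<^sub>R (y - x0))) \<in> rapid r"
      using rapid_dilate[OF rapid_compact[OF \<psi> supp] s1] .
    from continuous_dual_cmult[OF f this, of "of_real (1 / A)"]
    have "dilated_pairing f x0 (1 / s) ?\<psi> = of_real (1 / A) * dilated_pairing f x0 (1 / s) \<psi>"
      using s by (simp add: dilated_pairing_inverse)
    then have "dilated_pairing f x0 (1 / s) ?\<psi> - \<gamma> * (LINT x|lebesgue. ?\<psi> x) =
        of_real (1 / A) * (dilated_pairing f x0 (1 / s) \<psi> - \<gamma> * (LINT x|lebesgue. \<psi> x))"
      by (simp add: algebra_simps)
    with * have "1 / A * cmod (dilated_pairing f x0 (1 / s) \<psi> - \<gamma> * (LINT x|lebesgue. \<psi> x)) < \<eta>"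
      using A by (simp only: norm_mult norm_of_real) simp
    then show "cmod (dilated_pairing f x0 (1 / s) \<psi> - \<gamma> * (LINT x|lebesgue. \<psi> x)) \<le> \<eta> * A"
      using A by (simp add: field_simps)
  qed (use d in auto)
qed

text \<open>Stretching \<theta> by N \<ge> 1 does not enlarge its derivatives, so the bound is
  uniform in N. In the ball of radius N the factor 1 - \<theta> is identically 0, which removes the
  derivatives there as well.\<close>

lemma Cr_bound_outer_part:
  assumes \<theta>: "Cr_bound r (\<lambda>x. T) \<theta>" "\<And>x. norm x \<le> 1 \<Longrightarrow> \<theta> x = 1"
    and \<kappa>: "Cr_bound r w \<kappa>" and N: "1 \<le> N"
  shows "Cr_bound r (\<lambda>z. if norm z < N then 0 else 2 ^ r * (1 + T) * w z)
    (\<lambda>z. (1 - \<theta> ((1 / N) *\<^sub>R z)) * \<kappa> z)"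
proof -
  have "Cr_bound r (\<lambda>z. max 1 \<bar>1 / N\<bar> ^ r * T) (\<lambda>z. \<theta> ((1 / N) *\<^sub>R z + 0))"
    by (rule Cr_bound_affine[OF \<theta>(1)])
  then have "Cr_bound r (\<lambda>z. T) (\<lambda>z. \<theta> ((1 / N) *\<^sub>R z))"
    using N by (simp add: max_absorb1)
  from Cr_bound_mult[OF Cr_bound_diff[OF Cr_bound_const[of r 1] this] \<kappa>]
  have "Cr_bound r (\<lambda>z. 2 ^ r * (1 + T) * w z) (\<lambda>z. (1 - \<theta> ((1 / N) *\<^sub>R z)) * \<kappa> z)"
    by simp
  moreover have "(1 - \<theta> ((1 / N) *\<^sub>R z)) * \<kappa> z = 0" if "z \<in> ball 0 N" for z
    using \<theta>(2)[of "(1 / N) *\<^sub>R z"] that N by simp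
  ultimately have "Cr_bound r (\<lambda>z. if z \<in> ball 0 N then 0 else 2 ^ r * (1 + T) * w z)
      (\<lambda>z. (1 - \<theta> ((1 / N) *\<^sub>R z)) * \<kappa> z)"
    by (intro Cr_bound_vanish[OF open_ball]) auto
  then show ?thesis by (rule Cr_bound_mono) auto
qed

text \<open>Three factors compete: s^n from normalising the pairing, s^r from differentiating the
  dilated function, and N^(-p) from decay beyond radius N. The constant is independent of s because
  the bounds on \<open>\<kappa> s\<close> are.\<close>

lemma outer_part_bound:
  fixes x0 :: "real^'n::finite"
  assumes f: "f \<in> continuous_dual (rapid r) (weight_norm r)"
    and \<theta>: "Cr_bound r (\<lambda>x. T) \<theta>" "\<And>x. norm x \<le> 1 \<Longrightarrow> \<theta> x = 1"
    and \<kappa>: "\<And>l. \<exists>B. \<forall>s. Cr_bound r (\<lambda>z. B / W l (norm z)) (\<kappa> s)"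
  obtains C where "\<And>s N. 1 \<le> s \<Longrightarrow> 1 \<le> N \<Longrightarrow>
    cmod (dilated_pairing f x0 (1 / s) (\<lambda>z. (1 - \<theta> ((1 / N) *\<^sub>R z)) * \<kappa> s z)) \<le>
      C * s ^ (CARD('n) + r) / N ^ p"
    and "0 \<le> C"
proof -
  obtain l C0 where C0: "0 \<le> C0"
    "\<And>\<psi> B. 0 < B \<Longrightarrow> \<psi> \<in> rapid r \<Longrightarrow> Cr_bound r (\<lambda>x. B / W l (norm x)) \<psi> \<Longrightarrow> cmod (f \<psi>) \<le> C0 * B"
    by (rule continuous_dual_bound[OF f]) (rule that)
  obtain k C1 where C1: "\<And>t. 0 \<le> t \<Longrightarrow> (1 + t) ^ p \<le> C1 * W k t" using poly_le by blast
  have "0 < C1" using C1[of 0] pos[of 0 k] by (simp add: zero_less_mult_iff) (smt (verit) mult_nonpos_nonneg)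
  \<comment> \<open>Index k pays for N^p and index 2 l for recentring at x0, which leaves the index
    l in which f is bounded.\<close>
  obtain B where B: "\<And>s. Cr_bound r (\<lambda>z. B / W (2 * l + k) (norm z)) (\<kappa> s)" using \<kappa> by blast
  have "0 \<le> B" using B Cr_bound_weight_nonneg by blast
  have "0 \<le> T" using \<theta>(1) Cr_bound_nonneg by blast
  \<comment> \<open>The added 1 makes D positive, so that it can enter the bound \<open>B\<close> of
    \<open>continuous_dual_bound\<close>.\<close>
  define D where "D = 2 ^ r * (1 + T) * B * C1 + 1"
  have D: "0 < D" using \<open>0 \<le> B\<close> \<open>0 \<le> T\<close> \<open>0 < C1\<close> by (simp add: D_def add_nonneg_pos)
  show ?thesis
  proof (rule that)
    show "0 \<le> C0 * D * W (2 * l) (norm x0)" using C0 D by simp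
    fix s N :: real assume s: "1 \<le> s" and N: "1 \<le> N"
    let ?P = "\<lambda>z. (1 - \<theta> ((1 / N) *\<^sub>R z)) * \<kappa> s z"
    have "Cr_bound r (\<lambda>z. (D / N ^ p) / W (2 * l) (norm z)) ?P"
    proof (rule Cr_bound_mono[OF Cr_bound_outer_part[OF \<theta> B N]])
      fix z :: "real^'n"
      show "(if norm z < N then 0 else 2 ^ r * (1 + T) * (B / W (2 * l + k) (norm z)))
          \<le> (D / N ^ p) / W (2 * l) (norm z)"
      proof (cases "norm z < N")
        case True
        then show ?thesis using D N by simp
      next
        case False
        have "N ^ p \<le> (1 + norm z) ^ p" using False N by (intro power_mono) auto
        also have "\<dots> \<le> C1 * W k (norm z)" by (rule C1) simp
        finally have "W (2 * l) (norm z) * N ^ p \<le> W (2 * l) (norm z) * (C1 * W k (norm z))"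
          by (intro mult_left_mono) auto
        also have "\<dots> \<le> C1 * W (2 * l + k) (norm z)"
          using mult_left_mono[OF mult_le[of "norm z" "2 * l" k], of C1] \<open>0 < C1\<close> by (simp add: ac_simps)
        finally have "1 / W (2 * l + k) (norm z) \<le> C1 / (N ^ p * W (2 * l) (norm z))"
          using N by (simp add: field_simps)
        then have "2 ^ r * (1 + T) * B * (1 / W (2 * l + k) (norm z)) \<le> 2 ^ r * (1 + T) * B * (C1 / (N ^ p * W (2 * l) (norm z)))"
          using \<open>0 \<le> B\<close> \<open>0 \<le> T\<close> by (intro mult_left_mono) auto
        also have "\<dots> \<le> D / (N ^ p * W (2 * l) (norm z))"
          using N by (simp add: D_def divide_right_mono)
        finally show ?thesis using False by simp
      qed
    qed
    from Cr_bound_dilate[OF this s, of x0]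
    have bd: "Cr_bound r (\<lambda>y. (s ^ r * (D / N ^ p) * W (2 * l) (norm x0)) / W l (norm y)) (\<lambda>y. ?P (s *\<^sub>R (y - x0)))" .
    have "\<kappa> s \<in> rapid r" unfolding rapid_iff using \<kappa> by blast
    moreover have "Cr_bound r (\<lambda>z. 1 + T) (\<lambda>z. 1 - \<theta> ((1 / N) *\<^sub>R z))"
      using Cr_bound_diff[OF Cr_bound_const[of r 1] Cr_bound_affine[OF \<theta>(1), of "1 / N" 0]] N
      by (simp add: max_absorb1)
    ultimately have "?P \<in> rapid r" by (intro rapid_mult_bounded)
    then have "(\<lambda>y. ?P (s *\<^sub>R (y - x0))) \<in> rapid r" by (rule rapid_dilate[OF _ s])
    from C0(2)[OF _ this bd] have "cmod (f (\<lambda>y. ?P (s *\<^sub>R (y - x0)))) \<le> C0 * (s ^ r * (D / N ^ p) * W (2 * l) (norm x0))"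
      using s N D by simp
    then have "s ^ CARD('n) * cmod (f (\<lambda>y. ?P (s *\<^sub>R (y - x0)))) \<le> s ^ CARD('n) * (C0 * (s ^ r * (D / N ^ p) * W (2 * l) (norm x0)))"
      using s by (intro mult_left_mono) auto
    then show "cmod (dilated_pairing f x0 (1 / s) ?P) \<le> C0 * D * W (2 * l) (norm x0) * s ^ (CARD('n) + r) / N ^ p"
      using s by (simp add: dilated_pairing_inverse norm_mult norm_power power_add ac_simps)
  qed
qed

lemma rapid_measurable: "\<psi> \<in> rapid r \<Longrightarrow> \<psi> \<in> borel_measurable lebesgue"
  unfolding rapid_iff using Cr_bound_continuous continuous_borel_measurable_lebesgue by blast

lemma rapid_integrable: 
  fixes \<psi> :: "real^'n::finite \<Rightarrow> complex"
  assumes "\<psi> \<in> rapid r"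
  shows "integrable lebesgue \<psi>"
proof -
  obtain B where "Cr_bound r (\<lambda>x. B / (1 + norm x) ^ (CARD('n) + 1)) \<psi>"
    using rapid_poly'[OF assms] by blast
  then show ?thesis
    by (intro integrable_decay[OF rapid_measurable[OF assms]] Cr_bound_le)
qed

text \<open>Telescoping over k. The shell at scale m = 2^(k+1) contributes at most \<eta> A0 / 2^k,
  where A0 collects 2^r from the product rule, T + 2^r T from the difference of cutoffs, the decay
  constant B, and 2^(n + r) from m = 2 * 2^k. With 2 A0 inside A this is at most \<eta> A / 2^(k+1),
  exactly the growth of A (2 - 1/2^k) times \<eta>; the summand 2^r T B serves k = 0.\<close>

lemma inner_part_bound:
  fixes x0 :: "real^'n::finite" and \<gamma> :: complex
  assumes f: "f \<in> continuous_dual (rapid r) (weight_norm r)"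
    and \<delta>: "\<delta> \<le> 1" and \<eta>: "0 < \<eta>"
    and H: "\<And>s A \<psi>. 0 < s \<Longrightarrow> 1 / s < \<delta> \<Longrightarrow> 0 < A \<Longrightarrow> Cr_bound r (\<lambda>x. A) \<psi> \<Longrightarrow>
       \<forall>x. norm x > R \<longrightarrow> \<psi> x = 0 \<Longrightarrow>
       cmod (dilated_pairing f x0 (1 / s) \<psi> - \<gamma> * (LINT x|lebesgue. \<psi> x)) \<le> \<eta> * A"
    and \<theta>: "Cr_bound r (\<lambda>x. T) \<theta>" "\<And>x. norm x \<le> 1 \<Longrightarrow> \<theta> x = 1" "\<And>x. norm x > R \<Longrightarrow> \<theta> x = 0"
    and \<kappa>: "\<kappa> \<in> rapid r" "Cr_bound r (\<lambda>z. B / (1 + norm z) ^ (CARD('n) + r + 1)) \<kappa>"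
    and T: "0 < T" and B: "0 < B"
  defines "A0 \<equiv> 2 ^ r * (T + 2 ^ r * T) * B * 2 ^ r * 2 ^ CARD('n)"
  defines "A \<equiv> 2 * A0 + 2 ^ r * T * B"
  shows "0 < s \<Longrightarrow> 2 ^ k / s < \<delta> \<Longrightarrow>
    cmod (dilated_pairing f x0 (1 / s) (\<lambda>z. \<theta> ((1 / 2 ^ k) *\<^sub>R z) * \<kappa> z) -
      \<gamma> * (LINT z|lebesgue. \<theta> ((1 / 2 ^ k) *\<^sub>R z) * \<kappa> z)) \<le> \<eta> * (A * (2 - 1 / 2 ^ k))"
proof (induction k)
  case 0
  have R: "\<theta> z * \<kappa> z = 0" if "norm z > R" for z using \<theta>(3) that by simp
  have "Cr_bound r (\<lambda>z. 2 ^ r * T * B) (\<lambda>z. \<theta> z * \<kappa> z)"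
  proof (rule Cr_bound_mono[OF Cr_bound_mult[OF \<theta>(1) \<kappa>(2)]])
    fix z :: "real^'n"
    have "B / (1 + norm z) ^ (CARD('n) + r + 1) \<le> B / 1"
      using B by (intro divide_left_mono one_le_power mult_pos_pos zero_less_power) (auto simp: add_pos_nonneg)
    then show "2 ^ r * T * (B / (1 + norm z) ^ (CARD('n) + r + 1)) \<le> 2 ^ r * T * B"
      using T by (intro mult_left_mono) auto
  qed
  then have "cmod (dilated_pairing f x0 (1 / s) (\<lambda>z. \<theta> z * \<kappa> z) - \<gamma> * (LINT z|lebesgue. \<theta> z * \<kappa> z)) \<le> \<eta> * (2 ^ r * T * B)"
    using 0 R T B by (intro H) auto
  also have "\<dots> \<le> \<eta> * A"
    using \<eta> T B by (intro mult_left_mono) (auto simp: A_def A0_def)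
  finally show ?case by simp
next
  case (Suc k)
  define m :: real where "m = 2 ^ Suc k"
  have m: "0 < m" "2 / m = 1 / 2 ^ k" by (auto simp: m_def)
  let ?\<Theta> = "\<lambda>z. \<theta> ((1 / 2 ^ k) *\<^sub>R z) * \<kappa> z"
  \<comment> \<open>The increment \<open>P\<close> brought to unit scale by z = m u. It can be
    nonzero only for 1/2 \<le> |u| \<le> R, a region that does not depend on k.\<close>
  define \<psi> where "\<psi> u = (\<theta> u - \<theta> (2 *\<^sub>R u)) * \<kappa> (m *\<^sub>R u)" for u
  define P where "P z = (\<theta> ((1 / m) *\<^sub>R z) - \<theta> ((2 / m) *\<^sub>R z)) * \<kappa> z" for z
  have ps: "P (m *\<^sub>R u) = \<psi> u" for u using m(1) by (simp add: P_def \<psi>_def)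
  have split: "(\<lambda>z. \<theta> ((1 / 2 ^ Suc k) *\<^sub>R z) * \<kappa> z) = (\<lambda>z. ?\<Theta> z + P z)"
    by (auto simp: P_def m(2) m_def[symmetric] algebra_simps simp del: power_Suc)
  have "2 ^ k / s < 2 ^ Suc k / s" using Suc.prems by (simp add: divide_strict_right_mono)
  then have k: "2 ^ k / s < \<delta>" using Suc.prems by linarith
  have "1 / s \<le> 2 ^ k / s" using Suc.prems by (intro divide_right_mono) auto
  then have "1 / s < 1" using k \<delta> by linarith
  then have s: "1 \<le> s" using Suc.prems by simp
  have \<theta>s: "\<exists>T. Cr_bound r (\<lambda>z. T) (\<lambda>z. \<theta> (a *\<^sub>R z))" for a
    using Cr_bound_affine[OF \<theta>(1), of a 0] by auto
  have \<Theta>r: "?\<Theta> \<in> rapid r" using \<theta>s rapid_mult_bounded \<kappa> by blast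
  have Pr: "P \<in> rapid r"
  proof -
    obtain T1 where 1: "Cr_bound r (\<lambda>z. T1) (\<lambda>z. \<theta> ((1 / m) *\<^sub>R z))" using \<theta>s by blast
    obtain T2 where 2: "Cr_bound r (\<lambda>z. T2) (\<lambda>z. \<theta> ((2 / m) *\<^sub>R z))" using \<theta>s by blast
    show ?thesis unfolding P_def by (rule rapid_mult_bounded[OF Cr_bound_diff[OF 1 2] \<kappa>(1)])
  qed
  \<comment> \<open>Derivatives of \<kappa>(m u) cost m^r, and |u| \<ge> 1/2 puts the argument at
    distance at least m/2 = 2^k from the origin.\<close>
  define v where "v = 2 ^ r * (T + 2 ^ r * T) * (m ^ r * B / (2 ^ k) ^ (CARD('n) + r + 1))"
  have v: "0 < v" using T B m unfolding v_def by (intro mult_pos_pos divide_pos_pos add_pos_pos) auto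
  have "Cr_bound r (\<lambda>u. v) \<psi>"
  proof -
    have 1: "Cr_bound r (\<lambda>u. 2 ^ r * T) (\<lambda>u. \<theta> (2 *\<^sub>R u))"
      using Cr_bound_affine[OF \<theta>(1), of 2 0] by simp
    have 2: "Cr_bound r (\<lambda>u. if u \<in> ball 0 (1/2) then 0 else T + 2 ^ r * T) (\<lambda>u. \<theta> u - \<theta> (2 *\<^sub>R u))"
      by (intro Cr_bound_vanish Cr_bound_diff \<theta> 1) (auto simp: \<theta>(2))
    have 3: "Cr_bound r (\<lambda>u. m ^ r * (B / (1 + norm (m *\<^sub>R u)) ^ (CARD('n) + r + 1))) (\<lambda>u. \<kappa> (m *\<^sub>R u))"
    proof -
      have "1 \<le> m" unfolding m_def by (rule one_le_power) simp
      then show ?thesis using Cr_bound_affine[OF \<kappa>(2), of m 0] by (simp add: max_absorb2)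
    qed
    show ?thesis
      unfolding \<psi>_def
    proof (rule Cr_bound_mono[OF Cr_bound_mult[OF 2 3]])
      fix u :: "real^'n"
      show "2 ^ r * (if u \<in> ball 0 (1/2) then 0 else T + 2 ^ r * T) *
          (m ^ r * (B / (1 + norm (m *\<^sub>R u)) ^ (CARD('n) + r + 1))) \<le> v"
      proof (cases "u \<in> ball 0 (1/2)")
        case True
        then show ?thesis using v by simp
      next
        case False
        have "2 ^ k \<le> 1 + norm (m *\<^sub>R u)"
        proof -
          have "m * (1/2) \<le> m * norm u" using False m by (intro mult_left_mono) auto
          moreover have "m * (1/2) = 2 ^ k" by (simp add: m_def)
          moreover have "norm (m *\<^sub>R u) = m * norm u" using m(1) by simp
          ultimately show ?thesis by linarith
        qed
        then have "(2 ^ k) ^ (CARD('n) + r + 1) \<le> (1 + norm (m *\<^sub>R u)) ^ (CARD('n) + r + 1)"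
          by (intro power_mono) auto
        then have "B / (1 + norm (m *\<^sub>R u)) ^ (CARD('n) + r + 1) \<le> B / (2 ^ k) ^ (CARD('n) + r + 1)"
          using B by (intro divide_left_mono mult_pos_pos zero_less_power) (auto simp: add_pos_nonneg)
        then have "m ^ r * (B / (1 + norm (m *\<^sub>R u)) ^ (CARD('n) + r + 1)) \<le> m ^ r * (B / (2 ^ k) ^ (CARD('n) + r + 1))"
          using m by (intro mult_left_mono) auto
        then have "2 ^ r * (T + 2 ^ r * T) * (m ^ r * (B / (1 + norm (m *\<^sub>R u)) ^ (CARD('n) + r + 1)))
            \<le> 2 ^ r * (T + 2 ^ r * T) * (m ^ r * (B / (2 ^ k) ^ (CARD('n) + r + 1)))"
          by (rule mult_left_mono) (use T in simp)
        then show ?thesis using False by (simp add: v_def)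
      qed
    qed
  qed
  moreover have "\<psi> u = 0" if "norm u > R" for u
  proof -
    have "norm u \<le> norm (2 *\<^sub>R u)" by simp
    then have "norm (2 *\<^sub>R u) > R" using that by linarith
    then show ?thesis using \<theta>(3)[of u] \<theta>(3)[of "2 *\<^sub>R u"] that by (simp add: \<psi>_def)
  qed
  \<comment> \<open>The point value is used at the coarser parameter m / s, which the hypothesis
    keeps below \<delta>.\<close>
  ultimately have "cmod (dilated_pairing f x0 (1 / (s / m)) \<psi> - \<gamma> * (LINT x|lebesgue. \<psi> x)) \<le> \<eta> * v"
    using Suc.prems m v by (intro H) (auto simp: m_def)
  moreover have "dilated_pairing f x0 (1 / s) P = of_real (m ^ CARD('n)) * dilated_pairing f x0 (1 / (s / m)) \<psi>"
  proof -
    have "P (s *\<^sub>R (y - x0)) = \<psi> ((s / m) *\<^sub>R (y - x0))" for y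
      using ps[of "(s / m) *\<^sub>R (y - x0)"] m by simp
    then show ?thesis
      using dilated_pairing_inverse[of s f x0 P] dilated_pairing_inverse[of "s / m" f x0 \<psi>] Suc.prems m
      by (simp add: power_divide)
  qed
  moreover have "(LINT x|lebesgue. P x) = of_real (m ^ CARD('n)) * (LINT x|lebesgue. \<psi> x)"
  proof -
    have "(LINT x|lebesgue. P x) = m ^ CARD('n) *\<^sub>R (LINT x|lebesgue. \<psi> x)"
      using lebesgue_integral_affine[OF _ rapid_measurable[OF Pr], of m 0] m(1) by (simp add: ps)
    then show ?thesis by (simp only: scaleR_conv_of_real)
  qed
  ultimately have "cmod (dilated_pairing f x0 (1 / s) P - \<gamma> * (LINT x|lebesgue. P x)) \<le> m ^ CARD('n) * (\<eta> * v)"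
  proof -
    assume *: "cmod (dilated_pairing f x0 (1 / (s / m)) \<psi> - \<gamma> * (LINT x|lebesgue. \<psi> x)) \<le> \<eta> * v"
      "dilated_pairing f x0 (1 / s) P = of_real (m ^ CARD('n)) * dilated_pairing f x0 (1 / (s / m)) \<psi>"
      "(LINT x|lebesgue. P x) = of_real (m ^ CARD('n)) * (LINT x|lebesgue. \<psi> x)"
    have "dilated_pairing f x0 (1 / s) P - \<gamma> * (LINT x|lebesgue. P x) = of_real (m ^ CARD('n)) *
        (dilated_pairing f x0 (1 / (s / m)) \<psi> - \<gamma> * (LINT x|lebesgue. \<psi> x))"
      unfolding *(2,3) by (simp add: algebra_simps)
    then have "cmod (dilated_pairing f x0 (1 / s) P - \<gamma> * (LINT x|lebesgue. P x)) = m ^ CARD('n) *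
        cmod (dilated_pairing f x0 (1 / (s / m)) \<psi> - \<gamma> * (LINT x|lebesgue. \<psi> x))"
      using m by (simp add: norm_mult norm_power)
    then show ?thesis using *(1) m by (simp add: mult_left_mono)
  qed
  \<comment> \<open>Here m^(n + r) meets (2^k)^(n + r + 1): one factor 2^k survives in the
    denominator and makes the shells summable.\<close>
  also have "m ^ CARD('n) * (\<eta> * v) = \<eta> * (A0 / 2 ^ k)"
  proof -
    have "m ^ CARD('n) * v = A0 / 2 ^ k"
      unfolding v_def A0_def m_def power_Suc power_mult_distrib power_add power_one_right
      by (simp add: field_simps)
    then show ?thesis by (simp add: mult.left_commute)
  qed
  also have "\<dots> \<le> \<eta> * (A / 2 ^ Suc k)"
    using \<eta> T B by (intro mult_left_mono) (auto simp: A_def field_simps)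
  finally have step: "cmod (dilated_pairing f x0 (1 / s) P - \<gamma> * (LINT x|lebesgue. P x)) \<le> \<eta> * (A / 2 ^ Suc k)" .
  have "dilated_pairing f x0 (1 / s) (\<lambda>z. ?\<Theta> z + P z) - \<gamma> * (LINT z|lebesgue. ?\<Theta> z + P z) =
      (dilated_pairing f x0 (1 / s) ?\<Theta> - \<gamma> * (LINT z|lebesgue. ?\<Theta> z)) +
      (dilated_pairing f x0 (1 / s) P - \<gamma> * (LINT z|lebesgue. P z))"
    unfolding dilated_pairing_add[OF f \<Theta>r Pr s]
    using rapid_integrable[OF \<Theta>r] rapid_integrable[OF Pr] by (simp add: algebra_simps)
  then have "cmod (dilated_pairing f x0 (1 / s) (\<lambda>z. ?\<Theta> z + P z) - \<gamma> * (LINT z|lebesgue. ?\<Theta> z + P z))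
      \<le> \<eta> * (A * (2 - 1 / 2 ^ k)) + \<eta> * (A / 2 ^ Suc k)"
    using Suc.IH[OF Suc.prems(1) k] step by (simp only:) (rule norm_triangle_mono)
  also have "\<dots> = \<eta> * (A * (2 - 1 / 2 ^ Suc k))"
    by (simp add: field_simps)
  finally show ?case unfolding split .
qed

text \<open>The profiles need not converge as s grows; bounds uniform in s and a fixed integral
  suffice, since the error estimates depend on nothing else.\<close>

theorem dilated_pairing_tendsto:
  fixes x0 :: "real^'n::finite" and \<gamma> :: complex
  assumes f: "f \<in> continuous_dual (rapid r) (weight_norm r)"
    and pv: "point_value_order_le r f x0 \<gamma>"
    and \<kappa>: "\<And>l. \<exists>B. \<forall>s. Cr_bound r (\<lambda>z. B / W l (norm z)) (\<kappa> s)"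
    and int: "\<And>s. (LINT z|lebesgue. \<kappa> s z) = 1"
  shows "((\<lambda>s. dilated_pairing f x0 (1 / s) (\<kappa> s)) \<longlongrightarrow> \<gamma>) at_top"
proof (rule tendstoI)
  fix \<epsilon> :: real assume \<epsilon>: "0 < \<epsilon>"
  let ?n = "CARD('n)" and ?p = "CARD('n) + r + 1"
  obtain \<theta> :: "real^'n \<Rightarrow> complex" and T0 R where \<theta>: "Cr_bound r (\<lambda>x. T0) \<theta>"
    "\<And>x. norm x \<le> 1 \<Longrightarrow> \<theta> x = 1" "\<And>x. norm x > R \<Longrightarrow> \<theta> x = 0"
    using Cr_cutoff[where r=r] by metis
  define T where "T = T0 + 1"
  have "0 \<le> T0" using \<theta>(1) Cr_bound_nonneg by blast
  then have T: "0 < T" "Cr_bound r (\<lambda>x. T) \<theta>"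
    using Cr_bound_mono[OF \<theta>(1), of "\<lambda>x. T"] by (auto simp: T_def)
  have \<kappa>r: "\<kappa> s \<in> rapid r" for s unfolding rapid_iff using \<kappa> by blast
  have poly: "\<exists>B>0. \<forall>s. Cr_bound r (\<lambda>z. B / (1 + norm z) ^ p) (\<kappa> s)" for p
  proof -
    obtain k C where C: "\<And>t. 0 \<le> t \<Longrightarrow> (1 + t) ^ p \<le> C * W k t" using poly_le by blast
    obtain B where B: "\<And>s. Cr_bound r (\<lambda>z. B / W k (norm z)) (\<kappa> s)" using \<kappa> by blast
    have "0 \<le> B" using B Cr_bound_weight_nonneg by blast
    have "0 < C" using C[of 0] pos[of 0 k] by (simp add: zero_less_mult_iff) (smt (verit) mult_nonpos_nonneg)
    have "B / W k (norm z) \<le> (B * C + 1) / (1 + norm z) ^ p" for z :: "real^'n"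
    proof -
      have "1 / W k (norm z) \<le> C / (1 + norm z) ^ p"
        using C[of "norm z"] by (simp add: field_simps add_pos_nonneg)
      then have "B * (1 / W k (norm z)) \<le> B * (C / (1 + norm z) ^ p)"
        using \<open>0 \<le> B\<close> by (intro mult_left_mono)
      also have "\<dots> \<le> (B * C + 1) / (1 + norm z) ^ p"
        by (simp add: divide_right_mono)
      finally show ?thesis by simp
    qed
    then have "Cr_bound r (\<lambda>z. (B * C + 1) / (1 + norm z) ^ p) (\<kappa> s)" for s
      by (rule Cr_bound_mono[OF B])
    moreover have "0 < B * C + 1" using \<open>0 \<le> B\<close> \<open>0 < C\<close> by (simp add: add_nonneg_pos)
    ultimately show ?thesis by blast
  qed
  obtain B where B: "0 < B" "\<And>s. Cr_bound r (\<lambda>z. B / (1 + norm z) ^ ?p) (\<kappa> s)"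
    using poly by blast
  obtain B2 where B2: "0 < B2" "\<And>s. Cr_bound r (\<lambda>z. B2 / (1 + norm z) ^ (?n + 2)) (\<kappa> s)"
    using poly by blast
  obtain C where outer: "\<And>s N. 1 \<le> s \<Longrightarrow> 1 \<le> N \<Longrightarrow>
    cmod (dilated_pairing f x0 (1 / s) (\<lambda>z. (1 - \<theta> ((1 / N) *\<^sub>R z)) * \<kappa> s z)) \<le>
      C * s ^ (?n + r) / N ^ ?p" "0 \<le> C"
    by (rule outer_part_bound[OF f T(2) \<theta>(2) \<kappa>, where ?x0.0=x0 and p="?p"]) (assumption, rule that)
  note C = outer(2,1)
  \<comment> \<open>The constant of \<open>inner_part_bound\<close>. The telescoped error stays
    below 2 \<eta> A, which the choice of \<eta> turns into half of \<epsilon>.\<close>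
  define A where "A = 2 * (2 ^ r * (T + 2 ^ r * T) * B * 2 ^ r * 2 ^ ?n) + 2 ^ r * T * B"
  have A: "0 < A" unfolding A_def using T B by (intro add_pos_pos mult_pos_pos) auto
  define \<eta> where "\<eta> = \<epsilon> / (4 * A)"
  have \<eta>: "0 < \<eta>" using \<epsilon> A by (simp add: \<eta>_def)
  obtain \<delta> where \<delta>: "0 < \<delta>" "\<delta> \<le> 1" and
    H: "\<And>s A \<psi>. 0 < s \<Longrightarrow> 1 / s < \<delta> \<Longrightarrow> 0 < A \<Longrightarrow> Cr_bound r (\<lambda>x. A) \<psi> \<Longrightarrow>
       \<forall>x. norm x > R \<longrightarrow> \<psi> x = 0 \<Longrightarrow>
       cmod (dilated_pairing f x0 (1 / s) \<psi> - \<gamma> * (LINT x|lebesgue. \<psi> x)) \<le> \<eta> * A"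
    by (rule point_value_uniform[OF f pv \<eta>, of R]) (rule that)
  let ?J = "LINT y|lebesgue. 1 / (1 + norm (y::real^'n)) ^ (?n + 1)"
  \<comment> \<open>Collects the two contributions from beyond the cutoff radius, the pairing and
    \<gamma> times the integral, each of size O(1/s).\<close>
  define D where "D = C * (2 / \<delta>) ^ ?p + cmod \<gamma> * (2 ^ r * (1 + T) * B2 * ?J * (2 / \<delta>))"
  have J: "0 \<le> ?J" by (intro Bochner_Integration.integral_nonneg) simp
  have main: "cmod (dilated_pairing f x0 (1 / s) (\<kappa> s) - \<gamma>) \<le> \<epsilon> / 2 + D / s" if s: "s > 1 / \<delta>" "s \<ge> 1" for s
  proof -
    have "1 < \<delta> * s" using s \<delta> by (simp add: field_simps)
    \<comment> \<open>The largest admissible dyadic radius: 2^k < \<delta> s admits the inner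
      estimate, and \<delta> s \<le> 2^(k+1) makes 1/2^k of size O(1/s) for the tails. For k = 0 the
      first inequality comes from 1 < \<delta> s.\<close>
    define k where "k = (LEAST k. \<delta> * s \<le> 2 ^ Suc k)"
    have ex: "\<exists>k. \<delta> * s \<le> 2 ^ Suc k"
    proof -
      obtain k where "\<delta> * s < 2 ^ k" using real_arch_pow[of 2 "\<delta> * s"] by auto
      then have "\<delta> * s \<le> 2 ^ Suc k" by (simp add: order_trans[OF less_imp_le])
      then show ?thesis by blast
    qed
    have k1: "\<delta> * s \<le> 2 ^ Suc k" unfolding k_def using ex by (rule LeastI_ex)
    have k2: "2 ^ k < \<delta> * s"
    proof (cases k)
      case 0
      then show ?thesis using \<open>1 < \<delta> * s\<close> by simp
    next
      case (Suc j)
      then show ?thesis using not_less_Least[of j "\<lambda>k. \<delta> * s \<le> 2 ^ Suc k"] k_def by auto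
    qed
    let ?N = "2 ^ k :: real"
    let ?\<Theta> = "\<lambda>z. \<theta> ((1 / ?N) *\<^sub>R z) * \<kappa> s z" and ?P = "\<lambda>z. (1 - \<theta> ((1 / ?N) *\<^sub>R z)) * \<kappa> s z"
    have "1 \<le> ?N" by simp
    have N: "1 / ?N \<le> (2 / \<delta>) / s" using k1 \<delta> s by (simp add: field_simps)
    have \<theta>N: "Cr_bound r (\<lambda>z. T) (\<lambda>z. \<theta> ((1 / ?N) *\<^sub>R z))"
      using Cr_bound_affine[OF T(2), of "1 / ?N" 0] \<open>1 \<le> ?N\<close> by (simp add: max_absorb1)
    have \<Theta>r: "?\<Theta> \<in> rapid r" by (rule rapid_mult_bounded[OF \<theta>N \<kappa>r])
    have Pr: "?P \<in> rapid r"
      by (rule rapid_mult_bounded[OF Cr_bound_diff[OF Cr_bound_const[of r 1] \<theta>N] \<kappa>r])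
    have eq: "(\<lambda>z. ?\<Theta> z + ?P z) = \<kappa> s" by (auto simp: algebra_simps)
    have "dilated_pairing f x0 (1 / s) (\<kappa> s) = dilated_pairing f x0 (1 / s) ?\<Theta> + dilated_pairing f x0 (1 / s) ?P"
      using dilated_pairing_add[OF f \<Theta>r Pr s(2), of x0] unfolding eq .
    moreover have "1 = (LINT z|lebesgue. ?\<Theta> z) + (LINT z|lebesgue. ?P z)"
      using Bochner_Integration.integral_add[OF rapid_integrable[OF \<Theta>r] rapid_integrable[OF Pr]] int[of s]
      unfolding eq by simp
    ultimately have split: "dilated_pairing f x0 (1 / s) (\<kappa> s) - \<gamma> =
        (dilated_pairing f x0 (1 / s) ?\<Theta> - \<gamma> * (LINT z|lebesgue. ?\<Theta> z)) +
        (dilated_pairing f x0 (1 / s) ?P - \<gamma> * (LINT z|lebesgue. ?P z))"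
      by (metis (no_types, lifting) add_diff_add distrib_left mult.right_neutral)
    have 1: "cmod (dilated_pairing f x0 (1 / s) ?\<Theta> - \<gamma> * (LINT z|lebesgue. ?\<Theta> z)) \<le> \<epsilon> / 2"
    proof -
      have "cmod (dilated_pairing f x0 (1 / s) ?\<Theta> - \<gamma> * (LINT z|lebesgue. ?\<Theta> z)) \<le> \<eta> * (A * (2 - 1 / 2 ^ k))"
        unfolding A_def
        by (rule inner_part_bound[OF f \<delta>(2) \<eta> H T(2) \<theta>(2,3) \<kappa>r B(2) T(1) B(1)])
          (use s k2 in \<open>auto simp: field_simps\<close>)
      also have "\<dots> \<le> \<eta> * (A * 2)" using \<eta> A by (intro mult_left_mono) auto
      also have "\<dots> = \<epsilon> / 2" using A by (simp add: \<eta>_def)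
      finally show ?thesis .
    qed
    have 2: "cmod (dilated_pairing f x0 (1 / s) ?P) \<le> C * (2 / \<delta>) ^ ?p / s"
    proof -
      have "cmod (dilated_pairing f x0 (1 / s) ?P) \<le> C * s ^ (?n + r) * (1 / ?N) ^ ?p"
        using C(2)[OF s(2) \<open>1 \<le> ?N\<close>] by (simp add: power_divide)
      also have "\<dots> \<le> C * s ^ (?n + r) * ((2 / \<delta>) / s) ^ ?p"
        using C(1) s N by (intro mult_left_mono power_mono) auto
      also have "\<dots> = C * (2 / \<delta>) ^ ?p / s"
        using s by (simp add: power_divide power_mult_distrib)
      finally show ?thesis .
    qed
    have 3: "cmod (LINT z|lebesgue. ?P z) \<le> 2 ^ r * (1 + T) * B2 * ?J * (2 / \<delta>) / s"
    proof -
      have bd: "Cr_bound r (\<lambda>z. if norm z < ?N then 0 else 2 ^ r * (1 + T) * (B2 / (1 + norm z) ^ (?n + 2))) ?P"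
        by (rule Cr_bound_outer_part[OF T(2) \<theta>(2) B2(2) \<open>1 \<le> ?N\<close>])
      have "cmod (LINT z|lebesgue. ?P z) \<le> (2 ^ r * (1 + T) * B2) / ?N * ?J"
      proof (rule integral_tail_bound[OF rapid_measurable[OF Pr]])
        show "cmod (?P z) \<le> (2 ^ r * (1 + T) * B2) / (1 + norm z) ^ (?n + 2)" for z
          using Cr_bound_le[OF bd, of z] T(1) B2(1)
          by (auto split: if_splits)
        show "?P z = 0" if "norm z < ?N" for z
          using Cr_bound_le[OF bd, of z] that by simp
      qed auto
      also have "\<dots> = (2 ^ r * (1 + T) * B2 * ?J) * (1 / ?N)" by simp
      also have "\<dots> \<le> (2 ^ r * (1 + T) * B2 * ?J) * ((2 / \<delta>) / s)"
        using T(1) B2(1) J by (intro mult_left_mono N mult_nonneg_nonneg) auto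
      finally show ?thesis by simp
    qed
    have "cmod (dilated_pairing f x0 (1 / s) ?P - \<gamma> * (LINT z|lebesgue. ?P z)) \<le>
        cmod (dilated_pairing f x0 (1 / s) ?P) + cmod \<gamma> * cmod (LINT z|lebesgue. ?P z)"
      by (rule order_trans[OF norm_triangle_ineq4]) (simp add: norm_mult)
    also have "\<dots> \<le> C * (2 / \<delta>) ^ ?p / s + cmod \<gamma> * (2 ^ r * (1 + T) * B2 * ?J * (2 / \<delta>) / s)"
      by (intro add_mono 2 mult_left_mono 3) auto
    also have "\<dots> = D / s" by (simp add: D_def add_divide_distrib)
    finally show ?thesis using split 1 by (simp only:) (rule norm_triangle_mono)
  qed
  have "((\<lambda>s. D / s) \<longlongrightarrow> 0) at_top"
    by (rule tendsto_divide_0[OF tendsto_const filterlim_at_top_imp_at_infinity[OF filterlim_ident]])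
  then have "\<forall>\<^sub>F s in at_top. D / s < \<epsilon> / 2"
    by (rule order_tendstoD) (use \<epsilon> in simp)
  then show "\<forall>\<^sub>F s in at_top. dist (dilated_pairing f x0 (1 / s) (\<kappa> s)) \<gamma> < \<epsilon>"
    using eventually_gt_at_top[of "1 / \<delta>"] eventually_ge_at_top[of 1]
  proof eventually_elim
    case (elim s)
    then show ?case using main[of s] unfolding dist_norm by linarith
  qed
qed

end

section \<open>Square-integrable functions and periodisation\<close>

lemma norm_add_square_le: "(cmod (a + b))\<^sup>2 \<le> 2 * (cmod a)\<^sup>2 + 2 * (cmod b)\<^sup>2"
proof -
  have "(cmod (a + b))\<^sup>2 \<le> (cmod a + cmod b)\<^sup>2"
    by (intro power_mono norm_triangle_ineq) auto
  also have "\<dots> \<le> 2 * (cmod a)\<^sup>2 + 2 * (cmod b)\<^sup>2"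
    using sum_squares_bound[of "cmod a" "cmod b"] by (simp add: power2_sum)
  finally show ?thesis .
qed

lemma L2D:
  assumes "f \<in> L2"
  shows "f \<in> borel_measurable lebesgue" "integrable lebesgue (\<lambda>x. (cmod (f x))\<^sup>2)"
  using assms unfolding L2_def by auto

lemma L2_add:
  assumes "f \<in> L2" "g \<in> L2"
  shows "(\<lambda>x. f x + g x) \<in> L2"
proof -
  note [measurable] = L2D(1)[OF assms(1)] L2D(1)[OF assms(2)]
  have "integrable lebesgue (\<lambda>x. (cmod (f x + g x))\<^sup>2)"
  proof (rule Bochner_Integration.integrable_bound)
    show "integrable lebesgue (\<lambda>x. 2 * (cmod (f x))\<^sup>2 + 2 * (cmod (g x))\<^sup>2)"
      using L2D(2)[OF assms(1)] L2D(2)[OF assms(2)] by auto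
    show "AE x in lebesgue. norm ((cmod (f x + g x))\<^sup>2) \<le> norm (2 * (cmod (f x))\<^sup>2 + 2 * (cmod (g x))\<^sup>2)"
      using norm_add_square_le by (intro AE_I2) simp
  qed measurable
  then show ?thesis unfolding L2_def by simp
qed

lemma L2_cmult:
  assumes "f \<in> L2" shows "(\<lambda>x. c * f x) \<in> L2"
  using L2D[OF assms] unfolding L2_def by (auto simp: norm_mult power_mult_distrib)

lemma L2_diff:
  assumes "f \<in> L2" "g \<in> L2" shows "(\<lambda>x. f x - g x) \<in> L2"
  using L2_add[OF assms(1) L2_cmult[OF assms(2), of "-1"]] by simp

lemma L2_sum:
  assumes "finite F" "\<And>i. i \<in> F \<Longrightarrow> f i \<in> L2"
  shows "(\<lambda>x. \<Sum>i\<in>F. f i x) \<in> L2"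
  using assms
proof (induction F)
  case empty
  then show ?case unfolding L2_def by simp
next
  case (insert i F)
  then show ?case using L2_add[of "f i" "\<lambda>x. \<Sum>i\<in>F. f i x"] by simp
qed

lemma L2_integrable_mult:
  assumes "f \<in> L2" "g \<in> L2"
  shows "integrable lebesgue (\<lambda>x. f x * cnj (g x))"
proof (rule Bochner_Integration.integrable_bound)
  note [measurable] = L2D(1)[OF assms(1)] L2D(1)[OF assms(2)]
  show "integrable lebesgue (\<lambda>x. (cmod (f x))\<^sup>2 + (cmod (g x))\<^sup>2)"
    using L2D(2)[OF assms(1)] L2D(2)[OF assms(2)] by auto
  have [measurable]: "(\<lambda>x. cnj (g x)) \<in> borel_measurable lebesgue"
    by (intro borel_measurable_continuous_on[of cnj] continuous_intros L2D(1)[OF assms(2)])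
  show "(\<lambda>x. f x * cnj (g x)) \<in> borel_measurable lebesgue" by measurable
  have "cmod (f x) * cmod (g x) \<le> (cmod (f x))\<^sup>2 + (cmod (g x))\<^sup>2" for x
    using sum_squares_bound[of "cmod (f x)" "cmod (g x)"] unfolding mult.assoc
    by (smt (verit) mult_nonneg_nonneg norm_ge_zero)
  then show "AE x in lebesgue. norm (f x * cnj (g x)) \<le> norm ((cmod (f x))\<^sup>2 + (cmod (g x))\<^sup>2)"
    by (intro AE_I2) (simp add: norm_mult)
qed

text \<open>Pythagoras: the residual h is orthogonal to each e i with i in F, hence to the
  combination d by which the coefficients differ, and the cross term drops out.\<close>

lemma orthogonal_projection_minimal:
  fixes e :: "'i \<Rightarrow> real^'n::finite \<Rightarrow> complex"
  assumes F: "finite F" and e: "\<And>i. e i \<in> L2"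
    and ortho: "\<And>i j. L2_inner (e i) (e j) = (if i = j then 1 else 0)"
    and G: "G \<in> L2"
  shows "(LINT x|lebesgue. (cmod (G x - (\<Sum>i\<in>F. L2_inner G (e i) * e i x)))\<^sup>2)
    \<le> (LINT x|lebesgue. (cmod (G x - (\<Sum>i\<in>F. c i * e i x)))\<^sup>2)"
proof -
  let ?b = "\<lambda>i. L2_inner G (e i)"
  define h where "h x = G x - (\<Sum>i\<in>F. ?b i * e i x)" for x
  define d where "d x = (\<Sum>i\<in>F. (?b i - c i) * e i x)" for x
  have hL: "h \<in> L2" unfolding h_def by (intro L2_diff G L2_sum F L2_cmult e)
  have dL: "d \<in> L2" unfolding d_def by (intro L2_sum F L2_cmult e)
  have he: "(LINT x|lebesgue. h x * cnj (e j x)) = 0" if "j \<in> F" for j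
  proof -
    have "(LINT x|lebesgue. h x * cnj (e j x)) =
        (LINT x|lebesgue. G x * cnj (e j x) - (\<Sum>i\<in>F. ?b i * (e i x * cnj (e j x))))"
      unfolding h_def by (simp add: algebra_simps sum_distrib_left)
    also have "\<dots> = ?b j - (\<Sum>i\<in>F. ?b i * L2_inner (e i) (e j))"
      unfolding L2_inner_def
      by (subst Bochner_Integration.integral_diff)
        (auto intro!: L2_integrable_mult G e Bochner_Integration.integrable_sum integrable_mult_right
          simp: Bochner_Integration.integral_sum L2_integrable_mult e)
    also have "\<dots> = 0" using that F
      by (simp add: ortho if_distrib[where f="\<lambda>z. L2_inner G _ * z"] cong: if_cong)
    finally show ?thesis .
  qed
  have "(LINT x|lebesgue. h x * cnj (d x)) = (LINT x|lebesgue. (\<Sum>i\<in>F. cnj (?b i - c i) * (h x * cnj (e i x))))"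
    unfolding d_def by (simp add: sum_distrib_left ac_simps)
  also have "\<dots> = 0"
    by (simp add: Bochner_Integration.integral_sum L2_integrable_mult hL e he)
  finally have hd: "(LINT x|lebesgue. h x * cnj (d x)) = 0" .
  have "(LINT x|lebesgue. (cmod (G x - (\<Sum>i\<in>F. c i * e i x)))\<^sup>2) =
      (LINT x|lebesgue. (cmod (h x))\<^sup>2 + (cmod (d x))\<^sup>2 + 2 * Re (h x * cnj (d x)))"
  proof (intro Bochner_Integration.integral_cong refl)
    fix x
    have "G x - (\<Sum>i\<in>F. c i * e i x) = h x + d x"
      unfolding h_def d_def by (simp add: algebra_simps sum_subtractf)
    moreover have "(cmod (a + b))\<^sup>2 = (cmod a)\<^sup>2 + (cmod b)\<^sup>2 + 2 * Re (a * cnj b)" for a b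
      unfolding cmod_power2 by (simp add: power2_eq_square algebra_simps)
    ultimately show "(cmod (G x - (\<Sum>i\<in>F. c i * e i x)))\<^sup>2 = (cmod (h x))\<^sup>2 + (cmod (d x))\<^sup>2 + 2 * Re (h x * cnj (d x))"
      by simp
  qed
  also have "\<dots> = (LINT x|lebesgue. (cmod (h x))\<^sup>2) + (LINT x|lebesgue. (cmod (d x))\<^sup>2) +
      2 * Re (LINT x|lebesgue. h x * cnj (d x))"
    using L2D(2)[OF hL] L2D(2)[OF dL] L2_integrable_mult[OF hL dL]
    by (subst Bochner_Integration.integral_add) (auto intro!: integrable_Re simp del: times_complex.sel)
  also have "\<dots> \<ge> (LINT x|lebesgue. (cmod (h x))\<^sup>2)"
    unfolding hd by simp
  finally show ?thesis unfolding h_def .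
qed

lemma floor_cube_measurable [measurable]:
  "{x::real^'n::finite. \<forall>i. \<lfloor>x $ i\<rfloor> = m $ i} \<in> sets borel"
proof -
  have "{x::real^'n. \<forall>i. \<lfloor>x $ i\<rfloor> = m $ i} = (\<Inter>i. {x. of_int (m $ i) \<le> x $ i} \<inter> {x. x $ i < of_int (m $ i) + 1})"
    by (auto simp: floor_eq_iff)
  also have "\<dots> \<in> sets borel"
    by (intro sets.finite_INT sets.Int borel_closed borel_open closed_Collect_le open_Collect_less continuous_intros) auto
  finally show ?thesis .
qed

lemma nn_integral_lborel_shift:
  fixes f :: "'a::euclidean_space \<Rightarrow> ennreal"
  assumes "f \<in> borel_measurable borel"
  shows "(\<integral>\<^sup>+ x. f (t + x) \<partial>lborel) = (\<integral>\<^sup>+ x. f x \<partial>lborel)"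
proof -
  have "(\<integral>\<^sup>+ x. f x \<partial>lborel) = (\<integral>\<^sup>+ x. f x \<partial>(distr lborel borel ((+) t)))"
    by (simp add: lborel_distr_plus)
  also have "\<dots> = (\<integral>\<^sup>+ x. f (t + x) \<partial>lborel)"
    using assms by (intro nn_integral_distr) auto
  finally show ?thesis by simp
qed

text \<open>The half-open cube of side N is the disjoint union of N^n lattice translates of the unit
  cell, told apart by coordinatewise floors; periodicity makes their integrals equal.\<close>

lemma nn_integral_periodic:
  fixes g :: "real^'n::finite \<Rightarrow> ennreal"
  assumes g [measurable]: "g \<in> borel_measurable borel"
    and per: "\<And>x m. g (lattice_point m + x) = g x"
  defines "Q \<equiv> {x::real^'n. \<forall>i. \<lfloor>x $ i\<rfloor> = 0}"
  shows "(\<integral>\<^sup>+ x. g x * indicator {x. \<forall>i. 0 \<le> x $ i \<and> x $ i < real N} x \<partial>lborel) =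
    of_nat (N ^ CARD('n)) * (\<integral>\<^sup>+ x. g x * indicator Q x \<partial>lborel)"
proof -
  define M where "M = (vec_lambda :: _ \<Rightarrow> int^'n) ` (PiE UNIV (\<lambda>_. {0..<int N}))"
  let ?C = "\<lambda>m::int^'n. {x::real^'n. \<forall>i. \<lfloor>x $ i\<rfloor> = m $ i}"
  have fin: "finite M" unfolding M_def by (intro finite_imageI finite_PiE) auto
  have "card M = card (PiE (UNIV::'n set) (\<lambda>_. {0..<int N}))"
    unfolding M_def by (intro card_image) (auto simp: inj_on_def vec_lambda_inject)
  also have "\<dots> = N ^ CARD('n)" by (simp add: card_PiE)
  finally have card: "card M = N ^ CARD('n)" .
  have M: "m \<in> M \<longleftrightarrow> (\<forall>i. 0 \<le> m $ i \<and> m $ i < int N)" for m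
  proof
    assume "\<forall>i. 0 \<le> m $ i \<and> m $ i < int N"
    then show "m \<in> M" unfolding M_def by (intro image_eqI[of _ _ "vec_nth m"]) auto
  qed (auto simp: M_def PiE_iff)
  have ind: "indicator {x. \<forall>i. 0 \<le> x $ i \<and> x $ i < real N} x = (\<Sum>m\<in>M. indicator (?C m) x :: ennreal)" for x :: "real^'n"
  proof -
    let ?m = "\<chi> i. \<lfloor>x $ i\<rfloor>"
    have "(\<Sum>m\<in>M. indicator (?C m) x :: ennreal) = (\<Sum>m\<in>M. if m = ?m then 1 else 0)"
      by (intro sum.cong refl) (simp add: indicator_def vec_eq_iff, metis)
    also have "\<dots> = (if ?m \<in> M then 1 else 0)" using fin by simp
    also have "\<dots> = indicator {x. \<forall>i. 0 \<le> x $ i \<and> x $ i < real N} x"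
      by (auto simp: M indicator_def floor_less_iff)
    finally show ?thesis by simp
  qed
  have "(\<integral>\<^sup>+ x. g x * indicator {x. \<forall>i. 0 \<le> x $ i \<and> x $ i < real N} x \<partial>lborel) =
      (\<integral>\<^sup>+ x. (\<Sum>m\<in>M. g x * indicator (?C m) x) \<partial>lborel)"
    by (simp add: ind sum_distrib_left)
  also have "\<dots> = (\<Sum>m\<in>M. \<integral>\<^sup>+ x. g x * indicator (?C m) x \<partial>lborel)"
    by (rule nn_integral_sum) simp
  also have "\<dots> = (\<Sum>m\<in>M. \<integral>\<^sup>+ x. g x * indicator Q x \<partial>lborel)"
  proof (rule sum.cong[OF refl])
    fix m assume "m \<in> M"
    have "(\<integral>\<^sup>+ x. g x * indicator (?C m) x \<partial>lborel) =
        (\<integral>\<^sup>+ x. g (lattice_point m + x) * indicator (?C m) (lattice_point m + x) \<partial>lborel)"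
      by (rule nn_integral_lborel_shift[symmetric]) simp
    also have "\<dots> = (\<integral>\<^sup>+ x. g x * indicator Q x \<partial>lborel)"
    proof (intro nn_integral_cong)
      fix x :: "real^'n"
      have "\<lfloor>(lattice_point m + x) $ i\<rfloor> = m $ i + \<lfloor>x $ i\<rfloor>" for i
        by (simp add: lattice_point_def)
      then show "g (lattice_point m + x) * indicator (?C m) (lattice_point m + x) = g x * indicator Q x"
        by (simp add: per Q_def indicator_def)
    qed
    finally show "(\<integral>\<^sup>+ x. g x * indicator (?C m) x \<partial>lborel) = (\<integral>\<^sup>+ x. g x * indicator Q x \<partial>lborel)" .
  qed
  finally show ?thesis by (simp add: card)
qed

lemma MRA_dilate_iff:
  assumes "MRA V"
  shows "f \<in> V 0 \<longleftrightarrow> (\<lambda>x. f (2 ^ j *\<^sub>R x)) \<in> V (int j)"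
proof (induction j)
  case (Suc j)
  have "\<forall>j f. f \<in> V j \<longleftrightarrow> (\<lambda>x. f (2 *\<^sub>R x)) \<in> V (j + 1)"
    using assms unfolding MRA_def by (elim conjE)
  then have "(\<lambda>x. f (2 ^ j *\<^sub>R x)) \<in> V (int j) \<longleftrightarrow> (\<lambda>x. f (2 ^ j *\<^sub>R (2 *\<^sub>R x))) \<in> V (int j + 1)"
    by (elim allE)
  then show ?case using Suc by (simp add: ac_simps)
qed simp

text \<open>Relabelling k as m + k absorbs a lattice shift common to both arguments; the kernel is
  periodic only along the diagonal.\<close>

lemma q0_kernel_shift:
  "q0_kernel \<phi> (lattice_point m + x) (lattice_point m + y) = q0_kernel \<phi> x y"
proof -
  have "bij (\<lambda>k::int^'a. m + k)"
    by (rule bij_betw_byWitness[where f'="\<lambda>k. k - m"]) auto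
  from infsum_reindex_bij_betw[OF this, of "\<lambda>k. \<phi> (lattice_point m + x - lattice_point k) * cnj (\<phi> (lattice_point m + y - lattice_point k))"]
  have "q0_kernel \<phi> (lattice_point m + x) (lattice_point m + y) =
      (\<Sum>\<^sub>\<infinity>k. \<phi> (lattice_point m + x - lattice_point (m + k)) * cnj (\<phi> (lattice_point m + y - lattice_point (m + k))))"
    unfolding q0_kernel_def by simp
  moreover have "lattice_point m + z - lattice_point (m + k) = z - lattice_point k" for z k
    by (simp add: lattice_point_def vec_eq_iff)
  ultimately show ?thesis unfolding q0_kernel_def by simp
qed

text \<open>The polynomial counterpart of \<open>split_le\<close>: a factor 1 + |x - y| is shared
  between decay about x and decay about y.\<close>

lemma one_plus_le_mult:
  fixes a b c :: real
  assumes "0 \<le> a" "0 \<le> b" "c \<le> a + b"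
  shows "1 + c \<le> (1 + a) * (1 + b)"
proof -
  have "0 \<le> a * b" using assms by simp
  moreover have "(1 + a) * (1 + b) = 1 + a + b + a * b" by (simp add: algebra_simps)
  ultimately show ?thesis using assms(3) by linarith
qed

lemma open_AE_empty:
  fixes U :: "'a::euclidean_space set"
  assumes "open U" "AE x in lborel. x \<notin> U"
  shows "U = {}"
proof (rule ccontr)
  assume "U \<noteq> {}"
  have "U \<in> null_sets lborel"
    using assms by (subst AE_iff_null_sets) auto
  then have "negligible U"
    by (simp add: negligible_iff_null_sets null_sets_completionI)
  then show False using open_not_negligible[OF assms(1) \<open>U \<noteq> {}\<close>] by simp
qed

section \<open>Expansions in lattice translates of the scaling function\<close>

text \<open>The integral of the kernel involves no derivatives, so this part works with continuity
  and polynomial decay alone, independently of r and of the choice of weight.\<close>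

locale rapidly_decaying =
  fixes \<phi> :: "real^'n::finite \<Rightarrow> complex"
  assumes cont: "continuous_on UNIV \<phi>"
    and decay: "\<exists>B. \<forall>x. cmod (\<phi> x) \<le> B / (1 + norm x) ^ p"
begin

definition translate :: "int^'n \<Rightarrow> real^'n \<Rightarrow> complex" where
  "translate m x = \<phi> (x - lattice_point m)"

lemma continuous_translate: "continuous_on UNIV (translate m)"
  unfolding translate_def by (intro continuous_on_compose2[OF cont] continuous_intros) auto

lemma translate_measurable [measurable]:
  "translate m \<in> borel_measurable borel" "translate m \<in> borel_measurable lebesgue"
  "(\<lambda>x. cnj (translate m x)) \<in> borel_measurable lebesgue"
  using continuous_translate[of m]
  by (auto intro!: borel_measurable_continuous_onI continuous_borel_measurable_lebesgue continuous_intros)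

lemma integrable_shift_decay:
  "integrable lebesgue (\<lambda>y::real^'n. 1 / (1 + norm (y - a)) ^ (CARD('n) + 1))"
  "(LINT y|lebesgue. 1 / (1 + norm (y - a)) ^ (CARD('n) + 1)) = (LINT y|lebesgue. 1 / (1 + norm (y::real^'n)) ^ (CARD('n) + 1))"
proof -
  let ?f = "\<lambda>y::real^'n. 1 / (1 + norm (y - a)) ^ (CARD('n) + 1)"
  have m: "?f \<in> borel_measurable borel" by measurable
  then have ml: "?f \<in> borel_measurable lebesgue" by (intro measurable_completion) simp
  show eq: "integral\<^sup>L lebesgue ?f = (LINT y|lebesgue. 1 / (1 + norm (y::real^'n)) ^ (CARD('n) + 1))"
    using lebesgue_integral_affine[OF _ ml, of 1 a] by simp
  have "(\<integral>\<^sup>+ y. ennreal (?f (a + y)) \<partial>lborel) = (\<integral>\<^sup>+ y. ennreal (?f y) \<partial>lborel)"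
    using m by (intro nn_integral_lborel_shift) simp
  then have "(\<integral>\<^sup>+ y. ennreal (norm (?f y)) \<partial>lborel) = (\<integral>\<^sup>+ y. ennreal (norm (1 / (1 + norm (y::real^'n)) ^ (CARD('n) + 1))) \<partial>lborel)"
    by simp
  also have "\<dots> < \<infinity>"
    using integrable_inverse_power_norm[where 'n='n] unfolding integrable_iff_bounded by blast
  finally have "integrable lborel ?f"
    using m by (intro integrableI_bounded) auto
  then show "integrable lebesgue ?f" using m by (subst integrable_completion) auto
qed

text \<open>One power of decay from each factor is pooled into 1 / (1 + |x - y|); what is left is
  summable in m and integrable in y. Hence the exponents 2n + 1 and n + 2.\<close>

lemma translate_product_bound:
  obtains D where "0 \<le> D" "\<And>x y m. cmod (translate m x) * cmod (translate m y) \<le>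
    D / (1 + norm (x - y)) * (1 / (1 + norm (x - lattice_point m)) ^ (2 * CARD('n))) *
      (1 / (1 + norm (y - lattice_point m)) ^ (CARD('n) + 1))"
proof -
  obtain B where B: "\<And>x. cmod (\<phi> x) \<le> B / (1 + norm x) ^ (2 * CARD('n) + 1)" using decay by blast
  obtain B' where B': "\<And>x. cmod (\<phi> x) \<le> B' / (1 + norm x) ^ (CARD('n) + 2)" using decay by blast
  have B0: "0 \<le> B" "0 \<le> B'"
    using order_trans[OF norm_ge_zero B[of 0]] order_trans[OF norm_ge_zero B'[of 0]] by auto
  show ?thesis
  proof (rule that[of "B * B'"])
    show "0 \<le> B * B'" using B0 by simp
    fix x y :: "real^'n" and m
    let ?a = "1 + norm (x - lattice_point m)" and ?b = "1 + norm (y - lattice_point m)"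
    have a: "?a > 0" "?b > 0" by (auto simp: add_pos_nonneg)
    have "norm (x - y) \<le> norm (x - lattice_point m) + norm (y - lattice_point m)"
      using norm_triangle_ineq4[of "x - lattice_point m" "y - lattice_point m"] by simp
    then have ab: "1 + norm (x - y) \<le> ?a * ?b"
      by (intro one_plus_le_mult) auto
    have "cmod (translate m x) * cmod (translate m y) \<le> (B / ?a ^ (2 * CARD('n) + 1)) * (B' / ?b ^ (CARD('n) + 2))"
      unfolding translate_def using B0 by (intro mult_mono B B') auto
    also have "\<dots> = B * B' / (?a * ?b) * ((1 / ?a ^ (2 * CARD('n))) * (1 / ?b ^ (CARD('n) + 1)))"
      by simp
    also have "\<dots> \<le> B * B' / (1 + norm (x - y)) * ((1 / ?a ^ (2 * CARD('n))) * (1 / ?b ^ (CARD('n) + 1)))"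
      using B0 a by (intro mult_right_mono divide_left_mono ab mult_pos_pos) (auto simp: add_pos_nonneg)
    finally show "cmod (translate m x) * cmod (translate m y) \<le>
      B * B' / (1 + norm (x - y)) * (1 / ?a ^ (2 * CARD('n))) * (1 / ?b ^ (CARD('n) + 1))"
      by (simp only: mult.assoc)
  qed
qed

lemma translate_bound:
  obtains B where "0 \<le> B" "\<And>m x. cmod (translate m x) \<le> B * (1 / (1 + norm (x - lattice_point m)) ^ p)"
proof -
  obtain B where B: "\<And>x. cmod (\<phi> x) \<le> B / (1 + norm x) ^ p" using decay by blast
  then have "0 \<le> B" using order_trans[OF norm_ge_zero B[of 0]] by auto
  then show ?thesis using that B unfolding translate_def by auto
qed

lemma translate_integrable: "integrable lebesgue (translate m)"
proof -
  obtain B where B: "0 \<le> B" "\<And>m x. cmod (translate m x) \<le> B * (1 / (1 + norm (x - lattice_point m)) ^ (CARD('n) + 1))"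
    by (rule translate_bound) (rule that)
  show ?thesis
    by (rule Bochner_Integration.integrable_bound[OF integrable_mult_right[OF integrable_shift_decay(1)[of "lattice_point m"], of B]])
      (use B in simp_all)
qed

lemma bounded_mult_integrable:
  assumes "H \<in> borel_measurable lebesgue" "\<forall>y. cmod (H y) \<le> 1"
  shows "integrable lebesgue (\<lambda>y. H y * cnj (translate m y))"
proof (rule Bochner_Integration.integrable_bound[OF translate_integrable[of m]])
  show "(\<lambda>y. H y * cnj (translate m y)) \<in> borel_measurable lebesgue"
    using assms(1) by measurable
  show "AE y in lebesgue. norm (H y * cnj (translate m y)) \<le> norm (translate m y)"
    using assms(2) by (intro AE_I2) (simp add: norm_mult mult_left_le_one_le)
qed

text \<open>Only |x - y| \<ge> \<rho> matters, so the pooled factor is at most 1 / (1 + \<rho>). The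
  remaining integral over y is independent of m by translation, and the factor summable in m is
  kept.\<close>

lemma coefficient_bound:
  obtains C where "0 \<le> C"
    "\<And>H x \<rho> m. H \<in> borel_measurable lebesgue \<Longrightarrow> \<forall>y. cmod (H y) \<le> 1 \<Longrightarrow> 0 \<le> \<rho> \<Longrightarrow>
       \<forall>y. norm (x - y) < \<rho> \<longrightarrow> H y = 0 \<Longrightarrow>
       (LINT y|lebesgue. cmod (translate m x * (H y * cnj (translate m y)))) \<le>
         C / (1 + \<rho>) * (1 / (1 + norm (x - lattice_point m)) ^ (2 * CARD('n)))"
proof -
  obtain D where D: "0 \<le> D" "\<And>x y m. cmod (translate m x) * cmod (translate m y) \<le>
    D / (1 + norm (x - y)) * (1 / (1 + norm (x - lattice_point m)) ^ (2 * CARD('n))) *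
      (1 / (1 + norm (y - lattice_point m)) ^ (CARD('n) + 1))"
    by (rule translate_product_bound) (rule that)
  define J where "J = (LINT y|lebesgue. 1 / (1 + norm (y::real^'n)) ^ (CARD('n) + 1))"
  have J: "0 \<le> J" unfolding J_def by (intro Bochner_Integration.integral_nonneg) simp
  show ?thesis
  proof (rule that[of "D * J"])
    show "0 \<le> D * J" using D J by simp
    fix H and x :: "real^'n" and \<rho> :: real and m
    assume H: "H \<in> borel_measurable lebesgue" "\<forall>y. cmod (H y) \<le> 1" "0 \<le> \<rho>" "\<forall>y. norm (x - y) < \<rho> \<longrightarrow> H y = 0"
    let ?s = "1 / (1 + norm (x - lattice_point m)) ^ (2 * CARD('n))"
    let ?t = "\<lambda>y. 1 / (1 + norm (y - lattice_point m)) ^ (CARD('n) + 1)"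
    have "cmod (translate m x * (H y * cnj (translate m y))) \<le> D / (1 + \<rho>) * ?s * ?t y" for y
    proof (cases "norm (x - y) < \<rho>")
      case True
      then show ?thesis using H D by simp
    next
      case False
      have "cmod (translate m x * (H y * cnj (translate m y))) = cmod (H y) * (cmod (translate m x) * cmod (translate m y))"
        by (simp add: norm_mult)
      also have "\<dots> \<le> 1 * (cmod (translate m x) * cmod (translate m y))"
        using H(2) by (intro mult_right_mono) auto
      also have "\<dots> \<le> D / (1 + norm (x - y)) * ?s * ?t y" using D(2) by simp
      also have "\<dots> \<le> D / (1 + \<rho>) * ?s * ?t y"
        using False H(3) D(1) by (intro mult_right_mono divide_left_mono mult_pos_pos) auto
      finally show ?thesis .
    qed
    then have "(LINT y|lebesgue. cmod (translate m x * (H y * cnj (translate m y)))) \<le>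
        (LINT y|lebesgue. D / (1 + \<rho>) * ?s * ?t y)"
      by (intro Bochner_Integration.integral_mono integrable_norm integrable_mult_right
          bounded_mult_integrable[OF H(1,2)] integrable_shift_decay(1))
    also have "\<dots> = D / (1 + \<rho>) * ?s * J"
      unfolding J_def using integrable_shift_decay(2) by (subst integral_mult_right_zero) simp
    finally show "(LINT y|lebesgue. cmod (translate m x * (H y * cnj (translate m y)))) \<le> D * J / (1 + \<rho>) * ?s"
      by (simp add: mult_ac)
  qed
qed

text \<open>For orthonormal translates and H in \<open>L2\<close> this is the series of the
  orthogonal projection. It is taken pointwise so that it also makes sense for bounded H outside
  \<open>L2\<close>, above all for the constant 1.\<close>

definition expansion :: "(nat \<Rightarrow> int^'n) \<Rightarrow> (real^'n \<Rightarrow> complex) \<Rightarrow> real^'n \<Rightarrow> complex" where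
  "expansion e H x = (\<Sum>k. translate (e k) x * L2_inner H (translate (e k)))"

text \<open>The case \<rho> = 0 gives convergence for every H bounded by 1; large \<rho> says that
  values of H far from x have little effect at x.\<close>

lemma expansion_bound:
  assumes "inj e"
  obtains C where
    "\<And>H x \<rho>. H \<in> borel_measurable lebesgue \<Longrightarrow> \<forall>y. cmod (H y) \<le> 1 \<Longrightarrow> 0 \<le> \<rho> \<Longrightarrow>
       \<forall>y. norm (x - y) < \<rho> \<longrightarrow> H y = 0 \<Longrightarrow>
       summable (\<lambda>k. translate (e k) x * L2_inner H (translate (e k))) \<and>
       cmod (expansion e H x) \<le> C / (1 + \<rho>)"
proof -
  obtain C where C: "0 \<le> C"
    "\<And>H x \<rho> m. H \<in> borel_measurable lebesgue \<Longrightarrow> \<forall>y. cmod (H y) \<le> 1 \<Longrightarrow> 0 \<le> \<rho> \<Longrightarrow>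
       \<forall>y. norm (x - y) < \<rho> \<longrightarrow> H y = 0 \<Longrightarrow>
       (LINT y|lebesgue. cmod (translate m x * (H y * cnj (translate m y)))) \<le>
         C / (1 + \<rho>) * (1 / (1 + norm (x - lattice_point m)) ^ (2 * CARD('n)))"
    by (rule coefficient_bound) (rule that)
  obtain S where S: "\<And>x::real^'n. summable (\<lambda>k. 1 / (1 + norm (x - lattice_point (e k))) ^ (2 * CARD('n)))"
    "\<And>x::real^'n. (\<Sum>k. 1 / (1 + norm (x - lattice_point (e k))) ^ (2 * CARD('n))) \<le> S"
    by (rule lattice_series_bound[OF assms]) (rule that)
  show ?thesis
  proof (rule that[of "C * S"])
    fix H and x :: "real^'n" and \<rho> :: real
    assume H: "H \<in> borel_measurable lebesgue" "\<forall>y. cmod (H y) \<le> 1" "0 \<le> \<rho>" "\<forall>y. norm (x - y) < \<rho> \<longrightarrow> H y = 0"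
    let ?a = "\<lambda>k. translate (e k) x * L2_inner H (translate (e k))"
    let ?s = "\<lambda>k. 1 / (1 + norm (x - lattice_point (e k))) ^ (2 * CARD('n))"
    have a: "norm (?a k) \<le> C / (1 + \<rho>) * ?s k" for k
    proof -
      have "?a k = (LINT y|lebesgue. translate (e k) x * (H y * cnj (translate (e k) y)))"
        unfolding L2_inner_def by simp
      also have "norm \<dots> \<le> (LINT y|lebesgue. cmod (translate (e k) x * (H y * cnj (translate (e k) y))))"
        by (rule integral_norm_bound)
      also have "\<dots> \<le> C / (1 + \<rho>) * ?s k" by (rule C(2)[OF H])
      finally show ?thesis .
    qed
    have sm: "summable (\<lambda>k. C / (1 + \<rho>) * ?s k)" by (intro summable_mult S)
    have nsm: "summable (\<lambda>k. norm (?a k))"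
      by (rule summable_comparison_test'[OF sm, of 0]) (use a in simp)
    have "cmod (expansion e H x) \<le> (\<Sum>k. norm (?a k))"
      unfolding expansion_def by (rule summable_norm[OF nsm])
    also have "\<dots> \<le> (\<Sum>k. C / (1 + \<rho>) * ?s k)" by (rule suminf_le[OF a nsm sm])
    also have "\<dots> = C / (1 + \<rho>) * (\<Sum>k. ?s k)" by (rule suminf_mult[OF S(1)])
    also have "\<dots> \<le> C / (1 + \<rho>) * S" using C(1) H(3) by (intro mult_left_mono S) auto
    finally show "summable ?a \<and> cmod (expansion e H x) \<le> C * S / (1 + \<rho>)"
      using summable_norm_cancel[OF nsm] by simp
  qed
qed

text \<open>\<open>coefficient_bound\<close> with \<rho> = 0 makes the L^1 norms of the terms
  summable, which permits integrating the kernel series term by term.\<close>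

lemma expansion_const_eq:
  assumes e: "bij e"
  shows "(LINT y|lebesgue. q0_kernel \<phi> x y) = expansion e (\<lambda>_. 1) x"
proof -
  obtain C where C: "0 \<le> C"
    "\<And>H x \<rho> m. H \<in> borel_measurable lebesgue \<Longrightarrow> \<forall>y. cmod (H y) \<le> 1 \<Longrightarrow> 0 \<le> \<rho> \<Longrightarrow>
       \<forall>y. norm (x - y) < \<rho> \<longrightarrow> H y = 0 \<Longrightarrow>
       (LINT y|lebesgue. cmod (translate m x * (H y * cnj (translate m y)))) \<le>
         C / (1 + \<rho>) * (1 / (1 + norm (x - lattice_point m)) ^ (2 * CARD('n)))"
    by (rule coefficient_bound) (rule that)
  obtain S where S: "\<And>x::real^'n. summable (\<lambda>k. 1 / (1 + norm (x - lattice_point (e k))) ^ (2 * CARD('n)))"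
    by (rule lattice_series_bound[OF bij_is_inj[OF e]]) (rule that)
  obtain B where B: "\<And>x. cmod (\<phi> x) \<le> B / (1 + norm x) ^ (2 * CARD('n))" using decay by blast
  obtain B1 where B1: "0 \<le> B1" "\<And>m x. cmod (translate m x) \<le> B1 * (1 / (1 + norm (x - lattice_point m)) ^ (2 * CARD('n)))"
    by (rule translate_bound) (rule that)
  let ?f = "\<lambda>k y. translate (e k) x * (1 * cnj (translate (e k) y))"
  have "(LINT y|lebesgue. q0_kernel \<phi> x y) = (LINT y|lebesgue. (\<Sum>k. ?f k y))"
    using q0_kernel_eq_suminf[OF e B] by (simp add: translate_def)
  also have "\<dots> = (\<Sum>k. LINT y|lebesgue. ?f k y)"
  proof (rule integral_suminf)
    show "integrable lebesgue (?f k)" for k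
      by (intro integrable_mult_right bounded_mult_integrable) auto
    show "AE y in lebesgue. summable (\<lambda>k. norm (?f k y))"
    proof (rule AE_I2)
      fix y
      have "summable (\<lambda>k. B1 * B1 * (1 / (1 + norm (x - lattice_point (e k))) ^ (2 * CARD('n))))"
        by (intro summable_mult S)
      then show "summable (\<lambda>k. norm (?f k y))"
      proof (rule summable_comparison_test'[where N=0])
        fix k
        have "(1::real) / (1 + norm (y - lattice_point (e k))) ^ (2 * CARD('n)) \<le> 1"
          by (simp add: divide_le_eq_1 one_le_power)
        then have "cmod (translate (e k) y) \<le> B1 * 1"
          using B1 by (meson mult_left_mono order_trans)
        then have "cmod (translate (e k) x) * cmod (translate (e k) y) \<le>
            B1 * (1 / (1 + norm (x - lattice_point (e k))) ^ (2 * CARD('n))) * (B1 * 1)"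
          using B1 by (intro mult_mono) auto
        then show "norm (norm (?f k y)) \<le> B1 * B1 * (1 / (1 + norm (x - lattice_point (e k))) ^ (2 * CARD('n)))"
          by (simp add: norm_mult)
      qed
    qed
    have "summable (\<lambda>k. C / (1 + 0) * (1 / (1 + norm (x - lattice_point (e k))) ^ (2 * CARD('n))))"
      by (intro summable_mult S)
    then show "summable (\<lambda>k. LINT y|lebesgue. norm (?f k y))"
    proof (rule summable_comparison_test'[where N=0])
      fix k
      have "(LINT y|lebesgue. norm (?f k y)) \<le> C / (1 + 0) * (1 / (1 + norm (x - lattice_point (e k))) ^ (2 * CARD('n)))"
        by (rule C(2)[where H="\<lambda>_. 1" and \<rho>=0]) auto
      moreover have "0 \<le> (LINT y|lebesgue. norm (?f k y))"
        by (intro Bochner_Integration.integral_nonneg) auto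
      ultimately show "norm (LINT y|lebesgue. norm (?f k y)) \<le> C / (1 + 0) * (1 / (1 + norm (x - lattice_point (e k))) ^ (2 * CARD('n)))"
        by simp
    qed
  qed
  also have "\<dots> = expansion e (\<lambda>_. 1) x"
    unfolding expansion_def L2_inner_def by simp
  finally show ?thesis .
qed

text \<open>On the ball of radius R, 1 + |m| is at most (1 + R)(1 + |x - m|), so decay about x may
  be replaced by decay about 0. This gives a majorant free of x, hence locally uniform
  convergence.\<close>

lemma expansion_const_continuous:
  assumes e: "inj e"
  shows "continuous_on UNIV (expansion e (\<lambda>_. 1))"
proof -
  obtain B where B: "0 \<le> B" "\<And>m x. cmod (translate m x) \<le> B * (1 / (1 + norm (x - lattice_point m)) ^ (2 * CARD('n)))"
    by (rule translate_bound) (rule that)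
  obtain S where S: "\<And>x::real^'n. summable (\<lambda>k. 1 / (1 + norm (x - lattice_point (e k))) ^ (2 * CARD('n)))"
    by (rule lattice_series_bound[OF e]) (rule that)
  \<comment> \<open>By translation invariance all coefficients of the constant 1 coincide.\<close>
  define c where "c = (LINT y|lebesgue. cnj (\<phi> y))"
  have c: "L2_inner (\<lambda>_. 1) (translate m) = c" for m
    using lebesgue_integral_affine[OF _ translate_measurable(3), of 1 m "lattice_point m"]
    by (simp add: L2_inner_def translate_def c_def)
  have "continuous_on (ball 0 R) (expansion e (\<lambda>_. 1))" for R
  proof -
    let ?M = "\<lambda>k. B * cmod c * (1 + R) ^ (2 * CARD('n)) * (1 / (1 + norm (0 - lattice_point (e k) :: real^'n)) ^ (2 * CARD('n)))"
    have "uniform_limit (ball 0 R) (\<lambda>n x. \<Sum>k<n. translate (e k) x * L2_inner (\<lambda>_. 1) (translate (e k)))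
        (expansion e (\<lambda>_. 1)) sequentially"
      unfolding expansion_def
    proof (rule Weierstrass_m_test)
      show "summable ?M" by (intro summable_mult S)
      fix k and x :: "real^'n" assume x: "x \<in> ball 0 R"
      let ?m = "lattice_point (e k) :: real^'n"
      have "norm ?m \<le> norm x + norm (x - ?m)" using norm_triangle_ineq4[of x "x - ?m"] by simp
      then have "1 + norm ?m \<le> (1 + norm x) * (1 + norm (x - ?m))"
        by (intro one_plus_le_mult) auto
      also have "\<dots> \<le> (1 + R) * (1 + norm (x - ?m))" using x by (intro mult_right_mono) auto
      finally have "(1 + norm ?m) ^ (2 * CARD('n)) \<le> (1 + R) ^ (2 * CARD('n)) * (1 + norm (x - ?m)) ^ (2 * CARD('n))"
        using power_mono[of "1 + norm ?m" "(1 + R) * (1 + norm (x - ?m))" "2 * CARD('n)"] by (simp add: power_mult_distrib)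
      moreover have "0 < (1 + norm ?m) ^ (2 * CARD('n))" "0 < (1 + norm (x - ?m)) ^ (2 * CARD('n))"
        by (auto intro!: zero_less_power simp: add_pos_nonneg)
      ultimately have "1 / (1 + norm (x - ?m)) ^ (2 * CARD('n)) \<le> (1 + R) ^ (2 * CARD('n)) * (1 / (1 + norm ?m) ^ (2 * CARD('n)))"
        by (simp add: divide_le_eq pos_le_divide_eq field_simps)
      then have "B * (1 / (1 + norm (x - ?m)) ^ (2 * CARD('n))) \<le> B * ((1 + R) ^ (2 * CARD('n)) * (1 / (1 + norm ?m) ^ (2 * CARD('n))))"
        using B(1) by (intro mult_left_mono)
      then have "cmod (translate (e k) x) \<le> B * ((1 + R) ^ (2 * CARD('n)) * (1 / (1 + norm ?m) ^ (2 * CARD('n))))"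
        using B(2) order_trans by blast
      from mult_right_mono[OF this, of "cmod c"]
      show "norm (translate (e k) x * L2_inner (\<lambda>_. 1) (translate (e k))) \<le> ?M k"
        unfolding c by (simp add: norm_mult mult_ac)
    qed
    then show ?thesis
      by (rule uniform_limit_theorem[rotated])
        (auto intro!: always_eventually continuous_intros continuous_on_subset[OF continuous_translate])
  qed
  then have "isCont (expansion e (\<lambda>_. 1)) x" for x
    using continuous_on_eq_continuous_at[OF open_ball, of 0 "norm x + 1"] by force
  then show ?thesis by (simp add: continuous_on_eq_continuous_at)
qed

text \<open>Long enough partial sums approximate G at least as well as s, by minimality of the
  orthogonal coefficients. They converge pointwise to the expansion, and Fatou's lemma carries the
  bound over, so no L^2 limit has to be identified with it.\<close>

lemma expansion_projection_bound:
  assumes e: "bij e"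
    and L2: "\<And>m. translate m \<in> L2"
    and ortho: "\<And>i j. L2_inner (translate i) (translate j) = (if i = j then 1 else 0)"
    and G: "G \<in> L2" "\<And>y. cmod (G y) \<le> 1" and s: "s \<in> family_span translate"
  shows "(\<integral>\<^sup>+ x. ennreal ((cmod (G x - expansion e G x))\<^sup>2) \<partial>lborel) \<le>
    ennreal (LINT x|lebesgue. (cmod (G x - s x))\<^sup>2)"
proof -
  have inj: "inj e" using e by (rule bij_is_inj)
  obtain c F where F: "finite F" and s: "s = (\<lambda>x. \<Sum>i\<in>F. c i * translate i x)"
    using s unfolding family_span_def by auto
  have "finite (e -` F)" using F inj by (rule finite_vimageI)
  then obtain N0 where N0: "\<And>k. e k \<in> F \<Longrightarrow> k < N0"
    using finite_nat_set_iff_bounded[of "e -` F"] by auto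
  \<comment> \<open>The offset \<open>N0\<close> puts every translate that occurs in s into each
    partial sum, so s becomes a competitor with some coefficients equal to 0.\<close>
  define P where "P n x = (\<Sum>k<n + N0. L2_inner G (translate (e k)) * translate (e k) x)" for n x
  have s': "s x = (\<Sum>k<n + N0. (if e k \<in> F then c (e k) else 0) * translate (e k) x)" for x n
  proof -
    have "F \<subseteq> e ` {..<n + N0}"
    proof
      fix i assume "i \<in> F"
      moreover obtain k where "i = e k" using e by (metis bij_is_surj surjE)
      ultimately show "i \<in> e ` {..<n + N0}" using N0[of k] by auto
    qed
    then have "s x = (\<Sum>i\<in>e ` {..<n + N0}. (if i \<in> F then c i else 0) * translate i x)"
      unfolding s by (intro sum.mono_neutral_cong_left) auto
    also have "\<dots> = (\<Sum>k<n + N0. (if e k \<in> F then c (e k) else 0) * translate (e k) x)"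
      by (subst sum.reindex) (auto intro: inj_on_subset[OF inj])
    finally show ?thesis .
  qed
  have PL: "P n \<in> L2" for n unfolding P_def by (intro L2_sum L2_cmult L2) auto
  have bound: "(\<integral>\<^sup>+ x. ennreal ((cmod (G x - P n x))\<^sup>2) \<partial>lebesgue) \<le>
      ennreal (LINT x|lebesgue. (cmod (G x - s x))\<^sup>2)" for n
  proof -
    have "(LINT x|lebesgue. (cmod (G x - P n x))\<^sup>2) \<le> (LINT x|lebesgue. (cmod (G x - s x))\<^sup>2)"
      unfolding P_def s'[of _ n]
      by (rule orthogonal_projection_minimal) (use L2 ortho G inj in \<open>auto simp: inj_eq\<close>)
    moreover have "(\<integral>\<^sup>+ x. ennreal ((cmod (G x - P n x))\<^sup>2) \<partial>lebesgue) = ennreal (LINT x|lebesgue. (cmod (G x - P n x))\<^sup>2)"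
      using L2D(2)[OF L2_diff[OF G(1) PL]] by (intro nn_integral_eq_integral) auto
    ultimately show ?thesis by (simp add: ennreal_leI)
  qed
  obtain C where C: "\<And>H x \<rho>. H \<in> borel_measurable lebesgue \<Longrightarrow> \<forall>y. cmod (H y) \<le> 1 \<Longrightarrow> 0 \<le> \<rho> \<Longrightarrow>
       \<forall>y. norm (x - y) < \<rho> \<longrightarrow> H y = 0 \<Longrightarrow>
       summable (\<lambda>k. translate (e k) x * L2_inner H (translate (e k))) \<and>
       cmod (expansion e H x) \<le> C / (1 + \<rho>)"
    by (rule expansion_bound[OF inj]) (rule that)
  have lim: "(\<lambda>n. ennreal ((cmod (G x - P n x))\<^sup>2)) \<longlonglongrightarrow> ennreal ((cmod (G x - expansion e G x))\<^sup>2)" for x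
  proof -
    have "summable (\<lambda>k. translate (e k) x * L2_inner G (translate (e k)))"
      using C[OF L2D(1)[OF G(1)] allI[OF G(2)], of 0 x] by simp
    then have "(\<lambda>n. \<Sum>k<n. translate (e k) x * L2_inner G (translate (e k))) \<longlonglongrightarrow> expansion e G x"
      unfolding expansion_def by (rule summable_LIMSEQ)
    then have "(\<lambda>n. P n x) \<longlonglongrightarrow> expansion e G x"
      unfolding P_def using LIMSEQ_ignore_initial_segment[of _ _ N0] by (simp add: mult.commute)
    then show ?thesis by (intro tendsto_ennrealI tendsto_intros)
  qed
  have "(\<integral>\<^sup>+ x. ennreal ((cmod (G x - expansion e G x))\<^sup>2) \<partial>lborel) =
      (\<integral>\<^sup>+ x. ennreal ((cmod (G x - expansion e G x))\<^sup>2) \<partial>lebesgue)"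
    by (rule nn_integral_completion[symmetric])
  also have "\<dots> = (\<integral>\<^sup>+ x. liminf (\<lambda>n. ennreal ((cmod (G x - P n x))\<^sup>2)) \<partial>lebesgue)"
    using lim_imp_Liminf[OF _ lim] by (intro nn_integral_cong) simp
  also have "\<dots> \<le> liminf (\<lambda>n. \<integral>\<^sup>+ x. ennreal ((cmod (G x - P n x))\<^sup>2) \<partial>lebesgue)"
    using L2D(2)[OF L2_diff[OF G(1) PL]] by (intro nn_integral_liminf) auto
  also have "\<dots> \<le> liminf (\<lambda>n. ennreal (LINT x|lebesgue. (cmod (G x - s x))\<^sup>2))"
    using bound by (intro Liminf_mono always_eventually) auto
  also have "\<dots> = ennreal (LINT x|lebesgue. (cmod (G x - s x))\<^sup>2)"
    by (rule Liminf_const) simp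
  finally show ?thesis .
qed

end

lemma sum_Basis_component: "(\<Sum>i\<in>Basis. (i :: real^'n::finite) $ k) = 1"
proof -
  have "(\<Sum>i\<in>Basis. (i :: real^'n) $ k) = (\<Sum>i\<in>Basis. (i :: real^'n) \<bullet> axis k 1)"
    by (simp add: inner_axis)
  also have "\<dots> = (\<Sum>i\<in>(Basis :: (real^'n) set). if i = axis k 1 then 1 else 0)"
    by (intro sum.cong refl) (auto simp: inner_Basis axis_in_Basis_iff)
  also have "\<dots> = 1" by (simp add: axis_in_Basis_iff)
  finally show ?thesis .
qed

lemma unit_cube_bounds:
  defines "Q \<equiv> {x::real^'n::finite. \<forall>i. \<lfloor>x $ i\<rfloor> = 0}"
  shows "box 0 One \<subseteq> Q" "emeasure lborel Q \<le> 1"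
proof -
  have b: "x \<bullet> axis k 1 = x $ k" for x :: "real^'n" and k by (simp add: inner_axis)
  have Ax: "axis k (1::real) \<in> (Basis :: (real^'n) set)" for k by (simp add: axis_in_Basis_iff)
  show "box 0 One \<subseteq> Q"
  proof
    fix x :: "real^'n" assume x: "x \<in> box 0 One"
    have "0 < x $ k \<and> x $ k < 1" for k
    proof -
      have "(0 :: real^'n) \<bullet> axis k 1 < x \<bullet> axis k 1 \<and> x \<bullet> axis k 1 < (One :: real^'n) \<bullet> axis k 1"
        using x Ax[of k] unfolding mem_box by blast
      then show ?thesis using Ax[of k] by (simp add: b sum_Basis_component)
    qed
    then show "x \<in> Q" unfolding Q_def by (simp add: floor_eq_iff less_imp_le)
  qed
  have "Q \<subseteq> cbox 0 One"
  proof
    fix x assume x: "x \<in> Q"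
    show "x \<in> cbox 0 One"
      unfolding mem_box
    proof
      fix i :: "real^'n" assume i: "i \<in> Basis"
      then obtain k where k: "i = axis k 1" by (auto simp: Basis_vec_def)
      have "0 \<le> x $ k \<and> x $ k \<le> 1"
        using x unfolding Q_def by (auto simp: floor_eq_iff intro: less_imp_le)
      then show "0 \<bullet> i \<le> x \<bullet> i \<and> x \<bullet> i \<le> One \<bullet> i"
        using i by (simp add: k b sum_Basis_component)
    qed
  qed
  then have "emeasure lborel Q \<le> emeasure lborel (cbox 0 (One::real^'n))"
    by (intro emeasure_mono) auto
  also have "\<dots> = 1" by (simp add: emeasure_lborel_cbox_eq inner_sum_left_Basis)
  finally show "emeasure lborel Q \<le> 1" .
qed

section \<open>The integral of the reproducing kernel\<close>

context rapidly_decaying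
begin

text \<open>Brings the difference within reach of \<open>expansion_bound\<close>: when G is the
  indicator of a ball, 1 - G vanishes near every point deep inside it.\<close>

lemma expansion_diff:
  assumes e: "inj e" and G: "G \<in> borel_measurable lebesgue" "\<forall>y. cmod (G y) \<le> 1"
  shows "expansion e (\<lambda>_. 1) x - expansion e G x = expansion e (\<lambda>y. 1 - G y) x"
proof -
  obtain C where C: "\<And>H x \<rho>. H \<in> borel_measurable lebesgue \<Longrightarrow> \<forall>y. cmod (H y) \<le> 1 \<Longrightarrow> 0 \<le> \<rho> \<Longrightarrow>
       \<forall>y. norm (x - y) < \<rho> \<longrightarrow> H y = 0 \<Longrightarrow>
       summable (\<lambda>k. translate (e k) x * L2_inner H (translate (e k))) \<and>
       cmod (expansion e H x) \<le> C / (1 + \<rho>)"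
    by (rule expansion_bound[OF e]) (rule that)
  have D: "L2_inner (\<lambda>y. 1 - G y) (translate m) = L2_inner (\<lambda>_. 1) (translate m) - L2_inner G (translate m)" for m
    unfolding L2_inner_def
    using bounded_mult_integrable[OF _ , of "\<lambda>_. 1" m] bounded_mult_integrable[OF G, of m]
    by (subst Bochner_Integration.integral_diff[symmetric]) (auto simp: algebra_simps)
  have "summable (\<lambda>k. translate (e k) x * L2_inner (\<lambda>_. 1) (translate (e k)))"
    "summable (\<lambda>k. translate (e k) x * L2_inner G (translate (e k)))"
    using C[of "\<lambda>_. 1" 0 x] C[OF G, of 0 x] by auto
  from suminf_diff[OF this] show ?thesis
    unfolding expansion_def D right_diff_distrib .
qed

text \<open>With N = 2^j the estimate reads N^n K \<le> N^n (8 \<epsilon>^2 + 2 C^2 / (1 + N)^2),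
  where K is the squared L^2 distance of h from 1 over one cell. After division by N^n, first j and
  then \<epsilon> is sent to its limit.\<close>

lemma q0_kernel_integral:
  assumes V: "MRA V" and scaling: "scaling_function V \<phi>"
  shows "(LINT y|lebesgue. q0_kernel \<phi> x y) = 1"
proof -
  let ?n = "CARD('n)"
  obtain e :: "nat \<Rightarrow> int^'n" where e: "bij e" using lattice_enumeration by blast
  then have inj: "inj e" by (rule bij_is_inj)
  define h where "h = expansion e (\<lambda>_. 1)"
  have h_eq: "h x = (LINT y|lebesgue. q0_kernel \<phi> x y)" for x
    unfolding h_def using expansion_const_eq[OF e] by simp
  have h_cont: "continuous_on UNIV h" unfolding h_def by (rule expansion_const_continuous[OF inj])
  then have h_meas [measurable]: "h \<in> borel_measurable borel" by (rule borel_measurable_continuous_onI)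
  have V0: "L2_closed_subspace (V j)" for j using V unfolding MRA_def by blast
  then have VL2: "V j \<subseteq> L2" for j unfolding L2_closed_subspace_def by blast
  have tr: "(\<lambda>m x. \<phi> (x - lattice_point m)) = translate" by (intro ext) (simp add: translate_def)
  have basis: "orthonormal_basis translate (V 0)"
    using scaling unfolding scaling_function_def tr by blast
  then have tL2: "translate m \<in> L2" for m using VL2 unfolding orthonormal_basis_def by blast
  have ortho: "L2_inner (translate i) (translate j) = (if i = j then 1 else 0)" for i j
    using basis unfolding orthonormal_basis_def by blast
  have span: "L2_closure (family_span translate) = V 0"
    using basis unfolding orthonormal_basis_def by blast
  have q0_meas: "q0_kernel \<phi> x \<in> borel_measurable lebesgue" for x
  proof -
    obtain B where "\<And>x. cmod (\<phi> x) \<le> B / (1 + norm x) ^ (2 * ?n)" using decay by blast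
    from q0_kernel_eq_suminf[OF e this]
    have "q0_kernel \<phi> x = (\<lambda>y. \<Sum>k. translate (e k) x * cnj (translate (e k) y))"
      by (intro ext) (simp add: translate_def)
    then show ?thesis by simp
  qed
  \<comment> \<open>Shifting y by m leaves the integral unchanged, so diagonal periodicity of the
    kernel becomes periodicity of h.\<close>
  have h_per: "h (lattice_point m + x) = h x" for m x
  proof -
    have "h (lattice_point m + x) = (LINT y|lebesgue. q0_kernel \<phi> (lattice_point m + x) (lattice_point m + 1 *\<^sub>R y))"
      unfolding h_eq using lebesgue_integral_affine[OF _ q0_meas, of 1 "lattice_point m + x" "lattice_point m"] by simp
    then show ?thesis by (simp add: q0_kernel_shift h_eq)
  qed
  define Q where "Q = {x::real^'n. \<forall>i. \<lfloor>x $ i\<rfloor> = 0}"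
  have Q_meas [measurable]: "Q \<in> sets borel"
    using floor_cube_measurable[of "0 :: int^'n"] unfolding Q_def by simp
  define K where "K = (\<integral>\<^sup>+ x. ennreal ((cmod (1 - h x))\<^sup>2) * indicator Q x \<partial>lborel)"
  \<comment> \<open>Points of the cube of side 2^j have norm at most n 2^j, so this radius leaves a
    margin of 2^j around each of them.\<close>
  define G where "G j x = (if norm x < (real ?n + 1) * 2 ^ j then 1 else 0 :: complex)" for j :: nat and x :: "real^'n"
  have G_meas [measurable]: "G j \<in> borel_measurable borel" for j
    unfolding G_def by measurable
  then have G_leb: "G j \<in> borel_measurable lebesgue" for j
    by (intro measurable_completion) simp
  have G1: "\<forall>y. cmod (G j y) \<le> 1" for j by (simp add: G_def)
  have GL2: "G j \<in> L2" for j
  proof -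
    have "integrable lebesgue (indicator (ball 0 ((real ?n + 1) * 2 ^ j)) :: real^'n \<Rightarrow> real)"
      by (subst integrable_completion) (auto intro!: integrable_real_indicator emeasure_bounded_finite borel_measurable_indicator)
    also have "indicator (ball 0 ((real ?n + 1) * 2 ^ j)) = (\<lambda>x. (cmod (G j x))\<^sup>2)"
      by (auto simp: G_def indicator_def)
    finally show ?thesis using G_leb unfolding L2_def by simp
  qed
  obtain C where C: "\<And>H x \<rho>. H \<in> borel_measurable lebesgue \<Longrightarrow> \<forall>y. cmod (H y) \<le> 1 \<Longrightarrow> 0 \<le> \<rho> \<Longrightarrow>
       \<forall>y. norm (x - y) < \<rho> \<longrightarrow> H y = 0 \<Longrightarrow>
       summable (\<lambda>k. translate (e k) x * L2_inner H (translate (e k))) \<and>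
       cmod (expansion e H x) \<le> C / (1 + \<rho>)"
    by (rule expansion_bound[OF inj]) (rule that)
  define A where "A j = {x::real^'n. \<forall>i. 0 \<le> x $ i \<and> x $ i < real (2 ^ j)}" for j
  have near: "cmod (h x - expansion e (G j) x) \<le> C / (1 + 2 ^ j)" if x: "x \<in> A j" for x j
  proof -
    have "norm x \<le> (\<Sum>i\<in>UNIV. \<bar>x $ i\<bar>)" by (rule norm_le_l1_cart)
    also have "\<dots> \<le> (\<Sum>i\<in>(UNIV::'n set). 2 ^ j)"
      using x unfolding A_def by (intro sum_mono) (auto intro: less_imp_le)
    finally have nx: "norm x \<le> real ?n * 2 ^ j" by simp
    have "1 - G j y = 0" if "norm (x - y) < 2 ^ j" for y
      using nx that norm_triangle_ineq4[of x "x - y"] by (simp add: G_def algebra_simps)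
    moreover have "\<forall>y. cmod (1 - G j y) \<le> 1" by (simp add: G_def)
    ultimately have "cmod (expansion e (\<lambda>y. 1 - G j y) x) \<le> C / (1 + 2 ^ j)"
      using C[of "\<lambda>y. 1 - G j y" "2 ^ j" x] G_leb by simp
    then show ?thesis unfolding h_def expansion_diff[OF inj G_leb G1] .
  qed
  have K_bound: "K \<le> ennreal (8 * \<epsilon>\<^sup>2)" if \<epsilon>: "0 < \<epsilon>" for \<epsilon>
  proof -
    \<comment> \<open>Density is used for \<open>G 0\<close> only. The other indicators are its
      dilates, so a single approximant u serves every j \<ge> j1.\<close>
    have "L2_closure (\<Union>j. V j) = L2" using V unfolding MRA_def by blast
    then have "G 0 \<in> L2_closure (\<Union>j. V j)" using GL2 by simp
    then obtain us where us: "\<And>k::nat. us k \<in> (\<Union>j. V j)" "(\<lambda>k. L2_norm_fun (\<lambda>x. us k x - G 0 x)) \<longlonglongrightarrow> 0"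
      unfolding L2_closure_def by blast
    from order_tendstoD(2)[OF us(2) \<epsilon>] obtain k where k: "L2_norm_fun (\<lambda>x. us k x - G 0 x) < \<epsilon>"
      by (auto simp: eventually_sequentially)
    define u where "u = us k"
    obtain j1 where j1: "u \<in> V j1" using us(1)[of k] u_def by blast
    then have uL2: "u \<in> L2" using VL2 by blast
    have u_close: "(LINT x|lebesgue. (cmod (u x - G 0 x))\<^sup>2) \<le> \<epsilon>\<^sup>2"
      using k sqrt_le_D[of _ \<epsilon>] unfolding L2_norm_fun_def u_def by simp
    have main: "K \<le> ennreal (8 * \<epsilon>\<^sup>2 + 2 * (C / (1 + 2 ^ j))\<^sup>2)" if j: "nat j1 \<le> j" for j
    proof -
      have "V j1 \<subseteq> V (int j)" using V j unfolding MRA_def by (intro monoD[of V]) auto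
      then have uj: "u \<in> V (int j)" using j1 by blast
      \<comment> \<open>This dilation carries u from \<open>V (int j)\<close> to \<open>V 0\<close>
        and \<open>G 0\<close> to \<open>G j\<close>, and multiplies squared distances by
        2^(jn).\<close>
      define v where "v x = u ((1 / 2 ^ j) *\<^sub>R x)" for x
      have "v \<in> V 0" unfolding MRA_dilate_iff[OF V, of v j] using uj by (simp add: v_def)
      then have vL2: "v \<in> L2" and "v \<in> L2_closure (family_span translate)" using VL2 span by auto
      then obtain ss where ss: "\<And>k::nat. ss k \<in> family_span translate" "(\<lambda>k. L2_norm_fun (\<lambda>x. ss k x - v x)) \<longlonglongrightarrow> 0"
        unfolding L2_closure_def by blast
      from order_tendstoD(2)[OF ss(2) \<epsilon>] obtain k' where k': "L2_norm_fun (\<lambda>x. ss k' x - v x) < \<epsilon>"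
        by (auto simp: eventually_sequentially)
      define s where "s = ss k'"
      have s: "s \<in> family_span translate" using ss(1) s_def by simp
      then have sL2: "s \<in> L2" unfolding family_span_def by (auto intro!: L2_sum L2_cmult tL2)
      have s_close: "(LINT x|lebesgue. (cmod (s x - v x))\<^sup>2) \<le> \<epsilon>\<^sup>2"
        using k' sqrt_le_D[of _ \<epsilon>] unfolding L2_norm_fun_def s_def by simp
      define N where "N = (2::real) ^ j"
      have N: "1 \<le> N ^ ?n" "0 < N" by (auto simp: N_def intro!: one_le_power)
      have v_close: "(LINT x|lebesgue. (cmod (v x - G j x))\<^sup>2) \<le> N ^ ?n * \<epsilon>\<^sup>2"
      proof -
        have "(\<lambda>x. (cmod (u x - G 0 x))\<^sup>2) \<in> borel_measurable lebesgue"
          using L2D(2)[OF L2_diff[OF uL2 GL2]] by blast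
        from lebesgue_integral_affine[OF _ this, of "1 / N" 0]
        have "(LINT x|lebesgue. (cmod (u x - G 0 x))\<^sup>2) =
            (1 / N) ^ ?n * (LINT x|lebesgue. (cmod (u ((1 / N) *\<^sub>R x) - G 0 ((1 / N) *\<^sub>R x)))\<^sup>2)"
          using N by simp
        moreover have "G 0 ((1 / N) *\<^sub>R x) = G j x" for x
          using N by (simp add: G_def N_def field_simps)
        ultimately have "(1 / N) ^ ?n * (LINT x|lebesgue. (cmod (v x - G j x))\<^sup>2) \<le> \<epsilon>\<^sup>2"
          using u_close by (simp add: v_def N_def)
        then show ?thesis using N by (simp add: power_one_over field_simps)
      qed
      have "(LINT x|lebesgue. (cmod (G j x - s x))\<^sup>2) \<le>
          (LINT x|lebesgue. 2 * (cmod (v x - G j x))\<^sup>2 + 2 * (cmod (s x - v x))\<^sup>2)"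
      proof (intro Bochner_Integration.integral_mono)
        show "integrable lebesgue (\<lambda>x. (cmod (G j x - s x))\<^sup>2)"
          by (intro L2D L2_diff GL2 sL2)
        show "integrable lebesgue (\<lambda>x. 2 * (cmod (v x - G j x))\<^sup>2 + 2 * (cmod (s x - v x))\<^sup>2)"
          using L2D(2)[OF L2_diff[OF vL2 GL2]] L2D(2)[OF L2_diff[OF sL2 vL2]] by simp
        show "(cmod (G j x - s x))\<^sup>2 \<le> 2 * (cmod (v x - G j x))\<^sup>2 + 2 * (cmod (s x - v x))\<^sup>2" for x
          using norm_add_square_le[of "v x - G j x" "s x - v x"] by (simp add: norm_minus_commute)
      qed
      also have "\<dots> = 2 * (LINT x|lebesgue. (cmod (v x - G j x))\<^sup>2) + 2 * (LINT x|lebesgue. (cmod (s x - v x))\<^sup>2)"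
        using L2D(2)[OF L2_diff[OF vL2 GL2]] L2D(2)[OF L2_diff[OF sL2 vL2]] by simp
      \<comment> \<open>The error of s against v is not scaled; it is enlarged by N^n \<ge> 1 to
        match the other one.\<close>
      also have "\<dots> \<le> 2 * (N ^ ?n * \<epsilon>\<^sup>2) + 2 * (N ^ ?n * \<epsilon>\<^sup>2)"
        using v_close s_close mult_right_mono[OF N(1), of "\<epsilon>\<^sup>2"] by (intro add_mono mult_left_mono) auto
      finally have Gs: "(LINT x|lebesgue. (cmod (G j x - s x))\<^sup>2) \<le> N ^ ?n * (4 * \<epsilon>\<^sup>2)" by simp
      have proj: "(\<integral>\<^sup>+ x. ennreal ((cmod (G j x - expansion e (G j) x))\<^sup>2) \<partial>lborel) \<le> ennreal (N ^ ?n * (4 * \<epsilon>\<^sup>2))"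
        using expansion_projection_bound[OF e tL2 ortho GL2 _ s, of j] G1 ennreal_leI[OF Gs]
        by (meson order_trans)
      define \<delta> where "\<delta> = C / (1 + 2 ^ j)"
      have exp_meas [measurable]: "expansion e (G j) \<in> borel_measurable borel"
        unfolding expansion_def by measurable
      have [measurable]: "A j \<in> sets borel"
      proof -
        have "A j = (\<Inter>i. {x. 0 \<le> x $ i} \<inter> {x. x $ i < real (2 ^ j)})" unfolding A_def by auto
        also have "\<dots> \<in> sets borel"
          by (intro sets.finite_INT sets.Int borel_closed borel_open closed_Collect_le open_Collect_less continuous_intros) auto
        finally show ?thesis .
      qed
      have Nn: "of_nat ((2 ^ j) ^ ?n) = ennreal (N ^ ?n)"
        by (simp add: N_def ennreal_of_nat_eq_real_of_nat)
      have volA: "emeasure lborel (A j) \<le> ennreal (N ^ ?n)"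
      proof -
        have "emeasure lborel (A j) = (\<integral>\<^sup>+ x. 1 * indicator (A j) x \<partial>lborel)" by simp
        also have "\<dots> = of_nat ((2 ^ j) ^ ?n) * (\<integral>\<^sup>+ x. 1 * indicator Q x \<partial>lborel)"
          unfolding A_def Q_def by (rule nn_integral_periodic) auto
        also have "\<dots> = ennreal (N ^ ?n) * emeasure lborel Q" unfolding Nn by simp
        also have "\<dots> \<le> ennreal (N ^ ?n) * 1"
          using unit_cube_bounds(2) unfolding Q_def by (intro mult_left_mono) auto
        finally show ?thesis by simp
      qed
      \<comment> \<open>Periodicity of h spreads the integral over one cell to the N^n cells of the
        cube, where \<open>G j\<close> equals 1 and \<open>near\<close> applies.\<close>
      have "ennreal (N ^ ?n) * K = (\<integral>\<^sup>+ x. ennreal ((cmod (1 - h x))\<^sup>2) * indicator (A j) x \<partial>lborel)"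
        unfolding K_def A_def Q_def Nn[symmetric]
        by (rule nn_integral_periodic[symmetric]) (auto simp: h_per)
      also have "\<dots> \<le> (\<integral>\<^sup>+ x. ennreal 2 * ennreal ((cmod (G j x - expansion e (G j) x))\<^sup>2) +
          ennreal (2 * \<delta>\<^sup>2) * indicator (A j) x \<partial>lborel)"
      proof (rule nn_integral_mono)
        fix x :: "real^'n"
        show "ennreal ((cmod (1 - h x))\<^sup>2) * indicator (A j) x \<le>
          ennreal 2 * ennreal ((cmod (G j x - expansion e (G j) x))\<^sup>2) + ennreal (2 * \<delta>\<^sup>2) * indicator (A j) x"
        proof (cases "x \<in> A j")
          case True
          have "norm x \<le> (\<Sum>i\<in>UNIV. \<bar>x $ i\<bar>)" by (rule norm_le_l1_cart)
          also have "\<dots> \<le> (\<Sum>i\<in>(UNIV::'n set). 2 ^ j)"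
            using True unfolding A_def by (intro sum_mono) (auto intro: less_imp_le)
          also have "\<dots> < (real ?n + 1) * 2 ^ j" by (simp add: algebra_simps)
          finally have G1': "G j x = 1" by (simp add: G_def)
          have "(cmod (1 - h x))\<^sup>2 \<le> 2 * (cmod (1 - expansion e (G j) x))\<^sup>2 + 2 * (cmod (expansion e (G j) x - h x))\<^sup>2"
            using norm_add_square_le[of "1 - expansion e (G j) x" "expansion e (G j) x - h x"] by simp
          also have "(cmod (expansion e (G j) x - h x))\<^sup>2 \<le> \<delta>\<^sup>2"
            using near[OF True] unfolding \<delta>_def by (intro power_mono) (auto simp: norm_minus_commute)
          finally have "(cmod (1 - h x))\<^sup>2 \<le> 2 * (cmod (G j x - expansion e (G j) x))\<^sup>2 + 2 * \<delta>\<^sup>2"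
            using G1' by simp
          then have "ennreal ((cmod (1 - h x))\<^sup>2) \<le> ennreal (2 * (cmod (G j x - expansion e (G j) x))\<^sup>2 + 2 * \<delta>\<^sup>2)"
            by (rule ennreal_leI)
          also have "\<dots> = ennreal 2 * ennreal ((cmod (G j x - expansion e (G j) x))\<^sup>2) + ennreal (2 * \<delta>\<^sup>2)"
            by (subst ennreal_plus) (auto simp: ennreal_mult)
          finally show ?thesis using True by simp
        qed simp
      qed
      also have "\<dots> = ennreal 2 * (\<integral>\<^sup>+ x. ennreal ((cmod (G j x - expansion e (G j) x))\<^sup>2) \<partial>lborel) +
          ennreal (2 * \<delta>\<^sup>2) * emeasure lborel (A j)"
        by (subst nn_integral_add) (auto simp: nn_integral_cmult nn_integral_cmult_indicator)
      also have "\<dots> \<le> ennreal 2 * ennreal (N ^ ?n * (4 * \<epsilon>\<^sup>2)) + ennreal (2 * \<delta>\<^sup>2) * ennreal (N ^ ?n)"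
        by (intro add_mono mult_left_mono proj volA) auto
      also have "\<dots> = ennreal (2 * (N ^ ?n * (4 * \<epsilon>\<^sup>2))) + ennreal (2 * \<delta>\<^sup>2 * N ^ ?n)"
        using N by (intro arg_cong2[where f="(+)"] ennreal_mult[symmetric]) auto
      also have "\<dots> = ennreal (2 * (N ^ ?n * (4 * \<epsilon>\<^sup>2)) + 2 * \<delta>\<^sup>2 * N ^ ?n)"
        using N by (intro ennreal_plus[symmetric]) auto
      also have "\<dots> = ennreal (N ^ ?n * (8 * \<epsilon>\<^sup>2 + 2 * \<delta>\<^sup>2))"
        by (simp add: algebra_simps)
      also have "\<dots> = ennreal (N ^ ?n) * ennreal (8 * \<epsilon>\<^sup>2 + 2 * \<delta>\<^sup>2)"
        using N by (intro ennreal_mult) auto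
      finally have "ennreal (N ^ ?n) * K \<le> ennreal (N ^ ?n) * ennreal (8 * \<epsilon>\<^sup>2 + 2 * \<delta>\<^sup>2)" .
      then show ?thesis
        using N by (subst (asm) ennreal_mult_le_mult_iff) (auto simp: \<delta>_def)
    qed
    have "(\<lambda>j. 1 / (1 + 2 ^ j :: real)) \<longlonglongrightarrow> 0"
    proof (rule tendsto_sandwich[of "\<lambda>_. 0" _ _ "\<lambda>j. (1/2) ^ j"])
      show "\<forall>\<^sub>F j in sequentially. 1 / (1 + 2 ^ j) \<le> ((1/2) ^ j :: real)"
        by (intro always_eventually allI) (simp add: power_one_over frac_le)
      show "(\<lambda>j. (1/2) ^ j :: real) \<longlonglongrightarrow> 0" by (rule LIMSEQ_power_zero) simp
    qed (auto intro!: always_eventually)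
    then have "(\<lambda>j. 8 * \<epsilon>\<^sup>2 + 2 * (C * (1 / (1 + 2 ^ j)))\<^sup>2) \<longlonglongrightarrow> 8 * \<epsilon>\<^sup>2 + 2 * (C * 0)\<^sup>2"
      by (intro tendsto_intros)
    then have "(\<lambda>j. ennreal (8 * \<epsilon>\<^sup>2 + 2 * (C / (1 + 2 ^ j))\<^sup>2)) \<longlonglongrightarrow> ennreal (8 * \<epsilon>\<^sup>2)"
      by (intro tendsto_ennrealI) simp
    then show ?thesis
      by (rule LIMSEQ_le_const) (use main in blast)
  qed
  have "K \<le> 0"
  proof (rule ennreal_le_epsilon)
    fix \<epsilon> :: real assume "0 < \<epsilon>"
    then show "K \<le> 0 + ennreal \<epsilon>" using K_bound[of "sqrt (\<epsilon> / 8)"] by simp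
  qed
  then have "AE x in lborel. ennreal ((cmod (1 - h x))\<^sup>2) * indicator Q x = 0"
    unfolding K_def by (subst (asm) le_zero_eq, subst (asm) nn_integral_0_iff_AE) auto
  then have AE: "AE x in lborel. x \<notin> box 0 One \<inter> {x. h x \<noteq> 1}"
  proof eventually_elim
    case (elim x)
    then show ?case
      using unit_cube_bounds(1)[where 'n='n] by (auto simp: Q_def indicator_def split: if_splits)
  qed
  \<comment> \<open>From almost everywhere to everywhere: by continuity the exceptional set in the
    open cell is open, so being null it is empty, and the faces follow by closure.\<close>
  have "open (box 0 One \<inter> {x. h x \<noteq> 1})"
    by (intro open_Int open_box open_Collect_neq h_cont continuous_intros)
  from open_AE_empty[OF this AE] have sub: "box 0 One \<subseteq> {x. h x = 1}" by blast
  have "closed {x. h x = 1}" by (intro closed_Collect_eq h_cont continuous_intros)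
  then have "closure (box 0 One) \<subseteq> {x. h x = 1}" using sub by (rule closure_minimal[rotated])
  moreover have "box 0 (One :: real^'n) \<noteq> {}" by (simp add: box_ne_empty inner_sum_left_Basis)
  ultimately have unit: "h x = 1" if "x \<in> cbox 0 One" for x
    using that by auto
  \<comment> \<open>Subtracting coordinatewise floors moves x into the closed unit cell.\<close>
  define m :: "int^'n" where "m = (\<chi> i. \<lfloor>x $ i\<rfloor>)"
  have "x - lattice_point m \<in> cbox 0 One"
    unfolding mem_box
  proof
    fix i :: "real^'n" assume i: "i \<in> Basis"
    then obtain k where k: "i = axis k 1" by (auto simp: Basis_vec_def)
    have "0 \<le> x $ k - \<lfloor>x $ k\<rfloor> \<and> x $ k - \<lfloor>x $ k\<rfloor> \<le> 1" by linarith
    then show "0 \<bullet> i \<le> (x - lattice_point m) \<bullet> i \<and> (x - lattice_point m) \<bullet> i \<le> One \<bullet> i"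
      using i by (simp add: k inner_axis sum_Basis_component m_def lattice_point_def)
  qed
  from unit[OF this] have "h (lattice_point m + (x - lattice_point m)) = 1" by (simp only: h_per)
  then show ?thesis by (simp add: h_eq)
qed

end

section \<open>Convergence of the multiresolution expansion\<close>

context decay_weight
begin

theorem mra_expansion_tendsto:
  fixes \<phi> :: "real^'n::finite \<Rightarrow> complex" and \<gamma> :: complex
  assumes V: "MRA V" "scaling_function V \<phi>"
    and \<phi>: "\<phi> \<in> rapid r" and f: "f \<in> continuous_dual (rapid r) (weight_norm r)"
    and pv: "point_value_order_le r f x0 \<gamma>"
  shows "((\<lambda>l. mra_expansion \<phi> l f x0) \<longlongrightarrow> \<gamma>) at_top"
proof -
  interpret rapidly_decaying \<phi>
  proof
    show "continuous_on UNIV \<phi>" using \<phi> Cr_bound_continuous unfolding rapid_iff by blast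
    show "\<exists>B. \<forall>x. cmod (\<phi> x) \<le> B / (1 + norm x) ^ p" for p
    proof -
      obtain B where "Cr_bound r (\<lambda>x. B / (1 + norm x) ^ p) \<phi>"
        by (rule rapid_poly'[OF \<phi>]) (rule that)
      from Cr_bound_le[OF this] show ?thesis by blast
    qed
  qed
  \<comment> \<open>The kernel recentred at s x0. \<open>q0_kernel_bound\<close> is uniform in the
    base point, so the bounds on this family do not depend on s.\<close>
  define \<kappa> where "\<kappa> s z = q0_kernel \<phi> (s *\<^sub>R x0) (z + s *\<^sub>R x0)" for s z
  have \<kappa>: "\<exists>B. \<forall>s. Cr_bound r (\<lambda>z. B / W l (norm z)) (\<kappa> s)" for l
  proof -
    obtain B where B: "\<And>x. Cr_bound r (\<lambda>y. B / W l (norm (x - y))) (q0_kernel \<phi> x)"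
      by (rule q0_kernel_bound[OF \<phi>]) (rule that)
    have "Cr_bound r (\<lambda>z. B / W l (norm z)) (\<kappa> s)" for s
      using Cr_bound_affine[OF B, of 1 "s *\<^sub>R x0" "s *\<^sub>R x0"] unfolding \<kappa>_def by simp
    then show ?thesis by blast
  qed
  have int: "(LINT z|lebesgue. \<kappa> s z) = 1" for s
  proof -
    obtain B where B: "\<And>x. Cr_bound r (\<lambda>y. B / W 0 (norm (x - y))) (q0_kernel \<phi> x)"
      by (rule q0_kernel_bound[OF \<phi>]) (rule that)
    have "q0_kernel \<phi> (s *\<^sub>R x0) \<in> borel_measurable lebesgue"
      using Cr_bound_continuous[OF B] by (rule continuous_borel_measurable_lebesgue)
    from lebesgue_integral_affine[OF _ this, of 1 "s *\<^sub>R x0"]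
    show ?thesis
      using q0_kernel_integral[OF V, of "s *\<^sub>R x0"] by (simp add: \<kappa>_def add.commute)
  qed
  \<comment> \<open>For l \<ge> 0 the scale s = 2^l is at least 1, so the dilated kernel is rapidly
    decreasing and f is homogeneous on it; s^n is the normalising factor of both the pairing and
    \<open>q_kernel\<close>.\<close>
  have eq: "dilated_pairing f x0 (1 / 2 powr l) (\<kappa> (2 powr l)) = mra_expansion \<phi> l f x0" if l: "0 \<le> l" for l
  proof -
    define s where "s = 2 powr l"
    have s: "1 \<le> s" using l by (simp add: s_def ge_one_powr_ge_zero)
    have "\<kappa> s \<in> rapid r" using \<kappa> unfolding rapid_iff by blast
    then have "(\<lambda>y. \<kappa> s (s *\<^sub>R (y - x0))) \<in> rapid r" by (rule rapid_dilate[OF _ s])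
    from continuous_dual_cmult[OF f this, of "of_real (s ^ CARD('n))"]
    have "dilated_pairing f x0 (1 / s) (\<kappa> s) = f (\<lambda>y. of_real (s ^ CARD('n)) * \<kappa> s (s *\<^sub>R (y - x0)))"
      using s by (simp add: dilated_pairing_inverse)
    moreover have "2 powr (real CARD('n) * l) = s ^ CARD('n)"
      by (simp add: s_def powr_powr powr_realpow[symmetric] mult.commute)
    ultimately show ?thesis
      unfolding mra_expansion_def q_kernel_def \<kappa>_def by (simp add: s_def[symmetric] algebra_simps)
  qed
  have "filterlim (\<lambda>l::real. exp (ln 2 * l)) at_top at_top"
    by (intro filterlim_compose[OF exp_at_top] filterlim_tendsto_pos_mult_at_top[OF tendsto_const _ filterlim_ident]) simp
  then have "filterlim (\<lambda>l::real. 2 powr l) at_top at_top"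
    by (simp add: powr_def mult.commute)
  from filterlim_compose[OF dilated_pairing_tendsto[OF f pv \<kappa> int] this]
  have "((\<lambda>l. dilated_pairing f x0 (1 / 2 powr l) (\<kappa> (2 powr l))) \<longlongrightarrow> \<gamma>) at_top" .
  then show ?thesis
    by (rule Lim_transform_eventually)
      (use eventually_ge_at_top[of "0::real"] in eventually_elim, rule eq)
qed

end

theorem theorem4p4:
  fixes r :: nat
    and M :: "real \<Rightarrow> real"
    and V :: "int \<Rightarrow> (real^'n::finite \<Rightarrow> complex) set"
    and \<phi> :: "real^'n \<Rightarrow> complex"
    and f :: "(real^'n \<Rightarrow> complex) \<Rightarrow> complex"
    and x0 :: "real^'n"
    and \<gamma> :: complex
  assumes "MRA V" and "scaling_function V \<phi>"
    and "(weight_function M \<and> \<phi> \<in> KM_space M r \<and> f \<in> KM_dual M r) \<or>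
         (\<phi> \<in> S_space r \<and> f \<in> S_dual r)"
    and "has_point_value f x0 \<gamma>" and "point_value_order_le r f x0 \<gamma>"
  shows "((\<lambda>l. mra_expansion \<phi> l f x0) \<longlongrightarrow> \<gamma>) at_top"
  \<comment> \<open>The two alternatives are the instances with weights exp (M (l t)) and (1 +
    t)^l.\<close>
  using assms(3)
proof
  assume "weight_function M \<and> \<phi> \<in> KM_space M r \<and> f \<in> KM_dual M r"
  then have M: "weight_function M" and "\<phi> \<in> KM_space M r" "f \<in> KM_dual M r" by auto
  then show ?thesis
    using decay_weight.mra_expansion_tendsto[OF decay_weight_exp[OF M] assms(1,2) _ _ assms(5)]
    by (simp add: KM_space_eq[OF M])
next
  assume "\<phi> \<in> S_space r \<and> f \<in> S_dual r"
  then show ?thesis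
    using poly_weight.mra_expansion_tendsto[OF assms(1,2) _ _ assms(5)]
    by (simp add: S_space_eq S_dual_eq)
qed

end
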